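(* Let $M$ be a STCR lightlike submanifold of an indefinite Kähler manifold $\bar M$. Then $D$ defines a totally geodesic foliation on $M$ if and only if $Bh(X,\bar JY)=0$ for all $X,Y\in\Gamma(D)$.
   Context: Indefinite Kähler manifold $(\bar M,\bar J,\bar g)$: a semi-Riemannian manifold of constant index $q$, $0<q<\dim\bar M$, with an almost complex structure $\bar J$ ($\bar J^2=-I$) satisfying $\bar g(\bar JX,\bar JY)=\bar g(X,Y)$ and $\bar\nabla\bar J=0$, where $\bar\nabla$ is the Levi-Civita connection of $\bar g$. Lightlike submanifold: a submanifold $M$ of dimension $m$ of $\bar M$ (of dimension $m+n$), with induced metric $g$, such that $Rad(TM)=TM\cap TM^\perp$ has constant rank $r$, $1\le r\le m$. One fixes non-degenerate complements: a screen distribution $S(TM)$ with $TM=S(TM)\perp Rad(TM)$ and a screen transversal bundle $S(TM^\perp)$ with $TM^\perp=S(TM^\perp)\perp Rad(TM)$. The lightlike transversal bundle $ltr(TM)$ is a rank $r$ complement of $Rad(TM)$ in the orthogonal complement of $S(TM)\perp S(TM^\perp)$ in $T\bar M|_M$, locally spanned by $N_1,\dots,N_r$ with $\bar g(\xi_i,N_j)=\delta_{ij}$, $\bar g(N_i,N_j)=0$ for a local basis $\{\xi_i\}$ of $Rad(TM)$. Put $tr(TM)=ltr(TM)\perp S(TM^\perp)$; then $T\bar M|_M=TM\oplus tr(TM)$. STCR (screen transversal Cauchy Riemann) lightlike submanifold: a real lightlike submanifold $M$ of $\bar M$ such that (A) there are subbundles $D_1,D_2$ of $Rad(TM)$ with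 $Rad(TM)=D_1\oplus D_2$, $\bar J(D_1)\subset S(TM)$, $\bar J(D_2)\subset S(TM^\perp)$; (B) there are subbundles $D_0,D'$ of $S(TM)$ with $S(TM)=\{\bar JD_1\oplus D'\}\perp D_0$, $\bar J(D_0)=D_0$, $\bar J(D')=L_1\perp S$, where $D_0$ is non-degenerate and $L_1$, $S$ are vector subbundles of $ltr(TM)$ and $S(TM^\perp)$ respectively. Moreover $ltr(TM)=L_1\oplus L_2$ with $\bar J(L_1)\subset S(TM)$, $\bar J(L_2)\subset S(TM^\perp)$, and $S(TM^\perp)=\{\bar J(D_2)\oplus\bar J(L_2)\}\perp S$. Then $TM=D\oplus\tilde D$, where $D=D_0\oplus D_1\oplus\bar JD_1$ is $\bar J$-invariant and $\tilde D=D_2\oplus\bar JL_1\oplus\bar JS$ satisfies $\bar J\tilde D\subset tr(TM)$. Gauss formula: $\bar\nabla_XY=\nabla_XY+h(X,Y)$ for $X,Y\in\Gamma(TM)$, with $\nabla_XY\in\Gamma(TM)$, $h(X,Y)\in\Gamma(tr(TM))$. For $V\in\Gamma(tr(TM))$, $BV$ denotes the $TM$-component of $\bar JV$ in $T\bar M|_M=TM\oplus tr(TM)$. $D$ defines a totally geodesic foliation on $M$ if $\nabla_XY\in\Gamma(D)$ for all $X,Y\in\Gamma(D)$. *)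

theory Defs
  imports "HOL-Analysis.Analysis"
begin

section \<open>Smooth manifolds\<close>

text \<open>
  For an open set \<open>S\<close>, \<open>Ck_on k S f\<close> says that \<open>f\<close> is \<open>k\<close> times continuously differentiable on \<open>S\<close>:
  \<open>f\<close> is Frechet differentiable and every directional derivative is of class \<open>k - 1\<close>.
\<close>

fun Ck_on :: "nat \<Rightarrow> 'a::euclidean_space set \<Rightarrow> ('a \<Rightarrow> 'b::real_normed_vector) \<Rightarrow> bool" where
  "Ck_on 0 S f \<longleftrightarrow> continuous_on S f"
| "Ck_on (Suc k) S f \<longleftrightarrow>
     (\<exists>f'. (\<forall>x\<in>S. (f has_derivative f' x) (at x)) \<and> (\<forall>v. Ck_on k S (\<lambda>x. f' x v)))"

definition smooth_on :: "'a::euclidean_space set \<Rightarrow> ('a \<Rightarrow> 'b::real_normed_vector) \<Rightarrow> bool" where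
  "smooth_on S f \<longleftrightarrow> (\<forall>k. Ck_on k S f)"

text \<open>A chart is a pair of its domain and its coordinate map.\<close>

type_synonym ('a, 'e) chart = "'a set \<times> ('a \<Rightarrow> 'e)"

definition chart_inv :: "('a, 'e) chart \<Rightarrow> 'e \<Rightarrow> 'a" where
  "chart_inv c = inv_into (fst c) (snd c)"

definition is_chart :: "('a::topological_space, 'e::euclidean_space) chart \<Rightarrow> bool" where
  "is_chart c \<longleftrightarrow> open (fst c) \<and> open (snd c ` fst c) \<and>
     homeomorphism (fst c) (snd c ` fst c) (snd c) (chart_inv c)"

text \<open>
  A smooth manifold is a type with a Hausdorff, second countable topology and a smooth atlas; its
  dimension is the dimension of the model space \<open>'e\<close>.
\<close>

definition smooth_atlas ::
  "('a::{t2_space, second_countable_topology}, 'e::euclidean_space) chart set \<Rightarrow> bool" where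
  "smooth_atlas A \<longleftrightarrow> (\<forall>c\<in>A. is_chart c) \<and> (\<Union>c\<in>A. fst c) = UNIV \<and>
     (\<forall>c\<in>A. \<forall>d\<in>A. smooth_on (snd c ` (fst c \<inter> fst d)) (snd d \<circ> chart_inv c))"

text \<open>
  The tangent space at \<open>p\<close> is the model space \<open>'e\<close>: a tangent vector is represented by its
  coordinates in the preferred chart \<open>chart_at A p\<close>. The preferred chart may jump with \<open>p\<close>, so a
  field of tangent vectors is a function into \<open>'e\<close> whose smoothness must be tested after passing
  to the coordinates \<open>tan_coord A c\<close> of a fixed chart \<open>c\<close>.
\<close>

definition chart_at :: "('a, 'e) chart set \<Rightarrow> 'a \<Rightarrow> ('a, 'e) chart" where
  "chart_at A p = (SOME c. c \<in> A \<and> p \<in> fst c)"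

definition tan_coord ::
  "('a, 'e::euclidean_space) chart set \<Rightarrow> ('a, 'e) chart \<Rightarrow> 'a \<Rightarrow> 'e \<Rightarrow> 'e" where
  "tan_coord A c p v =
     frechet_derivative (snd c \<circ> chart_inv (chart_at A p)) (at (snd (chart_at A p) p)) v"

text \<open>The vector field on the domain of \<open>c\<close> with constant coordinates \<open>u\<close> in the chart \<open>c\<close>.\<close>

definition const_field ::
  "('a, 'e::euclidean_space) chart set \<Rightarrow> ('a, 'e) chart \<Rightarrow> 'e \<Rightarrow> 'a \<Rightarrow> 'e" where
  "const_field A c u q =
     frechet_derivative (snd (chart_at A q) \<circ> chart_inv c) (at (snd c q)) u"

definition dir_deriv ::
  "('a, 'e::euclidean_space) chart set \<Rightarrow> 'a \<Rightarrow> 'e \<Rightarrow> ('a \<Rightarrow> 'c::real_normed_vector) \<Rightarrow> 'c" where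
  "dir_deriv A p v f =
     frechet_derivative (f \<circ> chart_inv (chart_at A p)) (at (snd (chart_at A p) p)) v"

definition tan_map ::
  "('b, 'f::euclidean_space) chart set \<Rightarrow> ('a, 'e::euclidean_space) chart set \<Rightarrow>
     ('b \<Rightarrow> 'a) \<Rightarrow> 'b \<Rightarrow> 'f \<Rightarrow> 'e" where
  "tan_map B A f p w =
     frechet_derivative (snd (chart_at A (f p)) \<circ> f \<circ> chart_inv (chart_at B p))
       (at (snd (chart_at B p) p)) w"

definition smooth_map ::
  "('b::topological_space, 'f::euclidean_space) chart set \<Rightarrow>
     ('a::topological_space, 'e::euclidean_space) chart set \<Rightarrow> ('b \<Rightarrow> 'a) \<Rightarrow> bool" where
  "smooth_map B A f \<longleftrightarrow> continuous_on UNIV f \<and>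
     (\<forall>d\<in>B. \<forall>c\<in>A. smooth_on (snd d ` (fst d \<inter> f -` fst c)) (snd c \<circ> f \<circ> chart_inv d))"

definition smooth_fun ::
  "('a, 'e::euclidean_space) chart set \<Rightarrow> 'a set \<Rightarrow> ('a \<Rightarrow> real) \<Rightarrow> bool" where
  "smooth_fun A U f \<longleftrightarrow> (\<forall>c\<in>A. smooth_on (snd c ` (fst c \<inter> U)) (f \<circ> chart_inv c))"

text \<open>
  \<open>V\<close> is a smooth section over the open set \<open>U\<close> of the pull-back along \<open>f\<close> of the tangent bundle of
  the target; \<open>V p\<close> is a tangent vector at \<open>f p\<close>.
\<close>

definition smooth_along ::
  "('b, 'f::euclidean_space) chart set \<Rightarrow> ('a, 'e::euclidean_space) chart set \<Rightarrow> ('b \<Rightarrow> 'a) \<Rightarrow>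
     'b set \<Rightarrow> ('b \<Rightarrow> 'e) \<Rightarrow> bool" where
  "smooth_along B A f U V \<longleftrightarrow> (\<forall>d\<in>B. \<forall>c\<in>A.
     smooth_on (snd d ` (fst d \<inter> U \<inter> f -` fst c))
       (\<lambda>x. tan_coord A c (f (chart_inv d x)) (V (chart_inv d x))))"

abbreviation smooth_field ::
  "('a, 'e::euclidean_space) chart set \<Rightarrow> 'a set \<Rightarrow> ('a \<Rightarrow> 'e) \<Rightarrow> bool" where
  "smooth_field A U X \<equiv> smooth_along A A (\<lambda>p. p) U X"

definition smooth_fun_near ::
  "('a::topological_space, 'e::euclidean_space) chart set \<Rightarrow> 'a \<Rightarrow> ('a \<Rightarrow> real) \<Rightarrow> bool" where
  "smooth_fun_near A p f \<longleftrightarrow> (\<exists>U. open U \<and> p \<in> U \<and> smooth_fun A U f)"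

definition smooth_field_near ::
  "('a::topological_space, 'e::euclidean_space) chart set \<Rightarrow> 'a \<Rightarrow> ('a \<Rightarrow> 'e) \<Rightarrow> bool" where
  "smooth_field_near A p X \<longleftrightarrow> (\<exists>U. open U \<and> p \<in> U \<and> smooth_field A U X)"

text \<open>\<open>[X, Y] = DY(X) - DX(Y)\<close> in the coordinates of the preferred chart at the point.\<close>

definition lie_bracket ::
  "('a, 'e::euclidean_space) chart set \<Rightarrow> ('a \<Rightarrow> 'e) \<Rightarrow> ('a \<Rightarrow> 'e) \<Rightarrow> 'a \<Rightarrow> 'e" where
  "lie_bracket A X Y p =
     dir_deriv A p (X p) (\<lambda>q. tan_coord A (chart_at A p) q (Y q)) -
     dir_deriv A p (Y p) (\<lambda>q. tan_coord A (chart_at A p) q (X q))"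

section \<open>Indefinite Kaehler manifolds\<close>

definition nondegenerate_on :: "'e::real_vector set \<Rightarrow> ('e \<Rightarrow> 'e \<Rightarrow> real) \<Rightarrow> bool" where
  "nondegenerate_on W b \<longleftrightarrow> (\<forall>v\<in>W. (\<forall>w\<in>W. b v w = 0) \<longrightarrow> v = 0)"

text \<open>The index of a symmetric bilinear form: the largest dimension of a negative definite subspace.\<close>

definition form_index :: "('e::euclidean_space \<Rightarrow> 'e \<Rightarrow> real) \<Rightarrow> nat" where
  "form_index b = Max {dim W | W. subspace W \<and> (\<forall>w\<in>W. w \<noteq> 0 \<longrightarrow> b w w < 0)}"

definition semi_riemannian_metric ::
  "('a::topological_space, 'e::euclidean_space) chart set \<Rightarrow> ('a \<Rightarrow> 'e \<Rightarrow> 'e \<Rightarrow> real) \<Rightarrow>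
     nat \<Rightarrow> bool" where
  "semi_riemannian_metric A g q \<longleftrightarrow>
     (\<forall>p. bilinear (g p) \<and> (\<forall>v w. g p v w = g p w v) \<and> nondegenerate_on UNIV (g p) \<and>
        form_index (g p) = q) \<and>
     (\<forall>U X Y. open U \<longrightarrow> smooth_field A U X \<longrightarrow> smooth_field A U Y \<longrightarrow>
        smooth_fun A U (\<lambda>p. g p (X p) (Y p)))"

text \<open>
  A linear connection as an operator on local vector fields: \<open>nab p v Y\<close> is the covariant derivative
  at \<open>p\<close>, in the direction of the tangent vector \<open>v\<close> at \<open>p\<close>, of a field \<open>Y\<close> that is smooth near \<open>p\<close>.
  Nothing is required when \<open>Y\<close> is not smooth near \<open>p\<close>. Locality in \<open>Y\<close> is a consequence of the
  Leibniz rule, since the indicator function of a neighbourhood of \<open>p\<close> is smooth near \<open>p\<close>.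
\<close>

definition linear_connection ::
  "('a::topological_space, 'e::euclidean_space) chart set \<Rightarrow> ('a \<Rightarrow> 'e \<Rightarrow> ('a \<Rightarrow> 'e) \<Rightarrow> 'e) \<Rightarrow>
     bool" where
  "linear_connection A nab \<longleftrightarrow>
     (\<forall>p Y. smooth_field_near A p Y \<longrightarrow> linear (\<lambda>v. nab p v Y)) \<and>
     (\<forall>p v Y Z. smooth_field_near A p Y \<longrightarrow> smooth_field_near A p Z \<longrightarrow>
        nab p v (\<lambda>q. Y q + Z q) = nab p v Y + nab p v Z) \<and>
     (\<forall>p v f Y. smooth_fun_near A p f \<longrightarrow> smooth_field_near A p Y \<longrightarrow>
        nab p v (\<lambda>q. f q *\<^sub>R Y q) = dir_deriv A p v f *\<^sub>R Y p + f p *\<^sub>R nab p v Y) \<and>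
     (\<forall>U X Y. open U \<longrightarrow> smooth_field A U X \<longrightarrow> smooth_field A U Y \<longrightarrow>
        smooth_field A U (\<lambda>p. nab p (X p) Y))"

definition levi_civita ::
  "('a::topological_space, 'e::euclidean_space) chart set \<Rightarrow> ('a \<Rightarrow> 'e \<Rightarrow> 'e \<Rightarrow> real) \<Rightarrow>
     ('a \<Rightarrow> 'e \<Rightarrow> ('a \<Rightarrow> 'e) \<Rightarrow> 'e) \<Rightarrow> bool" where
  "levi_civita A g nab \<longleftrightarrow> linear_connection A nab \<and>
     (\<forall>p X Y. smooth_field_near A p X \<longrightarrow> smooth_field_near A p Y \<longrightarrow>
        nab p (X p) Y - nab p (Y p) X = lie_bracket A X Y p) \<and>
     (\<forall>p v Y Z. smooth_field_near A p Y \<longrightarrow> smooth_field_near A p Z \<longrightarrow>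
        dir_deriv A p v (\<lambda>q. g q (Y q) (Z q)) = g p (nab p v Y) (Z p) + g p (Y p) (nab p v Z))"

definition almost_complex_structure ::
  "('a::topological_space, 'e::euclidean_space) chart set \<Rightarrow> ('a \<Rightarrow> 'e \<Rightarrow> 'e) \<Rightarrow> bool" where
  "almost_complex_structure A J \<longleftrightarrow>
     (\<forall>p. linear (J p) \<and> (\<forall>v. J p (J p v) = - v)) \<and>
     (\<forall>U X. open U \<longrightarrow> smooth_field A U X \<longrightarrow> smooth_field A U (\<lambda>p. J p (X p)))"

text \<open>The last conjunct is \<open>(\<nabla>\<^sub>v J) Y = \<nabla>\<^sub>v (J Y) - J (\<nabla>\<^sub>v Y) = 0\<close>.\<close>

definition indefinite_kaehler ::
  "('a::{t2_space, second_countable_topology}, 'e::euclidean_space) chart set \<Rightarrow>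
     ('a \<Rightarrow> 'e \<Rightarrow> 'e) \<Rightarrow> ('a \<Rightarrow> 'e \<Rightarrow> 'e \<Rightarrow> real) \<Rightarrow> nat \<Rightarrow>
     ('a \<Rightarrow> 'e \<Rightarrow> ('a \<Rightarrow> 'e) \<Rightarrow> 'e) \<Rightarrow> bool" where
  "indefinite_kaehler A J g q nab \<longleftrightarrow>
     smooth_atlas A \<and> 0 < q \<and> q < DIM('e) \<and> semi_riemannian_metric A g q \<and>
     levi_civita A g nab \<and> almost_complex_structure A J \<and>
     (\<forall>p v w. g p (J p v) (J p w) = g p v w) \<and>
     (\<forall>p v Y. smooth_field_near A p Y \<longrightarrow> nab p v (\<lambda>q. J q (Y q)) = J p (nab p v Y))"

section \<open>Lightlike submanifolds\<close>

text \<open>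
  An (immersed) submanifold is the manifold \<open>'b\<close> with the injective immersion \<open>i\<close>. A bundle \<open>E\<close> over
  it assigns to each \<open>p\<close> a subspace \<open>E p\<close> of the tangent space of the ambient manifold at \<open>i p\<close>;
  in particular the tangent bundle consists of the images of the differential of \<open>i\<close>.
\<close>

definition immersed_submanifold ::
  "('b::{t2_space, second_countable_topology}, 'f::euclidean_space) chart set \<Rightarrow>
     ('a::{t2_space, second_countable_topology}, 'e::euclidean_space) chart set \<Rightarrow>
     ('b \<Rightarrow> 'a) \<Rightarrow> bool" where
  "immersed_submanifold B A i \<longleftrightarrow>
     smooth_atlas B \<and> smooth_map B A i \<and> inj i \<and> (\<forall>p. inj (tan_map B A i p))"

definition tangent_bundle ::
  "('b, 'f::euclidean_space) chart set \<Rightarrow> ('a, 'e::euclidean_space) chart set \<Rightarrow> ('b \<Rightarrow> 'a) \<Rightarrow>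
     'b \<Rightarrow> 'e set" where
  "tangent_bundle B A i p = range (tan_map B A i p)"

definition orth_bundle ::
  "('a \<Rightarrow> 'e \<Rightarrow> 'e \<Rightarrow> real) \<Rightarrow> ('b \<Rightarrow> 'a) \<Rightarrow> ('b \<Rightarrow> 'e set) \<Rightarrow> 'b \<Rightarrow> 'e set" where
  "orth_bundle g i E p = {v. \<forall>w\<in>E p. g (i p) v w = 0}"

definition rad_bundle ::
  "('b, 'f::euclidean_space) chart set \<Rightarrow> ('a, 'e::euclidean_space) chart set \<Rightarrow>
     ('a \<Rightarrow> 'e \<Rightarrow> 'e \<Rightarrow> real) \<Rightarrow> ('b \<Rightarrow> 'a) \<Rightarrow> 'b \<Rightarrow> 'e set" where
  "rad_bundle B A g i p = tangent_bundle B A i p \<inter> orth_bundle g i (tangent_bundle B A i) p"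

text \<open>
  A smooth subbundle of the pulled-back tangent bundle: of constant rank, with local smooth frames.
\<close>

definition subbundle ::
  "('b::topological_space, 'f::euclidean_space) chart set \<Rightarrow>
     ('a::topological_space, 'e::euclidean_space) chart set \<Rightarrow> ('b \<Rightarrow> 'a) \<Rightarrow>
     ('b \<Rightarrow> 'e set) \<Rightarrow> bool" where
  "subbundle B A i E \<longleftrightarrow> (\<exists>k. (\<forall>p. subspace (E p) \<and> dim (E p) = k) \<and>
     (\<forall>p. \<exists>U F. open U \<and> p \<in> U \<and> (\<forall>j<k. smooth_along B A i U (F j)) \<and>
        (\<forall>q\<in>U. E q = span ((\<lambda>j. F j q) ` {..<k}))))"

definition sections ::
  "('b, 'f::euclidean_space) chart set \<Rightarrow> ('a, 'e::euclidean_space) chart set \<Rightarrow> ('b \<Rightarrow> 'a) \<Rightarrow>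
     ('b \<Rightarrow> 'e set) \<Rightarrow> ('b \<Rightarrow> 'e) set" where
  "sections B A i E = {V. smooth_along B A i UNIV V \<and> (\<forall>p. V p \<in> E p)}"

definition bundle_sum :: "('b \<Rightarrow> 'e::real_vector set) \<Rightarrow> ('b \<Rightarrow> 'e set) \<Rightarrow> 'b \<Rightarrow> 'e set" where
  "bundle_sum E F p = {u + v | u v. u \<in> E p \<and> v \<in> F p}"

definition bundle_image :: "('a \<Rightarrow> 'e \<Rightarrow> 'e) \<Rightarrow> ('b \<Rightarrow> 'a) \<Rightarrow> ('b \<Rightarrow> 'e set) \<Rightarrow> 'b \<Rightarrow> 'e set" where
  "bundle_image J i E p = J (i p) ` E p"

text \<open>\<open>is_direct E F\<close>: the sum of \<open>E\<close> and \<open>F\<close> is direct.\<close>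

definition is_direct :: "('b \<Rightarrow> 'e::real_vector set) \<Rightarrow> ('b \<Rightarrow> 'e set) \<Rightarrow> bool" where
  "is_direct E F \<longleftrightarrow> (\<forall>p. E p \<inter> F p = {0})"

definition direct_decomp ::
  "('b \<Rightarrow> 'e::real_vector set) \<Rightarrow> ('b \<Rightarrow> 'e set) \<Rightarrow> ('b \<Rightarrow> 'e set) \<Rightarrow> bool" where
  "direct_decomp E F G \<longleftrightarrow> is_direct F G \<and> E = bundle_sum F G"

definition orth_decomp ::
  "('a \<Rightarrow> 'e::real_vector \<Rightarrow> 'e \<Rightarrow> real) \<Rightarrow> ('b \<Rightarrow> 'a) \<Rightarrow>
     ('b \<Rightarrow> 'e set) \<Rightarrow> ('b \<Rightarrow> 'e set) \<Rightarrow> ('b \<Rightarrow> 'e set) \<Rightarrow> bool" where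
  "orth_decomp g i E F G \<longleftrightarrow>
     direct_decomp E F G \<and> (\<forall>p. \<forall>u\<in>F p. \<forall>v\<in>G p. g (i p) u v = 0)"

text \<open>
  \<open>ST\<close>, \<open>STp\<close> and \<open>ltr\<close> are the chosen screen distribution, screen transversal bundle and
  lightlike transversal bundle, and \<open>r\<close> is the rank of the radical distribution.
\<close>

definition lightlike_submanifold ::
  "('b::{t2_space, second_countable_topology}, 'f::euclidean_space) chart set \<Rightarrow>
     ('a::{t2_space, second_countable_topology}, 'e::euclidean_space) chart set \<Rightarrow>
     ('a \<Rightarrow> 'e \<Rightarrow> 'e \<Rightarrow> real) \<Rightarrow> ('b \<Rightarrow> 'a) \<Rightarrow> nat \<Rightarrow>
     ('b \<Rightarrow> 'e set) \<Rightarrow> ('b \<Rightarrow> 'e set) \<Rightarrow> ('b \<Rightarrow> 'e set) \<Rightarrow> bool" where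
  "lightlike_submanifold B A g i r ST STp ltr \<longleftrightarrow>
     (let TM = tangent_bundle B A i; TMp = orth_bundle g i TM; Rad = rad_bundle B A g i in
     immersed_submanifold B A i \<and>
     1 \<le> r \<and> r \<le> DIM('f) \<and> (\<forall>p. dim (Rad p) = r) \<and>
     subbundle B A i ST \<and> (\<forall>p. nondegenerate_on (ST p) (g (i p))) \<and>
     orth_decomp g i TM ST Rad \<and>
     subbundle B A i STp \<and> (\<forall>p. nondegenerate_on (STp p) (g (i p))) \<and>
     orth_decomp g i TMp STp Rad \<and>
     direct_decomp (orth_bundle g i (bundle_sum ST STp)) Rad ltr \<and>
     (\<forall>p. \<exists>U xi N. open U \<and> p \<in> U \<and>
        (\<forall>j<r. smooth_along B A i U (xi j) \<and> smooth_along B A i U (N j)) \<and>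
        (\<forall>q\<in>U. Rad q = span ((\<lambda>j. xi j q) ` {..<r}) \<and> ltr q = span ((\<lambda>j. N j q) ` {..<r}) \<and>
           (\<forall>j<r. \<forall>k<r. g (i q) (xi j q) (N k q) = (if j = k then 1 else 0) \<and>
              g (i q) (N j q) (N k q) = 0))))"

abbreviation tr_bundle ::
  "('b \<Rightarrow> 'e::real_vector set) \<Rightarrow> ('b \<Rightarrow> 'e set) \<Rightarrow> 'b \<Rightarrow> 'e set" where
  "tr_bundle STp ltr \<equiv> bundle_sum ltr STp"

text \<open>
  The components of an ambient vector \<open>u\<close> at \<open>i p\<close> with respect to the direct sum of \<open>E p\<close> (first
  component) and \<open>F p\<close>; below, of the tangent bundle and the transversal bundle.
\<close>

definition component ::
  "('b \<Rightarrow> 'e::real_vector set) \<Rightarrow> ('b \<Rightarrow> 'e set) \<Rightarrow> 'b \<Rightarrow> 'e \<Rightarrow> 'e" where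
  "component E F p u = (THE a. a \<in> E p \<and> (\<exists>b\<in>F p. u = a + b))"

text \<open>
  The ambient connection applied to a section \<open>V\<close> along \<open>i\<close>, in the direction of a vector \<open>v\<close> tangent
  to the submanifold at \<open>p\<close>. If \<open>V = \<Sum>\<^sub>b V\<^sup>b (E\<^sub>b \<circ> i)\<close> in the coordinate frame \<open>(E\<^sub>b)\<close> of the preferred
  chart at \<open>i p\<close>, the value is \<open>\<Sum>\<^sub>b v(V\<^sup>b) E\<^sub>b + V\<^sup>b(p) \<nabla>\<^sub>v E\<^sub>b\<close>; the second summand is \<open>\<nabla>\<^sub>v\<close> of the field
  with constant coordinates \<open>V p\<close>. By the Leibniz rule this is \<open>nab (i p) v W\<close> for every local
  extension \<open>W\<close> of \<open>V\<close>.
\<close>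

definition cov_deriv_along ::
  "('b, 'f::euclidean_space) chart set \<Rightarrow> ('a, 'e::euclidean_space) chart set \<Rightarrow> ('b \<Rightarrow> 'a) \<Rightarrow>
     ('a \<Rightarrow> 'e \<Rightarrow> ('a \<Rightarrow> 'e) \<Rightarrow> 'e) \<Rightarrow> 'b \<Rightarrow> 'e \<Rightarrow> ('b \<Rightarrow> 'e) \<Rightarrow> 'e" where
  "cov_deriv_along B A i nab p v V =
     (let c = chart_at A (i p); w = (THE w. tan_map B A i p w = v) in
      dir_deriv B p w (\<lambda>q. tan_coord A c (i q) (V q)) + nab (i p) v (const_field A c (V p)))"

definition induced_conn ::
  "('b, 'f::euclidean_space) chart set \<Rightarrow> ('a, 'e::euclidean_space) chart set \<Rightarrow> ('b \<Rightarrow> 'a) \<Rightarrow>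
     ('a \<Rightarrow> 'e \<Rightarrow> ('a \<Rightarrow> 'e) \<Rightarrow> 'e) \<Rightarrow> ('b \<Rightarrow> 'e set) \<Rightarrow>
     ('b \<Rightarrow> 'e) \<Rightarrow> ('b \<Rightarrow> 'e) \<Rightarrow> 'b \<Rightarrow> 'e" where
  "induced_conn B A i nab tr X Y p =
     component (tangent_bundle B A i) tr p (cov_deriv_along B A i nab p (X p) Y)"

definition second_fund_form ::
  "('b, 'f::euclidean_space) chart set \<Rightarrow> ('a, 'e::euclidean_space) chart set \<Rightarrow> ('b \<Rightarrow> 'a) \<Rightarrow>
     ('a \<Rightarrow> 'e \<Rightarrow> ('a \<Rightarrow> 'e) \<Rightarrow> 'e) \<Rightarrow> ('b \<Rightarrow> 'e set) \<Rightarrow>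
     ('b \<Rightarrow> 'e) \<Rightarrow> ('b \<Rightarrow> 'e) \<Rightarrow> 'b \<Rightarrow> 'e" where
  "second_fund_form B A i nab tr X Y p =
     component tr (tangent_bundle B A i) p (cov_deriv_along B A i nab p (X p) Y)"

definition B_op ::
  "('b, 'f::euclidean_space) chart set \<Rightarrow> ('a, 'e::euclidean_space) chart set \<Rightarrow> ('b \<Rightarrow> 'a) \<Rightarrow>
     ('a \<Rightarrow> 'e \<Rightarrow> 'e) \<Rightarrow> ('b \<Rightarrow> 'e set) \<Rightarrow> ('b \<Rightarrow> 'e) \<Rightarrow> 'b \<Rightarrow> 'e" where
  "B_op B A i J tr V p = component (tangent_bundle B A i) tr p (J (i p) (V p))"

definition totally_geodesic_foliation ::
  "('b, 'f::euclidean_space) chart set \<Rightarrow> ('a, 'e::euclidean_space) chart set \<Rightarrow> ('b \<Rightarrow> 'a) \<Rightarrow>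
     ('a \<Rightarrow> 'e \<Rightarrow> ('a \<Rightarrow> 'e) \<Rightarrow> 'e) \<Rightarrow> ('b \<Rightarrow> 'e set) \<Rightarrow> ('b \<Rightarrow> 'e set) \<Rightarrow> bool" where
  "totally_geodesic_foliation B A i nab tr D \<longleftrightarrow>
     (\<forall>X\<in>sections B A i D. \<forall>Y\<in>sections B A i D.
        induced_conn B A i nab tr X Y \<in> sections B A i D)"

section \<open>STCR lightlike submanifolds\<close>

text \<open>\<open>D'\<close> is called \<open>Dp\<close> and \<open>S\<close> is called \<open>SS\<close>.\<close>

definition stcr_lightlike_submanifold ::
  "('b::{t2_space, second_countable_topology}, 'f::euclidean_space) chart set \<Rightarrow>
     ('a::{t2_space, second_countable_topology}, 'e::euclidean_space) chart set \<Rightarrow>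
     ('a \<Rightarrow> 'e \<Rightarrow> 'e) \<Rightarrow> ('a \<Rightarrow> 'e \<Rightarrow> 'e \<Rightarrow> real) \<Rightarrow> ('b \<Rightarrow> 'a) \<Rightarrow> nat \<Rightarrow>
     ('b \<Rightarrow> 'e set) \<Rightarrow> ('b \<Rightarrow> 'e set) \<Rightarrow> ('b \<Rightarrow> 'e set) \<Rightarrow>
     ('b \<Rightarrow> 'e set) \<Rightarrow> ('b \<Rightarrow> 'e set) \<Rightarrow> ('b \<Rightarrow> 'e set) \<Rightarrow> ('b \<Rightarrow> 'e set) \<Rightarrow>
     ('b \<Rightarrow> 'e set) \<Rightarrow> ('b \<Rightarrow> 'e set) \<Rightarrow> ('b \<Rightarrow> 'e set) \<Rightarrow> bool" where
  "stcr_lightlike_submanifold B A J g i r ST STp ltr D0 D1 D2 Dp L1 L2 SS \<longleftrightarrow>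
     (let Jim = bundle_image J i in
     lightlike_submanifold B A g i r ST STp ltr \<and>
     (\<forall>E\<in>{D0, D1, D2, Dp, L1, L2, SS}. subbundle B A i E) \<and>
     direct_decomp (rad_bundle B A g i) D1 D2 \<and>
     (\<forall>p. Jim D1 p \<subseteq> ST p) \<and> (\<forall>p. Jim D2 p \<subseteq> STp p) \<and>
     is_direct (Jim D1) Dp \<and> orth_decomp g i ST (bundle_sum (Jim D1) Dp) D0 \<and>
     Jim D0 = D0 \<and> (\<forall>p. nondegenerate_on (D0 p) (g (i p))) \<and>
     orth_decomp g i (Jim Dp) L1 SS \<and> (\<forall>p. L1 p \<subseteq> ltr p) \<and> (\<forall>p. SS p \<subseteq> STp p) \<and>
     direct_decomp ltr L1 L2 \<and> (\<forall>p. Jim L1 p \<subseteq> ST p) \<and> (\<forall>p. Jim L2 p \<subseteq> STp p) \<and>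
     is_direct (Jim D2) (Jim L2) \<and> orth_decomp g i STp (bundle_sum (Jim D2) (Jim L2)) SS)"

definition stcr_D ::
  "('a \<Rightarrow> 'e::real_vector \<Rightarrow> 'e) \<Rightarrow> ('b \<Rightarrow> 'a) \<Rightarrow> ('b \<Rightarrow> 'e set) \<Rightarrow> ('b \<Rightarrow> 'e set) \<Rightarrow>
     'b \<Rightarrow> 'e set" where
  "stcr_D J i D0 D1 = bundle_sum (bundle_sum D0 D1) (bundle_image J i D1)"

end

theory Submission
  imports Defs
begin

text \<open>
  Put \<open>E = D\<^sub>2 \<oplus> D'\<close>, so that \<open>TM = D \<oplus> E\<close>, where \<open>J\<close> preserves
  \<open>D\<close> and maps \<open>E\<close> into the transversal bundle, and where \<open>B\<close> takes values in
  \<open>E\<close>. As \<open>J\<close> is parallel for the ambient connection, applying \<open>J\<close> to the Gauss formula for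
  \<open>JY\<close> and taking tangential parts shows that \<open>-Bh(X, JY)\<close> is the \<open>E\<close>-component of the induced
  derivative of \<open>Y\<close> along \<open>X\<close>, which lies in \<open>D\<close> precisely when this component vanishes.

  The induced derivative must moreover be a smooth section. The tangential part of a smooth section is
  smooth because its coefficients in a local frame are obtained by inverting a smooth family of
  invertible linear maps.
\<close>

section \<open>Smooth maps between Euclidean spaces\<close>

text \<open>If \<open>u + w\<close> is the splitting in \<open>D + E\<close> of the induced
  derivative of \<open>JY\<close>, then \<open>Jw\<close> is transversal, so the tangential part of
  \<open>J(u + w + h(X, JY))\<close> is \<open>Ju + Bh(X, JY)\<close>, while the whole vector is
  minus the ambient derivative of \<open>Y\<close> because J^2 = -1. This is the source of the sign.
  \<open>B\<close> lands in \<open>E\<close> because \<open>J\<close> undoes itself: L1 + S is the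
  image of D', J D2 returns to D2, and L2 and J L2 are exchanged up to sign inside the transversal
  bundle. \<open>E\<close> may be written with D' since J D' = L1 + S gives D' = J L1 + J S. Two
  features of the encoding shape the analysis. Vectors are stored in the preferred chart of their
  base point, which may jump, so smoothness has to be followed in charts fixed beforehand. And the
  connection acts on ambient fields only, whereas \<open>Y\<close> lives along the immersion; it is
  therefore expanded in an ambient coordinate frame, and parallelism of \<open>J\<close> is applied
  to the frame fields.\<close>

lemma linear_inverse:
  assumes "linear M" "\<And>v. M (N v) = v" "\<And>v. N (M v) = v"
  shows "linear N"
proof (rule linearI)
  fix u v c
  have "N (u + v) = N (M (N u + N v))"
    by (simp only: linear_add[OF assms(1)] assms(2))
  then show "N (u + v) = N u + N v" by (simp only: assms(3))
  have "N (c *\<^sub>R v) = N (M (c *\<^sub>R N v))"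
    by (simp only: linear_scale[OF assms(1)] assms(2))
  then show "N (c *\<^sub>R v) = c *\<^sub>R N v" by (simp only: assms(3))
qed

text \<open>Its use is to trade a varying argument for scalar coefficients: when \<open>h\<close>
  itself depends on a point, regularity at the finitely many basis vectors then suffices.\<close>

lemma linear_expand:
  fixes h :: "'a::euclidean_space \<Rightarrow> 'b::real_vector"
  assumes "linear h"
  shows "h u = (\<Sum>b\<in>Basis. (u \<bullet> b) *\<^sub>R h b)"
proof -
  have "h u = h (\<Sum>b\<in>Basis. (u \<bullet> b) *\<^sub>R b)" by (simp add: euclidean_representation)
  also have "\<dots> = (\<Sum>b\<in>Basis. (u \<bullet> b) *\<^sub>R h b)"
    using assms by (simp add: linear_sum linear_scale)
  finally show ?thesis .
qed

section \<open>Calculus of maps of class C^k\<close>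

lemma Ck_on_cong:
  assumes "open S" "\<And>x. x \<in> S \<Longrightarrow> f x = g x"
  shows "Ck_on k S f \<longleftrightarrow> Ck_on k S g"
proof -
  have imp: "Ck_on k S g" if "Ck_on k S f" "\<And>x. x \<in> S \<Longrightarrow> f x = g x" for f g :: "'a \<Rightarrow> 'b"
  proof (cases k)
    case 0
    with that show ?thesis by (simp cong: continuous_on_cong)
  next
    case (Suc n)
    with that obtain f' where f': "\<forall>x\<in>S. (f has_derivative f' x) (at x)" "\<forall>v. Ck_on n S (\<lambda>x. f' x v)"
      by auto
    have "\<forall>x\<in>S. (g has_derivative f' x) (at x)"
      using f'(1) assms(1) that(2) by (blast intro: has_derivative_transform_within_open)
    with f'(2) Suc show ?thesis by auto
  qed
  show ?thesis using imp[of f g] imp[of g f] assms(2) by auto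
qed

text \<open>The derivative that \<open>Ck_on\<close> quantifies over is unique at each point, hence
  it is \<open>frechet_derivative\<close>; openness lets the two be exchanged inside the
  class.\<close>

lemma Ck_on_Suc_iff:
  assumes "open S"
  shows "Ck_on (Suc k) S f \<longleftrightarrow> (\<forall>x\<in>S. f differentiable (at x)) \<and>
    (\<forall>v. Ck_on k S (\<lambda>x. frechet_derivative f (at x) v))"
proof
  assume "Ck_on (Suc k) S f"
  then obtain f' where f': "\<forall>x\<in>S. (f has_derivative f' x) (at x)" "\<forall>v. Ck_on k S (\<lambda>x. f' x v)"
    by auto
  have "Ck_on k S (\<lambda>x. frechet_derivative f (at x) v) \<longleftrightarrow> Ck_on k S (\<lambda>x. f' x v)" for v
    using f'(1) by (intro Ck_on_cong assms) (metis frechet_derivative_at)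
  with f' show "(\<forall>x\<in>S. f differentiable (at x)) \<and>
    (\<forall>v. Ck_on k S (\<lambda>x. frechet_derivative f (at x) v))"
    by (auto simp: differentiable_def)
next
  assume "(\<forall>x\<in>S. f differentiable (at x)) \<and>
    (\<forall>v. Ck_on k S (\<lambda>x. frechet_derivative f (at x) v))"
  then show "Ck_on (Suc k) S f"
    by (auto intro!: exI[of _ "\<lambda>x. frechet_derivative f (at x)"]
        simp: frechet_derivative_works[symmetric])
qed

lemma Ck_on_SucD: "Ck_on (Suc k) S f \<Longrightarrow> Ck_on k S f"
proof (induction k arbitrary: f)
  case 0
  then show ?case
    by (auto intro!: continuous_at_imp_continuous_on dest: has_derivative_continuous)
next
  case (Suc k)
  then obtain f' where "\<forall>x\<in>S. (f has_derivative f' x) (at x)" "\<forall>v. Ck_on (Suc k) S (\<lambda>x. f' x v)"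
    by (auto simp del: Ck_on.simps(2) simp: Ck_on.simps(2)[of "Suc k"])
  with Suc.IH show ?case by auto
qed

lemma Ck_on_subset: "Ck_on k T f \<Longrightarrow> S \<subseteq> T \<Longrightarrow> Ck_on k S f"
proof (induction k arbitrary: f)
  case 0
  then show ?case by (auto intro: continuous_on_subset)
next
  case (Suc k)
  then obtain f' where "\<forall>x\<in>T. (f has_derivative f' x) (at x)" "\<forall>v. Ck_on k T (\<lambda>x. f' x v)"
    by auto
  with Suc.IH Suc.prems(2) show ?case by (auto intro!: exI[of _ f'])
qed

text \<open>Different neighbourhoods could bring different witnesses for the derivative. With the
  canonical one from \<open>Ck_on_Suc_iff\<close>, the induction hypothesis applies to a single
  function.\<close>

lemma Ck_on_local:
  assumes "open S" "\<And>x. x \<in> S \<Longrightarrow> \<exists>U. open U \<and> x \<in> U \<and> U \<subseteq> S \<and> Ck_on k U f"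
  shows "Ck_on k S f"
  using assms(2)
proof (induction k arbitrary: f)
  case 0
  show ?case unfolding Ck_on.simps(1)
  proof (rule continuous_at_imp_continuous_on, rule ballI)
    fix x assume "x \<in> S"
    from 0[OF this] obtain U where "open U" "x \<in> U" "Ck_on 0 U f" by blast
    then show "isCont f x" by (simp add: continuous_on_eq_continuous_at)
  qed
next
  case (Suc k)
  have *: "\<exists>U. open U \<and> x \<in> U \<and> U \<subseteq> S \<and> f differentiable (at x) \<and>
      (\<forall>v. Ck_on k U (\<lambda>x. frechet_derivative f (at x) v))" if "x \<in> S" for x
  proof -
    from Suc.prems[OF that] obtain U where U: "open U" "x \<in> U" "U \<subseteq> S" "Ck_on (Suc k) U f"
      by blast
    from Ck_on_Suc_iff[OF U(1), of k f] U show ?thesis by blast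
  qed
  show ?case unfolding Ck_on_Suc_iff[OF assms(1)]
  proof (intro conjI ballI allI)
    fix v show "Ck_on k S (\<lambda>x. frechet_derivative f (at x) v)"
    proof (rule Suc.IH)
      fix x assume "x \<in> S"
      from *[OF this] show "\<exists>U. open U \<and> x \<in> U \<and> U \<subseteq> S \<and>
        Ck_on k U (\<lambda>x. frechet_derivative f (at x) v)" by blast
    qed
  next
    fix x assume "x \<in> S"
    from *[OF this] show "f differentiable (at x)" by blast
  qed
qed

lemma Ck_on_const: "Ck_on k S (\<lambda>x. c)"
proof (induction k arbitrary: c)
  case (Suc k)
  then show ?case by (auto intro!: exI[of _ "\<lambda>x v. 0"])
qed auto

lemma Ck_on_bounded_linear:
  assumes "bounded_linear h" "Ck_on k S f"
  shows "Ck_on k S (\<lambda>x. h (f x))"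
  using assms(2)
proof (induction k arbitrary: f)
  case 0
  then show ?case using assms(1) by (auto intro: bounded_linear.continuous_on)
next
  case (Suc k)
  then obtain f' where f': "\<forall>x\<in>S. (f has_derivative f' x) (at x)" "\<forall>v. Ck_on k S (\<lambda>x. f' x v)"
    by auto
  then show ?case
    by (auto intro!: exI[of _ "\<lambda>x v. h (f' x v)"] Suc.IH bounded_linear.has_derivative[OF assms(1)])
qed

lemma Ck_on_add:
  "Ck_on k S f \<Longrightarrow> Ck_on k S g \<Longrightarrow> Ck_on k S (\<lambda>x. f x + g x)"
proof (induction k arbitrary: f g)
  case 0
  then show ?case by (auto intro: continuous_on_add)
next
  case (Suc k)
  from Suc.prems obtain f' g' where
    "\<forall>x\<in>S. (f has_derivative f' x) (at x)" "\<forall>v. Ck_on k S (\<lambda>x. f' x v)"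
    "\<forall>x\<in>S. (g has_derivative g' x) (at x)" "\<forall>v. Ck_on k S (\<lambda>x. g' x v)" by auto
  then show ?case
    by (auto intro!: exI[of _ "\<lambda>x v. f' x v + g' x v"] Suc.IH has_derivative_add)
qed

lemma Ck_on_sum: "(\<And>j. j \<in> I \<Longrightarrow> Ck_on k S (f j)) \<Longrightarrow> Ck_on k S (\<lambda>x. \<Sum>j\<in>I. f j x)"
  by (induction I rule: infinite_finite_induct) (auto intro: Ck_on_const Ck_on_add)

lemma Ck_on_scaleR:
  "Ck_on k S f \<Longrightarrow> Ck_on k S g \<Longrightarrow> Ck_on k S (\<lambda>x. f x *\<^sub>R g x)"
proof (induction k arbitrary: f g)
  case 0
  then show ?case by (auto intro: continuous_on_scaleR)
next
  case (Suc k)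
  from Suc.prems obtain f' g' where d:
    "\<forall>x\<in>S. (f has_derivative f' x) (at x)" "\<forall>v. Ck_on k S (\<lambda>x. f' x v)"
    "\<forall>x\<in>S. (g has_derivative g' x) (at x)" "\<forall>v. Ck_on k S (\<lambda>x. g' x v)" by auto
  have "Ck_on k S f" "Ck_on k S g" using Suc.prems by (blast dest: Ck_on_SucD)+
  with d show ?case
    by (auto intro!: exI[of _ "\<lambda>x v. f x *\<^sub>R g' x v + f' x v *\<^sub>R g x"] Suc.IH Ck_on_add
        has_derivative_scaleR)
qed

lemma Ck_on_compose:
  fixes f :: "'a::euclidean_space \<Rightarrow> 'b::euclidean_space"
  shows "Ck_on k S f \<Longrightarrow> Ck_on k T g \<Longrightarrow> f ` S \<subseteq> T \<Longrightarrow> Ck_on k S (\<lambda>x. g (f x))"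
proof (induction k arbitrary: g)
  case 0
  then show ?case by (auto intro: continuous_on_compose2)
next
  case (Suc k)
  from Suc.prems(1,2) obtain f' g' where d:
    "\<forall>x\<in>S. (f has_derivative f' x) (at x)" "\<forall>v. Ck_on k S (\<lambda>x. f' x v)"
    "\<forall>x\<in>T. (g has_derivative g' x) (at x)" "\<forall>v. Ck_on k T (\<lambda>x. g' x v)" by auto
  have fk: "Ck_on k S f" using Suc.prems by (blast dest: Ck_on_SucD)
  \<comment> \<open>The chain rule gives \<open>g' (f x) (f' x v)\<close>, whose second argument
    moves with \<open>x\<close>. Expanding it leaves \<open>g' (f x) b\<close> with \<open>b\<close>
    fixed, to which the induction hypothesis for composites with \<open>f\<close> applies.\<close>
  have der: "((\<lambda>x. g (f x)) has_derivative (\<lambda>v. \<Sum>b\<in>Basis. (f' x v \<bullet> b) *\<^sub>R g' (f x) b)) (at x)"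
    if "x \<in> S" for x
  proof -
    have g: "(g has_derivative g' (f x)) (at (f x))" using d(3) that Suc.prems(3) by blast
    have "linear (g' (f x))" by (rule has_derivative_linear[OF g])
    have eq: "(\<lambda>v. g' (f x) (f' x v)) = (\<lambda>v. \<Sum>b\<in>Basis. (f' x v \<bullet> b) *\<^sub>R g' (f x) b)"
      by (rule ext, rule linear_expand) fact
    show ?thesis using has_derivative_compose[OF bspec[OF d(1) that] g] unfolding eq .
  qed
  have "Ck_on k S (\<lambda>x. \<Sum>b\<in>Basis. (f' x v \<bullet> b) *\<^sub>R g' (f x) b)" for v
    using d Suc.prems(3) fk
    by (intro Ck_on_sum Ck_on_scaleR Suc.IH Ck_on_bounded_linear[OF bounded_linear_inner_left]) auto
  with der show ?case
    by (auto intro!: exI[of _ "\<lambda>x v. \<Sum>b\<in>Basis. (f' x v \<bullet> b) *\<^sub>R g' (f x) b"])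
qed

section \<open>Inverses of families of linear maps\<close>

lemma linear_family_inverse_continuous:
  fixes M N :: "'a::metric_space \<Rightarrow> 'e::euclidean_space \<Rightarrow> 'e"
  assumes S: "open S" "x0 \<in> S"
    and lin: "\<And>x. x \<in> S \<Longrightarrow> linear (M x)"
    and inv: "\<And>x v. x \<in> S \<Longrightarrow> M x (N x v) = v" "\<And>x v. x \<in> S \<Longrightarrow> N x (M x v) = v"
    and cont: "\<And>v. continuous_on S (\<lambda>x. M x v)"
  shows "isCont (\<lambda>x. N x v) x0"
proof -
  have cM: "((\<lambda>x. M x w) \<longlongrightarrow> M x0 w) (at x0)" for w
    using cont[of w] S by (metis continuous_on_eq_continuous_at isCont_def)
  have "inj (M x0)" using inv(2)[OF S(2)] by (metis injI)
  \<comment> \<open>The aim is a uniform bound on \<open>N\<close> near \<open>x0\<close>.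
    \<open>M x0\<close> stretches every vector by at least \<open>\<delta>\<close>, a perturbation
    of size below \<open>\<delta> / 2\<close> still leaves \<open>\<delta> / 2\<close>, so
    \<open>N x\<close> is bounded by \<open>2 / \<delta>\<close> and can be applied to
    \<open>v - M x w0\<close>, which tends to \<open>0\<close>.\<close>
  then obtain \<delta> where \<delta>: "\<delta> > 0" "\<And>w. \<delta> * norm w \<le> norm (M x0 w)"
    using linear_inj_bounded_below_pos[OF lin[OF S(2)]] by metis
  define w0 where "w0 = N x0 v"
  \<comment> \<open>The sum over the basis stands in for the operator norm of
    \<open>M x - M x0\<close>; it asks for continuity at constant arguments only.\<close>
  have "((\<lambda>x. \<Sum>b\<in>Basis. norm (M x b - M x0 b)) \<longlongrightarrow> (\<Sum>b\<in>Basis. norm (M x0 b - M x0 b))) (at x0)"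
    by (intro tendsto_intros cM)
  then have "((\<lambda>x. \<Sum>b\<in>Basis. norm (M x b - M x0 b)) \<longlongrightarrow> 0) (at x0)" by simp
  then have "\<forall>\<^sub>F x in at x0. (\<Sum>b\<in>Basis. norm (M x b - M x0 b)) < \<delta> / 2"
    using \<delta>(1) by (intro order_tendstoD) auto
  moreover have "\<forall>\<^sub>F x in at x0. x \<in> S" using S by (metis eventually_at_topological)
  ultimately have "\<forall>\<^sub>F x in at x0. norm (N x v - w0) \<le> (2 / \<delta>) * norm (v - M x w0)"
  proof eventually_elim
    case (elim x)
    interpret Mx: linear "M x" using lin elim by auto
    interpret M0: linear "M x0" using lin S by auto
    define w where "w = N x v - w0"
    have "M x w - M x0 w = (\<Sum>b\<in>Basis. (w \<bullet> b) *\<^sub>R (M x b - M x0 b))"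
      by (subst (1 2) euclidean_representation[of w, symmetric])
        (simp add: Mx.sum Mx.scale M0.sum M0.scale scaleR_diff_right sum_subtractf
          del: euclidean_representation)
    then have "norm (M x w - M x0 w) \<le> (\<Sum>b\<in>Basis. norm w * norm (M x b - M x0 b))"
      by (auto intro!: sum_norm_le mult_right_mono simp: Basis_le_norm)
    also have "\<dots> = norm w * (\<Sum>b\<in>Basis. norm (M x b - M x0 b))" by (simp add: sum_distrib_left)
    also have "\<dots> \<le> norm w * (\<delta> / 2)" using elim by (intro mult_left_mono) auto
    finally have "norm (M x w - M x0 w) \<le> norm w * (\<delta> / 2)" .
    moreover have "norm (M x0 w) - norm (M x w) \<le> norm (M x w - M x0 w)"
      by (metis norm_minus_commute norm_triangle_ineq2)
    ultimately have "norm w * (\<delta> / 2) \<le> norm (M x w)" using \<delta>(2)[of w] by (simp add: field_simps)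
    moreover have "M x w = v - M x w0" using inv(1) elim by (simp add: w_def Mx.diff)
    ultimately show ?case using \<delta>(1) unfolding w_def by (simp add: pos_le_divide_eq mult.commute)
  qed
  moreover have "((\<lambda>x. (2 / \<delta>) * norm (v - M x w0)) \<longlongrightarrow> (2 / \<delta>) * norm (v - M x0 w0)) (at x0)"
    by (intro tendsto_intros cM)
  then have "((\<lambda>x. (2 / \<delta>) * norm (v - M x w0)) \<longlongrightarrow> 0) (at x0)" using inv(1)[OF S(2)] by (simp add: w0_def)
  ultimately have "((\<lambda>x. N x v - w0) \<longlongrightarrow> 0) (at x0)" by (rule Lim_null_comparison)
  then show ?thesis by (simp add: isCont_def w0_def LIM_zero_iff)
qed

text \<open>Since \<open>f x = 0\<close>, the increment of \<open>g\<close> is only ever multiplied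
  by something of first order, so no derivative of \<open>g\<close> enters the product rule. The
  lemma serves the inverse family, whose differentiability is still to be shown at that
  stage.\<close>

lemma has_derivative_scaleR_vanishing:
  assumes f: "(f has_derivative f') (at x)" "f x = 0" and g: "isCont g x"
  shows "((\<lambda>y. f y *\<^sub>R g y) has_derivative (\<lambda>h. f' h *\<^sub>R g x)) (at x)"
proof -
  have bl: "bounded_linear f'" using f(1) by (rule has_derivative_bounded_linear)
  have lim: "((\<lambda>y. (f y - f' (y - x)) / norm (y - x)) \<longlongrightarrow> 0) (at x)"
    using f by (auto simp: has_derivative_at2 divide_inverse mult.commute)
  obtain K where K: "\<And>h. norm (f' h) \<le> norm h * K" using bl bounded_linear.bounded by blast
  have gl: "((\<lambda>y. g y - g x) \<longlongrightarrow> 0) (at x)" using g by (simp add: isCont_def LIM_zero_iff)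
  \<comment> \<open>The difference quotient is split into the remainder of \<open>f\<close> times
    \<open>g y\<close>, and the bounded slope of \<open>f'\<close> times the increment of
    \<open>g\<close>.\<close>
  have 1: "((\<lambda>y. ((f y - f' (y - x)) / norm (y - x)) *\<^sub>R g y) \<longlongrightarrow> 0 *\<^sub>R g x) (at x)"
    using g by (intro tendsto_scaleR lim) (simp add: isCont_def)
  have 2: "((\<lambda>y. (f' (y - x) / norm (y - x)) *\<^sub>R (g y - g x)) \<longlongrightarrow> 0) (at x)"
  proof (rule Lim_null_comparison)
    show "\<forall>\<^sub>F y in at x. norm ((f' (y - x) / norm (y - x)) *\<^sub>R (g y - g x)) \<le> K * norm (g y - g x)"
      unfolding eventually_at_filter
    proof (intro always_eventually allI impI)
      fix y assume "y \<noteq> x"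
      then have "\<bar>f' (y - x)\<bar> / norm (y - x) \<le> K" using K[of "y - x"] by (simp add: field_simps)
      from mult_right_mono[OF this norm_ge_zero[of "g y - g x"]]
      show "norm ((f' (y - x) / norm (y - x)) *\<^sub>R (g y - g x)) \<le> K * norm (g y - g x)"
        by simp
    qed
    show "((\<lambda>y. K * norm (g y - g x)) \<longlongrightarrow> 0) (at x)"
      using tendsto_mult[OF tendsto_const[of K] tendsto_norm[OF gl]] by simp
  qed
  have "((\<lambda>y. (f y *\<^sub>R g y - (f x *\<^sub>R g x + f' (y - x) *\<^sub>R g x)) /\<^sub>R norm (y - x)) \<longlongrightarrow> 0) (at x)"
    using tendsto_add[OF 1 2] f(2)
    by (simp add: algebra_simps divide_inverse scaleR_diff_right scaleR_diff_left)
  moreover have "bounded_linear (\<lambda>h. f' h *\<^sub>R g x)"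
    using bl by (rule bounded_linear_scaleR_const)
  ultimately show ?thesis by (simp add: has_derivative_at2 algebra_simps divide_inverse)
qed

text \<open>Once the inverse is known to be differentiable, its derivative is built from
  \<open>N\<close> and the derivative of \<open>M\<close>, both of class \<open>k\<close>: for
  \<open>N\<close> this is the induction hypothesis, because \<open>M\<close> is in particular of
  class \<open>k\<close>.\<close>

lemma Ck_on_linear_family_inverse:
  fixes M N :: "'a::euclidean_space \<Rightarrow> 'e::euclidean_space \<Rightarrow> 'e"
  assumes S: "open S"
    and lin: "\<And>x. x \<in> S \<Longrightarrow> linear (M x)"
    and inv: "\<And>x v. x \<in> S \<Longrightarrow> M x (N x v) = v" "\<And>x v. x \<in> S \<Longrightarrow> N x (M x v) = v"
    and M: "\<And>v. Ck_on k S (\<lambda>x. M x v)"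
  shows "Ck_on k S (\<lambda>x. N x v)"
  using M
proof (induction k arbitrary: v)
  case 0
  then show ?case
    using linear_family_inverse_continuous[OF S _ lin inv]
    by (auto intro!: continuous_at_imp_continuous_on)
next
  case (Suc k)
  have Mk: "Ck_on k S (\<lambda>x. M x v)" for v using Suc.prems by (rule Ck_on_SucD)
  have N: "Ck_on k S (\<lambda>x. N x v)" for v by (rule Suc.IH[OF Mk])
  have linN: "linear (N x)" if "x \<in> S" for x
    by (rule linear_inverse[OF lin inv]) (rule that)+
  obtain M' where M': "\<And>w x. x \<in> S \<Longrightarrow> ((\<lambda>x. M x w) has_derivative M' w x) (at x)"
    "\<And>w h. Ck_on k S (\<lambda>x. M' w x h)"
    using Suc.prems by (simp, metis)
  \<comment> \<open>\<open>M'\<close> is chosen separately for each \<open>w\<close>, so linearity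
    in \<open>w\<close> is not part of the choice; uniqueness of derivatives supplies it.\<close>
  have M'_expand: "(\<Sum>b'\<in>Basis. (w \<bullet> b') *\<^sub>R M' b' x h) = M' w x h" if x: "x \<in> S" for x w h
  proof -
    have "((\<lambda>x. \<Sum>b'\<in>Basis. (w \<bullet> b') *\<^sub>R M x b') has_derivative
       (\<lambda>h. \<Sum>b'\<in>Basis. (w \<bullet> b') *\<^sub>R M' b' x h)) (at x)"
      by (intro has_derivative_sum has_derivative_scaleR_right M'(1) x)
    then have "((\<lambda>x. M x w) has_derivative (\<lambda>h. \<Sum>b'\<in>Basis. (w \<bullet> b') *\<^sub>R M' b' x h)) (at x)"
      by (rule has_derivative_transform_within_open[OF _ S x])
        (rule linear_expand[OF lin, symmetric])
    from has_derivative_unique[OF this M'(1)[OF x]] show ?thesis by metis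
  qed
  \<comment> \<open>Differentiating \<open>M x (N x v) = v\<close> suggests the derivative \<open>D x h = - N x (M' (N x v) x h)\<close>.
    It is expanded in a basis because the class of \<open>N\<close> is known only at constant arguments.\<close>
  define D where "D x h =
    - (\<Sum>b\<in>Basis. ((\<Sum>b'\<in>Basis. (N x v \<bullet> b') *\<^sub>R M' b' x h) \<bullet> b) *\<^sub>R N x b)" for x h
  have der: "((\<lambda>x. N x v) has_derivative D x0) (at x0)" if x0: "x0 \<in> S" for x0
  proof -
    \<comment> \<open>As \<open>\<phi> x0 = 0\<close>, the identity
      \<open>N x v = N x0 v - N x (\<phi> x)\<close> moves all variation of \<open>N\<close> into
      products with a vanishing factor, where continuity of \<open>N\<close> is enough.\<close>
    define \<phi> where "\<phi> x = M x (N x0 v) - v" for x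
    have "(\<phi> has_derivative M' (N x0 v) x0) (at x0)"
      unfolding \<phi>_def using has_derivative_diff[OF M'(1)[OF x0] has_derivative_const] by simp
    then have \<phi>: "((\<lambda>x. \<phi> x \<bullet> b) has_derivative (\<lambda>h. M' (N x0 v) x0 h \<bullet> b)) (at x0)" for b
      by (rule has_derivative_inner_left)
    have "((\<lambda>x. N x0 v - (\<Sum>b\<in>Basis. (\<phi> x \<bullet> b) *\<^sub>R N x b)) has_derivative
        (\<lambda>h. 0 - (\<Sum>b\<in>Basis. (M' (N x0 v) x0 h \<bullet> b) *\<^sub>R N x0 b))) (at x0)"
    proof (intro has_derivative_diff has_derivative_const has_derivative_sum
        has_derivative_scaleR_vanishing[OF \<phi>])
      fix b show "\<phi> x0 \<bullet> b = 0" using inv(1)[OF x0] by (simp add: \<phi>_def)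
      show "isCont (\<lambda>x. N x b) x0"
        using Mk by (intro linear_family_inverse_continuous[OF S x0 lin inv])
          (auto intro: continuous_at_imp_continuous_on has_derivative_continuous M'(1))
    qed
    moreover have "N x0 v - (\<Sum>b\<in>Basis. (\<phi> x \<bullet> b) *\<^sub>R N x b) = N x v" if x: "x \<in> S" for x
    proof -
      have "N x (\<phi> x) = N x0 v - N x v"
        using inv(2)[OF x] linN[OF x] by (simp add: \<phi>_def linear_diff)
      then have "N x v = N x0 v - N x (\<phi> x)" by simp
      also note linear_expand[OF linN[OF x], of "\<phi> x"]
      finally show ?thesis by (rule sym)
    qed
    ultimately have "((\<lambda>x. N x v) has_derivative
        (\<lambda>h. 0 - (\<Sum>b\<in>Basis. (M' (N x0 v) x0 h \<bullet> b) *\<^sub>R N x0 b))) (at x0)"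
      by (rule has_derivative_transform_within_open[OF _ S x0])
    then show ?thesis unfolding D_def[abs_def] M'_expand[OF x0] diff_0 .
  qed
  have "Ck_on k S (\<lambda>x. D x h)" for h
    unfolding D_def
    by (intro Ck_on_bounded_linear[OF bounded_linear_minus[OF bounded_linear_ident]] Ck_on_sum
        Ck_on_scaleR N M'(2) Ck_on_bounded_linear[OF bounded_linear_inner_left])
  with der show ?case by auto
qed

section \<open>Smooth maps and smooth local frames\<close>

lemma smooth_onD: "smooth_on S f \<Longrightarrow> Ck_on k S f"
  by (simp add: smooth_on_def)

lemma smooth_onI: "(\<And>k. Ck_on k S f) \<Longrightarrow> smooth_on S f"
  by (simp add: smooth_on_def)

lemma smooth_on_transform:
  assumes "smooth_on S f" "open S" "\<And>x. x \<in> S \<Longrightarrow> f x = g x"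
  shows "smooth_on S g"
  unfolding smooth_on_def
proof
  fix k
  have "Ck_on k S f" using assms(1) by (simp add: smooth_on_def)
  then show "Ck_on k S g" using Ck_on_cong[OF assms(2), of f g k] assms(3) by simp
qed

lemma smooth_on_subset: "smooth_on T f \<Longrightarrow> S \<subseteq> T \<Longrightarrow> smooth_on S f"
  by (rule smooth_onI, rule Ck_on_subset, rule smooth_onD)

lemma smooth_on_local:
  assumes "open S" "\<And>x. x \<in> S \<Longrightarrow> \<exists>U. open U \<and> x \<in> U \<and> U \<subseteq> S \<and> smooth_on U f"
  shows "smooth_on S f"
  unfolding smooth_on_def
proof
  fix k show "Ck_on k S f"
  proof (rule Ck_on_local[OF assms(1)])
    fix x assume "x \<in> S"
    from assms(2)[OF this] obtain U where "open U \<and> x \<in> U \<and> U \<subseteq> S" "smooth_on U f" by blast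
    then show "\<exists>U. open U \<and> x \<in> U \<and> U \<subseteq> S \<and> Ck_on k U f"
      unfolding smooth_on_def by blast
  qed
qed

lemma smooth_on_const: "smooth_on S (\<lambda>x. c)"
  by (simp add: smooth_on_def Ck_on_const)

lemma smooth_on_bounded_linear: "bounded_linear h \<Longrightarrow> smooth_on S f \<Longrightarrow> smooth_on S (\<lambda>x. h (f x))"
  by (simp add: smooth_on_def Ck_on_bounded_linear)

lemma smooth_on_add: "smooth_on S f \<Longrightarrow> smooth_on S g \<Longrightarrow> smooth_on S (\<lambda>x. f x + g x)"
  by (simp add: smooth_on_def Ck_on_add)

lemma smooth_on_sum: "(\<And>j. j \<in> I \<Longrightarrow> smooth_on S (f j)) \<Longrightarrow> smooth_on S (\<lambda>x. \<Sum>j\<in>I. f j x)"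
  by (simp add: smooth_on_def Ck_on_sum)

lemma smooth_on_scaleR: "smooth_on S f \<Longrightarrow> smooth_on S g \<Longrightarrow> smooth_on S (\<lambda>x. f x *\<^sub>R g x)"
  by (simp add: smooth_on_def Ck_on_scaleR)

lemma smooth_on_inner_const: "smooth_on S f \<Longrightarrow> smooth_on S (\<lambda>x. f x \<bullet> b)"
  by (rule smooth_on_bounded_linear[OF bounded_linear_inner_left])

lemma smooth_on_compose:
  fixes f :: "'a::euclidean_space \<Rightarrow> 'b::euclidean_space"
  shows "smooth_on S f \<Longrightarrow> smooth_on T g \<Longrightarrow> f ` S \<subseteq> T \<Longrightarrow> smooth_on S (\<lambda>x. g (f x))"
  by (rule smooth_onI, rule Ck_on_compose[OF smooth_onD smooth_onD])

lemma smooth_on_differentiable: "smooth_on S f \<Longrightarrow> x \<in> S \<Longrightarrow> f differentiable (at x)"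
  by (drule smooth_onD[of _ _ "Suc 0"]) (auto simp: differentiable_def)

lemma smooth_on_frechet_derivative:
  assumes "open S" "smooth_on S f" "smooth_on S w"
  shows "smooth_on S (\<lambda>x. frechet_derivative f (at x) (w x))"
proof -
  have "Ck_on k S (\<lambda>x. frechet_derivative f (at x) v)" for k v
  proof -
    have "Ck_on (Suc k) S f" by (rule smooth_onD[OF assms(2)])
    then have "\<forall>v. Ck_on k S (\<lambda>x. frechet_derivative f (at x) v)"
      by (rule Ck_on_Suc_iff[OF assms(1), THEN iffD1, THEN conjunct2])
    then show ?thesis by (rule spec)
  qed
  then have "smooth_on S (\<lambda>x. frechet_derivative f (at x) v)" for v
    by (rule smooth_onI)
  then have "smooth_on S (\<lambda>x. \<Sum>b\<in>Basis. (w x \<bullet> b) *\<^sub>R frechet_derivative f (at x) b)"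
    by (intro smooth_on_sum smooth_on_scaleR smooth_on_inner_const assms(3))
  then show ?thesis
    by (rule smooth_on_transform[OF _ assms(1)])
      (rule linear_expand[symmetric, OF linear_frechet_derivative[OF smooth_on_differentiable[OF assms(2)]]])
qed

text \<open>Let \<open>M x\<close> carry the standard basis to the frame at \<open>x\<close>. The
  coefficients of \<open>u x\<close> are the coordinates of \<open>N x (u x)\<close>, with
  \<open>N x\<close> the inverse of \<open>M x\<close>, and inversion preserves smoothness. The
  coefficients \<open>c\<close> may be chosen pointwise: the frame determines them.\<close>

lemma smooth_on_frame_coefficients:
  fixes G :: "'i \<Rightarrow> 'a::euclidean_space \<Rightarrow> 'e::euclidean_space"
  assumes S: "open S" and I: "finite I" "card I = DIM('e)" "j \<in> I"
    and G: "\<And>j. j \<in> I \<Longrightarrow> smooth_on S (G j)"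
    and span: "\<And>x. x \<in> S \<Longrightarrow> span ((\<lambda>j. G j x) ` I) = UNIV"
    and u: "smooth_on S u" "\<And>x. x \<in> S \<Longrightarrow> u x = (\<Sum>j\<in>I. c j x *\<^sub>R G j x)"
  shows "smooth_on S (c j)"
proof -
  \<comment> \<open>Matching indices with basis vectors makes \<open>M x\<close> an endomorphism of
    the model space, for which onto implies one-to-one. The count \<open>card I = DIM('e)\<close>
    excludes redundant frames.\<close>
  obtain \<pi> where \<pi>: "bij_betw \<pi> (Basis::'e set) I"
    using finite_same_card_bij[OF finite_Basis I(1)] I(2) by auto
  define M where "M x v = (\<Sum>b\<in>Basis. (v \<bullet> b) *\<^sub>R G (\<pi> b) x)" for x and v :: 'e
  define N where "N x = inv (M x)" for x
  have lin: "linear (M x)" for x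
    unfolding M_def by (intro linearI)
      (auto simp: inner_add_left scaleR_add_left sum.distrib scaleR_sum_right)
  have Mb: "M x b = G (\<pi> b) x" if "b \<in> Basis" for x b
    using that by (simp add: M_def inner_Basis if_distrib[of "\<lambda>c. c *\<^sub>R _"] cong: if_cong)
  have surj: "surj (M x)" if "x \<in> S" for x
  proof -
    have "(\<lambda>j. G j x) ` I \<subseteq> range (M x)"
    proof
      fix y assume "y \<in> (\<lambda>j. G j x) ` I"
      then obtain j where "j \<in> I" and y: "y = G j x" by blast
      then obtain b where "b \<in> Basis" "\<pi> b = j" using \<pi> by (auto simp: bij_betw_def)
      with Mb[of b x] show "y \<in> range (M x)" unfolding y by (metis rangeI)
    qed
    then have "span ((\<lambda>j. G j x) ` I) \<subseteq> range (M x)"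
      using lin by (intro span_minimal) (auto intro: linear_subspace_image)
    with span[OF that] show ?thesis by auto
  qed
  have inj: "inj (M x)" if "x \<in> S" for x
    using linear_surjective_imp_injective[OF lin surj[OF that]] by simp
  have inv: "M x (N x v) = v" "N x (M x v) = v" if "x \<in> S" for x v
    using surj[OF that] inj[OF that] by (auto simp: N_def surj_f_inv_f)
  have M: "smooth_on S (\<lambda>x. M x v)" for v
    unfolding M_def using \<pi> by (intro smooth_on_sum smooth_on_scaleR smooth_on_const G)
      (auto simp: bij_betw_def)
  have N: "smooth_on S (\<lambda>x. N x v)" for v
    by (rule smooth_onI, rule Ck_on_linear_family_inverse[OF S lin inv smooth_onD[OF M]])
  obtain b where b: "b \<in> Basis" "\<pi> b = j" using \<pi> I(3) by (auto simp: bij_betw_def)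
  have "smooth_on S (\<lambda>x. (\<Sum>e\<in>Basis. (u x \<bullet> e) *\<^sub>R N x e) \<bullet> b)"
    by (intro smooth_on_inner_const smooth_on_sum smooth_on_scaleR u(1) N)
  then show ?thesis
  proof (rule smooth_on_transform[OF _ S])
    fix x assume x: "x \<in> S"
    define a where "a = (\<Sum>b\<in>Basis. c (\<pi> b) x *\<^sub>R b)"
    have "M x a = (\<Sum>b\<in>Basis. c (\<pi> b) x *\<^sub>R G (\<pi> b) x)"
      unfolding M_def a_def by (intro sum.cong) auto
    also have "\<dots> = u x" unfolding u(2)[OF x] by (rule sum.reindex_bij_betw[OF \<pi>])
    finally have "N x (u x) = a" using inv(2)[OF x, of a] by simp
    moreover have "linear (N x)" by (rule linear_inverse[OF lin inv[OF x]])
    ultimately have "(\<Sum>e\<in>Basis. (u x \<bullet> e) *\<^sub>R N x e) = a"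
      using linear_expand[of "N x" "u x"] by (simp only:)
    then show "(\<Sum>e\<in>Basis. (u x \<bullet> e) *\<^sub>R N x e) \<bullet> b = c j x" using b by (simp add: a_def)
  qed
qed

section \<open>Calculus in charts\<close>

text \<open>\<open>tan_coord\<close>, \<open>const_field\<close>, \<open>dir_deriv\<close> and
  \<open>tan_map\<close> are all derivatives of functions read in some chart. This relation and
  \<open>chart_deriv\<close> give them one common calculus, in which the chart is a parameter and
  not tied to the base point.\<close>

definition chart_has_deriv ::
  "('a, 'f::euclidean_space) chart \<Rightarrow> 'a \<Rightarrow> ('a \<Rightarrow> 'v::real_normed_vector) \<Rightarrow> ('f \<Rightarrow> 'v) \<Rightarrow> bool" where
  "chart_has_deriv d p f D \<longleftrightarrow> ((f \<circ> chart_inv d) has_derivative D) (at (snd d p))"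

definition chart_deriv ::
  "('a, 'f::euclidean_space) chart \<Rightarrow> 'a \<Rightarrow> ('a \<Rightarrow> 'v::real_normed_vector) \<Rightarrow> 'f \<Rightarrow> 'v" where
  "chart_deriv d p f = frechet_derivative (f \<circ> chart_inv d) (at (snd d p))"

definition chart_smooth ::
  "('a, 'f::euclidean_space) chart \<Rightarrow> 'a set \<Rightarrow> ('a \<Rightarrow> 'v::real_normed_vector) \<Rightarrow> bool" where
  "chart_smooth d W f \<longleftrightarrow> smooth_on (snd d ` (fst d \<inter> W)) (f \<circ> chart_inv d)"

lemma chart_inv_left: "is_chart d \<Longrightarrow> p \<in> fst d \<Longrightarrow> chart_inv d (snd d p) = p"
  unfolding is_chart_def homeomorphism_def by blast

lemma open_chart_image: "is_chart d \<Longrightarrow> open W \<Longrightarrow> open (snd d ` (fst d \<inter> W))"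
proof -
  assume d: "is_chart d" and W: "open W"
  then have "openin (top_of_set (snd d ` fst d)) (snd d ` (fst d \<inter> W))"
    unfolding is_chart_def by (meson homeomorphism_imp_open_map openin_open_Int)
  then show ?thesis using d unfolding is_chart_def by (meson openin_open_trans)
qed

lemma chart_deriv_eq: "chart_has_deriv d p f D \<Longrightarrow> chart_deriv d p f = D"
  unfolding chart_has_deriv_def chart_deriv_def by (rule frechet_derivative_at[symmetric])

lemma chart_has_deriv_linear: "chart_has_deriv d p f D \<Longrightarrow> linear D"
  unfolding chart_has_deriv_def by (rule has_derivative_linear)

lemma chart_has_deriv_transform:
  assumes "chart_has_deriv d p f D" "is_chart d" "p \<in> fst d" "open U" "p \<in> U"
    and eq: "\<And>q. q \<in> U \<Longrightarrow> f q = g q"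
  shows "chart_has_deriv d p g D"
  unfolding chart_has_deriv_def
proof (rule has_derivative_transform_within_open)
  show "((f \<circ> chart_inv d) has_derivative D) (at (snd d p))"
    using assms(1) by (simp add: chart_has_deriv_def)
  show "open (snd d ` (fst d \<inter> U))" using assms by (intro open_chart_image)
  show "snd d p \<in> snd d ` (fst d \<inter> U)" using assms by blast
  fix x assume "x \<in> snd d ` (fst d \<inter> U)"
  then obtain q where "q \<in> fst d" "q \<in> U" "x = snd d q" by blast
  then show "(f \<circ> chart_inv d) x = (g \<circ> chart_inv d) x"
    using chart_inv_left[OF assms(2)] eq by simp
qed

lemma chart_has_deriv_const: "chart_has_deriv d p (\<lambda>q. c) (\<lambda>w. 0)"
  unfolding chart_has_deriv_def o_def by (rule has_derivative_const)

lemma chart_has_deriv_sum: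
  "(\<And>j. j \<in> I \<Longrightarrow> chart_has_deriv d p (f j) (D j)) \<Longrightarrow>
    chart_has_deriv d p (\<lambda>q. \<Sum>j\<in>I. f j q) (\<lambda>w. \<Sum>j\<in>I. D j w)"
  unfolding chart_has_deriv_def o_def by (rule has_derivative_sum)

lemma chart_has_deriv_scaleR:
  assumes "chart_has_deriv d p f D" "chart_has_deriv d p g E" "is_chart d" "p \<in> fst d"
  shows "chart_has_deriv d p (\<lambda>q. f q *\<^sub>R g q) (\<lambda>w. f p *\<^sub>R E w + D w *\<^sub>R g p)"
  using has_derivative_scaleR[OF assms(1,2)[unfolded chart_has_deriv_def]] assms(3,4)
  unfolding chart_has_deriv_def by (simp add: o_def chart_inv_left)

lemma chart_has_deriv_inner:
  "chart_has_deriv d p f D \<Longrightarrow> chart_has_deriv d p (\<lambda>q. f q \<bullet> b) (\<lambda>w. D w \<bullet> b)"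
  unfolding chart_has_deriv_def o_def by (rule has_derivative_inner_left)

lemma chart_has_deriv_compose:
  assumes d: "is_chart d" "p \<in> fst d" and c: "is_chart c" and U: "open U" "p \<in> U" "i ` U \<subseteq> fst c"
    and i: "chart_has_deriv d p (\<lambda>q. snd c (i q)) D" and f: "chart_has_deriv c (i p) f E"
  shows "chart_has_deriv d p (\<lambda>q. f (i q)) (\<lambda>w. E (D w))"
proof -
  have "(((\<lambda>q. snd c (i q)) \<circ> chart_inv d) has_derivative D) (at (snd d p))"
    using i by (simp add: chart_has_deriv_def)
  moreover have "((f \<circ> chart_inv c) has_derivative E)
      (at (((\<lambda>q. snd c (i q)) \<circ> chart_inv d) (snd d p)))"
    using f chart_inv_left[OF d] by (simp add: chart_has_deriv_def)
  ultimately have "((\<lambda>x. (f \<circ> chart_inv c) (((\<lambda>q. snd c (i q)) \<circ> chart_inv d) x))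
      has_derivative (\<lambda>w. E (D w))) (at (snd d p))"
    by (rule has_derivative_compose)
  then have "chart_has_deriv d p (\<lambda>q. f (chart_inv c (snd c (i q)))) (\<lambda>w. E (D w))"
    by (simp add: chart_has_deriv_def o_def)
  then show ?thesis
  proof (rule chart_has_deriv_transform[OF _ d U(1,2)])
    fix q assume "q \<in> U"
    then have "i q \<in> fst c" using U(3) by blast
    then show "f (chart_inv c (snd c (i q))) = f (i q)" by (simp add: chart_inv_left[OF c])
  qed
qed

lemma chart_smooth_has_deriv:
  assumes "chart_smooth d W f" "p \<in> fst d" "p \<in> W"
  shows "chart_has_deriv d p f (chart_deriv d p f)"
proof -
  have "(f \<circ> chart_inv d) differentiable (at (snd d p))"
    using assms unfolding chart_smooth_def by (intro smooth_on_differentiable) auto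
  then show ?thesis
    unfolding chart_has_deriv_def chart_deriv_def by (simp add: frechet_derivative_works)
qed

lemma chart_smooth_subset: "chart_smooth d W f \<Longrightarrow> V \<subseteq> W \<Longrightarrow> chart_smooth d V f"
  unfolding chart_smooth_def by (erule smooth_on_subset) blast

lemma chart_smooth_transform:
  assumes "chart_smooth d W f" "is_chart d" "open W"
    and "\<And>q. q \<in> fst d \<Longrightarrow> q \<in> W \<Longrightarrow> f q = g q"
  shows "chart_smooth d W g"
  using assms(1) unfolding chart_smooth_def
proof (rule smooth_on_transform[OF _ open_chart_image[OF assms(2,3)]])
  fix x assume "x \<in> snd d ` (fst d \<inter> W)"
  then obtain q where "q \<in> fst d" "q \<in> W" "x = snd d q" by blast
  then show "(f \<circ> chart_inv d) x = (g \<circ> chart_inv d) x"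
    using chart_inv_left[OF assms(2)] assms(4) by simp
qed

lemma chart_smooth_local:
  assumes d: "is_chart d" "open W"
    and loc: "\<And>p. p \<in> fst d \<Longrightarrow> p \<in> W \<Longrightarrow> \<exists>U. open U \<and> p \<in> U \<and> chart_smooth d (W \<inter> U) f"
  shows "chart_smooth d W f"
  unfolding chart_smooth_def
proof (rule smooth_on_local[OF open_chart_image[OF d]])
  fix x assume "x \<in> snd d ` (fst d \<inter> W)"
  then obtain p where p: "p \<in> fst d" "p \<in> W" "x = snd d p" by blast
  from loc[OF p(1,2)] obtain U where U: "open U" "p \<in> U" "chart_smooth d (W \<inter> U) f" by blast
  have "open (snd d ` (fst d \<inter> (W \<inter> U)))" using d U(1) by (intro open_chart_image) auto
  moreover have "x \<in> snd d ` (fst d \<inter> (W \<inter> U))" using p U by blast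
  moreover have "snd d ` (fst d \<inter> (W \<inter> U)) \<subseteq> snd d ` (fst d \<inter> W)" by blast
  ultimately show "\<exists>U. open U \<and> x \<in> U \<and> U \<subseteq> snd d ` (fst d \<inter> W) \<and> smooth_on U (f \<circ> chart_inv d)"
    using U(3) unfolding chart_smooth_def by blast
qed

lemma chart_smooth_const: "chart_smooth d W (\<lambda>q. c)"
  unfolding chart_smooth_def o_def by (rule smooth_on_const)

lemma chart_smooth_add:
  "chart_smooth d W f \<Longrightarrow> chart_smooth d W g \<Longrightarrow> chart_smooth d W (\<lambda>q. f q + g q)"
  unfolding chart_smooth_def o_def by (rule smooth_on_add)

lemma chart_smooth_sum:
  "(\<And>j. j \<in> I \<Longrightarrow> chart_smooth d W (f j)) \<Longrightarrow> chart_smooth d W (\<lambda>q. \<Sum>j\<in>I. f j q)"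
  unfolding chart_smooth_def o_def by (rule smooth_on_sum)

lemma chart_smooth_scaleR:
  "chart_smooth d W f \<Longrightarrow> chart_smooth d W g \<Longrightarrow> chart_smooth d W (\<lambda>q. f q *\<^sub>R g q)"
  unfolding chart_smooth_def o_def by (rule smooth_on_scaleR)

lemma chart_smooth_inner: "chart_smooth d W f \<Longrightarrow> chart_smooth d W (\<lambda>q. f q \<bullet> b)"
  unfolding chart_smooth_def o_def by (rule smooth_on_inner_const)

lemma chart_smooth_compose:
  assumes "is_chart d" "is_chart c" "open W"
    and "chart_smooth d W (\<lambda>q. snd c (i q))" "chart_smooth c V f"
    and sub: "\<And>q. q \<in> fst d \<Longrightarrow> q \<in> W \<Longrightarrow> i q \<in> fst c \<and> i q \<in> V"
  shows "chart_smooth d W (\<lambda>q. f (i q))"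
proof -
  have *: "((\<lambda>q. snd c (i q)) \<circ> chart_inv d) ` snd d ` (fst d \<inter> W) \<subseteq> snd c ` (fst c \<inter> V)"
  proof safe
    fix q assume "q \<in> fst d" "q \<in> W"
    then show "((\<lambda>q. snd c (i q)) \<circ> chart_inv d) (snd d q) \<in> snd c ` (fst c \<inter> V)"
      using sub[of q] chart_inv_left[OF assms(1), of q] by simp
  qed
  have "chart_smooth d W (\<lambda>q. f (chart_inv c (snd c (i q))))"
    using smooth_on_compose[OF assms(4,5)[unfolded chart_smooth_def] *]
    by (simp add: chart_smooth_def o_def)
  then show ?thesis
    by (rule chart_smooth_transform[OF _ assms(1,3)]) (simp add: sub chart_inv_left[OF assms(2)])
qed

lemma chart_smooth_deriv:
  assumes "is_chart d" "open W" "chart_smooth d W f" "chart_smooth d W w"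
  shows "chart_smooth d W (\<lambda>p. chart_deriv d p f (w p))"
proof -
  note o = open_chart_image[OF assms(1,2)]
  have "smooth_on (snd d ` (fst d \<inter> W)) (\<lambda>x. frechet_derivative (f \<circ> chart_inv d) (at x) ((w \<circ> chart_inv d) x))"
    using assms(3,4) unfolding chart_smooth_def by (rule smooth_on_frechet_derivative[OF o])
  then show ?thesis unfolding chart_smooth_def
  proof (rule smooth_on_transform[OF _ o])
    fix x assume "x \<in> snd d ` (fst d \<inter> W)"
    then obtain q where "q \<in> fst d" "q \<in> W" "x = snd d q" by blast
    then show "frechet_derivative (f \<circ> chart_inv d) (at x) ((w \<circ> chart_inv d) x) =
        ((\<lambda>p. chart_deriv d p f (w p)) \<circ> chart_inv d) x"
      using chart_inv_left[OF assms(1)] by (simp add: chart_deriv_def)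
  qed
qed

lemma chart_smooth_frame_coefficients:
  fixes G :: "'i \<Rightarrow> 'a::topological_space \<Rightarrow> 'e::euclidean_space"
  assumes d: "is_chart d" "open W" and I: "finite I" "card I = DIM('e)" "j \<in> I"
    and G: "\<And>j. j \<in> I \<Longrightarrow> chart_smooth d W (G j)"
    and span: "\<And>p. p \<in> fst d \<Longrightarrow> p \<in> W \<Longrightarrow> span ((\<lambda>j. G j p) ` I) = UNIV"
    and u: "chart_smooth d W u"
      "\<And>p. p \<in> fst d \<Longrightarrow> p \<in> W \<Longrightarrow> u p = (\<Sum>j\<in>I. c j p *\<^sub>R G j p)"
  shows "chart_smooth d W (c j)"
proof -
  have inv: "chart_inv d x \<in> fst d" "chart_inv d x \<in> W" if "x \<in> snd d ` (fst d \<inter> W)" for x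
    using that chart_inv_left[OF d(1)] by auto
  have "smooth_on (snd d ` (fst d \<inter> W)) (\<lambda>x. c j (chart_inv d x))"
    using u(1) G
    by (intro smooth_on_frame_coefficients[OF open_chart_image[OF d] I, of "\<lambda>j x. G j (chart_inv d x)"
          "\<lambda>x. u (chart_inv d x)" "\<lambda>j x. c j (chart_inv d x)"])
      (simp_all add: chart_smooth_def o_def span u(2) inv)
  then show ?thesis by (simp add: chart_smooth_def o_def)
qed

section \<open>Changes of chart and coordinates of tangent vectors\<close>

lemma smooth_atlasD: "smooth_atlas A \<Longrightarrow> c \<in> A \<Longrightarrow> is_chart c"
  by (simp add: smooth_atlas_def)

lemma open_chart_domain: "smooth_atlas A \<Longrightarrow> c \<in> A \<Longrightarrow> open (fst c)"
  using smooth_atlasD is_chart_def by blast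

lemma chart_at_mem:
  assumes "smooth_atlas A"
  shows "chart_at A p \<in> A" "p \<in> fst (chart_at A p)"
proof -
  have "p \<in> (\<Union>c\<in>A. fst c)" using assms unfolding smooth_atlas_def by blast
  then have "\<exists>c. c \<in> A \<and> p \<in> fst c" by blast
  from someI_ex[OF this] show "chart_at A p \<in> A" "p \<in> fst (chart_at A p)"
    unfolding chart_at_def by auto
qed

lemma chart_smooth_transition:
  "smooth_atlas A \<Longrightarrow> c \<in> A \<Longrightarrow> d \<in> A \<Longrightarrow> chart_smooth c (fst d) (snd d)"
  unfolding smooth_atlas_def chart_smooth_def by blast

lemma tan_coord_eq: "tan_coord A c p v = chart_deriv (chart_at A p) p (snd c) v"
  by (simp add: tan_coord_def chart_deriv_def)

lemma const_field_eq: "const_field A c u q = chart_deriv c q (snd (chart_at A q)) u"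
  by (simp add: const_field_def chart_deriv_def)

lemma dir_deriv_eq: "dir_deriv A p v f = chart_deriv (chart_at A p) p f v"
  by (simp add: dir_deriv_def chart_deriv_def)

lemma tan_map_eq:
  "tan_map B A i p w = chart_deriv (chart_at B p) p (\<lambda>q. snd (chart_at A (i p)) (i q)) w"
  by (simp add: tan_map_def chart_deriv_def o_def)

lemma transition_has_deriv:
  assumes "smooth_atlas A" "c \<in> A" "d \<in> A" "p \<in> fst c" "p \<in> fst d"
  shows "chart_has_deriv c p (snd d) (chart_deriv c p (snd d))"
  using chart_smooth_has_deriv[OF chart_smooth_transition[OF assms(1-3)] assms(4,5)] .

lemma chart_has_deriv_change:
  assumes A: "smooth_atlas A" "c \<in> A" "d \<in> A" "p \<in> fst c" "p \<in> fst d"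
    and f: "chart_has_deriv d p f D"
  shows "chart_has_deriv c p f (\<lambda>u. D (chart_deriv c p (snd d) u))"
  using chart_has_deriv_compose[OF smooth_atlasD[OF A(1,2)] A(4) smooth_atlasD[OF A(1,3)]
      open_chart_domain[OF A(1,3)] A(5), of "\<lambda>q. q"] transition_has_deriv[OF A] f
  by simp

lemma chart_deriv_change:
  assumes A: "smooth_atlas A" "c \<in> A" "d \<in> A" "p \<in> fst c" "p \<in> fst d"
    and f: "chart_has_deriv d p f D"
  shows "chart_deriv c p f u = D (chart_deriv c p (snd d) u)"
  using chart_deriv_eq[OF chart_has_deriv_change[OF assms]] by simp

text \<open>The change-of-chart rule is applied to the coordinate map of \<open>e\<close>. The
  outcome makes the detour through the preferred chart harmless: \<open>tan_coord\<close> and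
  \<open>const_field\<close> for the same chart become mutually inverse.\<close>

lemma transition_cocycle:
  assumes A: "smooth_atlas A" "c \<in> A" "d \<in> A" "e \<in> A" "p \<in> fst c" "p \<in> fst d" "p \<in> fst e"
  shows "chart_deriv d p (snd e) (chart_deriv c p (snd d) u) = chart_deriv c p (snd e) u"
  using chart_deriv_change[OF A(1-3,5,6) transition_has_deriv[OF A(1,3,4,6,7)]] by simp

lemma transition_same:
  assumes "is_chart c" "p \<in> fst c"
  shows "chart_deriv c p (snd c) u = u"
proof -
  have o: "open (snd c ` fst c)" using open_chart_image[OF assms(1), of UNIV] by simp
  have "((snd c \<circ> chart_inv c) has_derivative (\<lambda>u. u)) (at (snd c p))"
    by (rule has_derivative_transform_within_open[OF has_derivative_ident o])
      (use assms chart_inv_left[OF assms(1)] in auto)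
  then have "chart_has_deriv c p (snd c) (\<lambda>u. u)" by (simp add: chart_has_deriv_def)
  from chart_deriv_eq[OF this] show ?thesis by simp
qed

lemma linear_tan_coord:
  assumes "smooth_atlas A" "c \<in> A" "p \<in> fst c"
  shows "linear (tan_coord A c p)"
  using chart_has_deriv_linear[OF transition_has_deriv[OF assms(1) chart_at_mem(1)[OF assms(1)]
        assms(2) chart_at_mem(2)[OF assms(1)] assms(3)]]
  by (simp add: tan_coord_eq[abs_def])

lemma linear_const_field:
  assumes "smooth_atlas A" "c \<in> A" "p \<in> fst c"
  shows "linear (\<lambda>u. const_field A c u p)"
  using chart_has_deriv_linear[OF transition_has_deriv[OF assms(1,2) chart_at_mem(1)[OF assms(1)]
        assms(3) chart_at_mem(2)[OF assms(1)]]]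
  by (simp add: const_field_eq)

lemma tan_coord_const_field_trans:
  assumes "smooth_atlas A" "c \<in> A" "d \<in> A" "p \<in> fst c" "p \<in> fst d"
  shows "tan_coord A d p (const_field A c u p) = chart_deriv c p (snd d) u"
  unfolding tan_coord_eq const_field_eq
  using assms chart_at_mem by (intro transition_cocycle) auto

lemma tan_coord_const_field:
  assumes "smooth_atlas A" "c \<in> A" "p \<in> fst c"
  shows "tan_coord A c p (const_field A c u p) = u"
  using tan_coord_const_field_trans[OF assms(1,2,2,3,3)] transition_same[OF smooth_atlasD assms(3)] assms
  by simp

lemma const_field_tan_coord:
  assumes "smooth_atlas A" "c \<in> A" "p \<in> fst c"
  shows "const_field A c (tan_coord A c p v) p = v"
  unfolding tan_coord_eq const_field_eq
  using assms chart_at_mem[OF assms(1)] transition_cocycle[OF assms(1) chart_at_mem(1) assms(2) chart_at_mem(1)]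
    transition_same[OF smooth_atlasD]
  by metis

lemma tan_coord_chart_at:
  assumes "smooth_atlas A"
  shows "tan_coord A (chart_at A p) p v = v"
  using transition_same[OF smooth_atlasD[OF assms]] chart_at_mem[OF assms] by (simp add: tan_coord_eq)

lemma const_field_chart_at:
  assumes "smooth_atlas A"
  shows "const_field A (chart_at A p) v p = v"
  using transition_same[OF smooth_atlasD[OF assms]] chart_at_mem[OF assms] by (simp add: const_field_eq)

text \<open>\<open>dir_deriv\<close> is defined through the preferred chart, which may jump with
  \<open>p\<close>; freed from that choice it can be followed in one fixed chart.\<close>

lemma dir_deriv_chart:
  assumes "smooth_atlas A" "d \<in> A" "p \<in> fst d" "chart_has_deriv d p f D"
  shows "dir_deriv A p v f = D (tan_coord A d p v)"
  unfolding dir_deriv_eq tan_coord_eq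
  by (rule chart_deriv_change[OF assms(1) chart_at_mem(1)[OF assms(1)] assms(2)
        chart_at_mem(2)[OF assms(1)] assms(3,4)])

section \<open>Smooth sections, pull-backs and the differential in charts\<close>

lemma smooth_along_iff:
  "smooth_along B A i U V \<longleftrightarrow> (\<forall>d\<in>B. \<forall>c\<in>A.
    chart_smooth d (U \<inter> i -` fst c) (\<lambda>p. tan_coord A c (i p) (V p)))"
  by (simp add: smooth_along_def chart_smooth_def o_def Int_assoc)

lemma smooth_fieldD:
  "smooth_field A U V \<Longrightarrow> c \<in> A \<Longrightarrow> chart_smooth c U (\<lambda>p. tan_coord A c p (V p))"
proof -
  assume "smooth_field A U V" "c \<in> A"
  then have "chart_smooth c (U \<inter> fst c) (\<lambda>p. tan_coord A c p (V p))"
    by (simp add: smooth_along_iff)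
  moreover have "fst c \<inter> (U \<inter> fst c) = fst c \<inter> U" by blast
  ultimately show ?thesis by (simp add: chart_smooth_def)
qed

lemma smooth_fun_iff: "smooth_fun A U f \<longleftrightarrow> (\<forall>c\<in>A. chart_smooth c U f)"
  by (simp add: smooth_fun_def chart_smooth_def)

lemma smooth_mapD:
  "smooth_map B A i \<Longrightarrow> d \<in> B \<Longrightarrow> c \<in> A \<Longrightarrow> chart_smooth d (i -` fst c) (\<lambda>p. snd c (i p))"
  by (simp add: smooth_map_def chart_smooth_def o_def)

lemma smooth_map_open:
  "smooth_map B A i \<Longrightarrow> open U \<Longrightarrow> open (i -` U)"
  unfolding smooth_map_def using continuous_on_open_vimage[OF open_UNIV, of i] by auto

text \<open>The coordinates of the field in a chart \<open>e\<close> are the derivative of the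
  transition from \<open>c\<close> to \<open>e\<close> in the fixed direction \<open>u\<close>. This
  is smooth when read in \<open>c\<close>, and hence when read in any chart
  \<open>d\<close>.\<close>

lemma const_field_smooth:
  assumes A: "smooth_atlas A" "c \<in> A"
  shows "smooth_field A (fst c) (const_field A c u)"
  unfolding smooth_along_iff
proof (intro ballI)
  fix d e assume d: "d \<in> A" and e: "e \<in> A"
  have o: "open (fst c \<inter> fst e)" using open_chart_domain[OF A(1)] A(2) e by blast
  have "chart_smooth c (fst e) (\<lambda>p. chart_deriv c p (snd e) u)"
    using A e by (intro chart_smooth_deriv chart_smooth_transition chart_smooth_const
        smooth_atlasD open_chart_domain)
  then have "chart_smooth d (fst c \<inter> fst e) (\<lambda>p. chart_deriv c p (snd e) u)"
    using chart_smooth_compose[of d c "fst c \<inter> fst e" "\<lambda>p. p" "fst e"] smooth_atlasD[OF A(1)] A(2) d o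
      chart_smooth_subset[OF chart_smooth_transition[OF A(1) d A(2)], of "fst c \<inter> fst e"]
    by auto
  then have "chart_smooth d (fst c \<inter> fst e) (\<lambda>p. tan_coord A e p (const_field A c u p))"
    by (rule chart_smooth_transform[OF _ smooth_atlasD[OF A(1) d] o])
      (simp add: tan_coord_const_field_trans[OF A e])
  then show "chart_smooth d (fst c \<inter> (\<lambda>p. p) -` fst e) (\<lambda>p. tan_coord A e p (const_field A c u p))"
    by simp
qed

lemma chart_smooth_pullback:
  assumes B: "smooth_atlas B" "d \<in> B" and A: "smooth_atlas A" "c \<in> A" and i: "smooth_map B A i"
    and U: "open U" and f: "chart_smooth c U f"
  shows "chart_smooth d (i -` (U \<inter> fst c)) (\<lambda>p. f (i p))"
proof (rule chart_smooth_compose[OF smooth_atlasD[OF B] smooth_atlasD[OF A] _ _ f])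
  show "open (i -` (U \<inter> fst c))" using smooth_map_open[OF i] U open_chart_domain[OF A] by blast
  show "chart_smooth d (i -` (U \<inter> fst c)) (\<lambda>p. snd c (i p))"
    by (rule chart_smooth_subset[OF smooth_mapD[OF i B(2) A(2)]]) blast
qed auto

lemma chart_has_deriv_pullback:
  assumes B: "smooth_atlas B" "d \<in> B" "p \<in> fst d" and A: "smooth_atlas A" "c \<in> A" "i p \<in> fst c"
    and i: "smooth_map B A i" and f: "chart_has_deriv c (i p) f D"
  shows "chart_has_deriv d p (\<lambda>q. f (i q)) (\<lambda>w. D (chart_deriv d p (\<lambda>q. snd c (i q)) w))"
proof (rule chart_has_deriv_compose[OF smooth_atlasD[OF B(1,2)] B(3) smooth_atlasD[OF A(1,2)]])
  show "open (i -` fst c)" by (rule smooth_map_open[OF i open_chart_domain[OF A(1,2)]])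
  show "p \<in> i -` fst c" "i ` i -` fst c \<subseteq> fst c" using A(3) by auto
  show "chart_has_deriv d p (\<lambda>q. snd c (i q)) (chart_deriv d p (\<lambda>q. snd c (i q)))"
    using A(3) by (intro chart_smooth_has_deriv[OF smooth_mapD[OF i B(2) A(2)] B(3)]) auto
qed (rule f)

text \<open>Chart independence of the differential: \<open>tan_map\<close> is defined by two
  preferred charts, and the chain rule with a transition on either side replaces them by
  \<open>c\<close> and \<open>d\<close>.\<close>

lemma tan_coord_tan_map:
  assumes B: "smooth_atlas B" "d \<in> B" "p \<in> fst d" and A: "smooth_atlas A" "c \<in> A" "i p \<in> fst c"
    and i: "smooth_map B A i"
  shows "tan_coord A c (i p) (tan_map B A i p w) =
    chart_deriv d p (\<lambda>q. snd c (i q)) (tan_coord B d p w)"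
proof -
  let ?a = "chart_at A (i p)" and ?b = "chart_at B p"
  note a = chart_at_mem[OF A(1), of "i p"] and b = chart_at_mem[OF B(1), of p]
  have "chart_has_deriv ?b p (\<lambda>q. snd c (i q))
     (\<lambda>w. chart_deriv ?a (i p) (snd c) (chart_deriv ?b p (\<lambda>q. snd ?a (i q)) w))"
    by (rule chart_has_deriv_pullback[OF B(1) b A(1) a i transition_has_deriv[OF A(1) a(1) A(2) a(2) A(3)]])
  from chart_deriv_eq[OF this]
  have "tan_coord A c (i p) (tan_map B A i p w) = chart_deriv ?b p (\<lambda>q. snd c (i q)) w"
    by (simp add: tan_coord_eq tan_map_eq)
  also have "\<dots> = chart_deriv d p (\<lambda>q. snd c (i q)) (tan_coord B d p w)"
    unfolding tan_coord_eq using A(3)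
    by (intro chart_deriv_change[OF B(1) b(1) B(2) b(2) B(3)]
        chart_smooth_has_deriv[OF smooth_mapD[OF i B(2) A(2)] B(3)]) auto
  finally show ?thesis .
qed

lemma dir_deriv_pullback:
  assumes B: "smooth_atlas B" and A: "smooth_atlas A" "c \<in> A" "i p \<in> fst c"
    and i: "smooth_map B A i" and f: "chart_has_deriv c (i p) f D"
  shows "dir_deriv B p w (\<lambda>q. f (i q)) = dir_deriv A (i p) (tan_map B A i p w) f"
proof -
  let ?b = "chart_at B p"
  note b = chart_at_mem[OF B, of p]
  have "dir_deriv B p w (\<lambda>q. f (i q)) = D (chart_deriv ?b p (\<lambda>q. snd c (i q)) w)"
    unfolding dir_deriv_eq using chart_deriv_eq[OF chart_has_deriv_pullback[OF B b A i f]] by simp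
  also have "\<dots> = D (tan_coord A c (i p) (tan_map B A i p w))"
    using tan_coord_tan_map[OF B b A i] tan_coord_chart_at[OF B] by simp
  also have "\<dots> = dir_deriv A (i p) (tan_map B A i p w) f"
    using dir_deriv_chart[OF A f] by simp
  finally show ?thesis .
qed

lemma linear_tan_map:
  assumes B: "smooth_atlas B" and A: "smooth_atlas A" and i: "smooth_map B A i"
  shows "linear (tan_map B A i p)"
proof -
  note a = chart_at_mem[OF A, of "i p"] and b = chart_at_mem[OF B, of p]
  have "chart_has_deriv (chart_at B p) p (\<lambda>q. snd (chart_at A (i p)) (i q))
     (chart_deriv (chart_at B p) p (\<lambda>q. snd (chart_at A (i p)) (i q)))"
    using a(2) by (intro chart_smooth_has_deriv[OF smooth_mapD[OF i b(1) a(1)] b(2)]) auto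
  from chart_has_deriv_linear[OF this] show ?thesis by (simp add: tan_map_eq[abs_def])
qed

section \<open>Connections along a map\<close>

text \<open>Asking of the map just that preimages of open sets are open lets the identity qualify at
  once, so that the lemma covers ordinary vector fields.\<close>

lemma smooth_along_sum:
  assumes B: "smooth_atlas B" and A: "smooth_atlas A" and i: "\<And>W. open W \<Longrightarrow> open (i -` W)" and U: "open U"
    and f: "\<And>j d. j \<in> I \<Longrightarrow> d \<in> B \<Longrightarrow> chart_smooth d U (f j)"
    and V: "\<And>j. j \<in> I \<Longrightarrow> smooth_along B A i U (V j)"
  shows "smooth_along B A i U (\<lambda>p. \<Sum>j\<in>I. f j p *\<^sub>R V j p)"
  unfolding smooth_along_iff
proof (intro ballI)
  fix d c assume d: "d \<in> B" and c: "c \<in> A"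
  have o: "open (U \<inter> i -` fst c)" using U i[OF open_chart_domain[OF A c]] by blast
  have "chart_smooth d (U \<inter> i -` fst c) (f j)" if "j \<in> I" for j
    using chart_smooth_subset[OF f[OF that d]] by blast
  then have "chart_smooth d (U \<inter> i -` fst c) (\<lambda>p. \<Sum>j\<in>I. f j p *\<^sub>R tan_coord A c (i p) (V j p))"
    using V d c by (intro chart_smooth_sum chart_smooth_scaleR) (auto simp: smooth_along_iff)
  then show "chart_smooth d (U \<inter> i -` fst c) (\<lambda>p. tan_coord A c (i p) (\<Sum>j\<in>I. f j p *\<^sub>R V j p))"
    by (rule chart_smooth_transform[OF _ smooth_atlasD[OF B d] o])
      (simp add: linear_sum[OF linear_tan_coord[OF A c]] linear_scale[OF linear_tan_coord[OF A c]])
qed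

lemma smooth_field_nearI: "smooth_field A U X \<Longrightarrow> open U \<Longrightarrow> p \<in> U \<Longrightarrow> smooth_field_near A p X"
  unfolding smooth_field_near_def by blast

lemma dir_deriv_const: "dir_deriv A p v (\<lambda>q. c) = 0"
  unfolding dir_deriv_eq chart_deriv_eq[OF chart_has_deriv_const] ..

section \<open>Local expressions of a linear connection\<close>

lemma
  assumes nab: "linear_connection A nab" and Y: "smooth_field_near A p Y"
  shows connection_linear: "linear (\<lambda>v. nab p v Y)"
    and connection_add: "smooth_field_near A p Z \<Longrightarrow> nab p v (\<lambda>q. Y q + Z q) = nab p v Y + nab p v Z"
    and connection_leibniz: "smooth_fun_near A p f \<Longrightarrow>
      nab p v (\<lambda>q. f q *\<^sub>R Y q) = dir_deriv A p v f *\<^sub>R Y p + f p *\<^sub>R nab p v Y"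
  using assms by (simp_all add: linear_connection_def)

text \<open>The indicator \<open>f\<close> of \<open>U\<close> is smooth near \<open>p\<close> with
  derivative zero there, and the products of \<open>f\<close> with the two fields agree on the whole
  manifold. The Leibniz rule then strips \<open>f\<close> off at \<open>p\<close>.\<close>

lemma connection_cong:
  assumes A: "smooth_atlas A" and nab: "linear_connection A nab"
    and Y: "smooth_field_near A p Y" and Z: "smooth_field_near A p Z"
    and U: "open U" "p \<in> U" "\<And>q. q \<in> U \<Longrightarrow> Y q = Z q"
  shows "nab p v Y = nab p v Z"
proof -
  define f :: "'a \<Rightarrow> real" where "f q = (if q \<in> U then 1 else 0)" for q
  have "smooth_fun A U f" unfolding smooth_fun_iff
  proof
    fix c assume "c \<in> A"
    show "chart_smooth c U f"
      by (rule chart_smooth_transform[OF chart_smooth_const[of c U 1] smooth_atlasD[OF A \<open>c \<in> A\<close>] U(1)])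
        (simp add: f_def)
  qed
  then have f: "smooth_fun_near A p f" using U unfolding smooth_fun_near_def by blast
  have "chart_has_deriv (chart_at A p) p f (\<lambda>w. 0)"
    by (rule chart_has_deriv_transform[OF chart_has_deriv_const[of _ _ 1]
          smooth_atlasD[OF A chart_at_mem(1)[OF A]] chart_at_mem(2)[OF A] U(1,2)])
      (simp add: f_def)
  then have d: "dir_deriv A p v f = 0" by (simp add: dir_deriv_eq chart_deriv_eq)
  have "(\<lambda>q. f q *\<^sub>R Y q) = (\<lambda>q. f q *\<^sub>R Z q)" using U(3) by (auto simp: f_def)
  moreover have "nab p v (\<lambda>q. f q *\<^sub>R Y q) = nab p v Y" "nab p v (\<lambda>q. f q *\<^sub>R Z q) = nab p v Z"
    using U(2) by (simp_all add: connection_leibniz[OF nab Y f] connection_leibniz[OF nab Z f] d)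
      (simp_all add: f_def)
  ultimately show ?thesis by simp
qed

lemma connection_sum:
  assumes A: "smooth_atlas A" and nab: "linear_connection A nab" and U: "open U" "p \<in> U"
    and I: "finite I"
    and f: "\<And>j. j \<in> I \<Longrightarrow> smooth_fun A U (f j)"
    and Y: "\<And>j. j \<in> I \<Longrightarrow> smooth_field A U (Y j)"
  shows "nab p v (\<lambda>q. \<Sum>j\<in>I. f j q *\<^sub>R Y j q) =
    (\<Sum>j\<in>I. dir_deriv A p v (f j) *\<^sub>R Y j p + f j p *\<^sub>R nab p v (Y j))"
proof -
  have add: "nab p v (\<lambda>q. Y q + Z q) = nab p v Y + nab p v Z"
    if "smooth_field A U Y" "smooth_field A U Z" for Y Z
    by (rule connection_add[OF nab smooth_field_nearI[OF that(1) U] smooth_field_nearI[OF that(2) U]])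
  have sm: "smooth_field A U (\<lambda>q. \<Sum>j\<in>I. f j q *\<^sub>R Y j q)"
    if "\<And>j. j \<in> I \<Longrightarrow> smooth_fun A U (f j)" "\<And>j. j \<in> I \<Longrightarrow> smooth_field A U (Y j)" for I
    using that by (intro smooth_along_sum[OF A A _ U(1)]) (auto simp: smooth_fun_iff)
  show ?thesis using I f Y
  proof (induction I)
    case empty
    \<comment> \<open>Additivity for the zero field reads
      \<open>nab 0 = nab 0 + nab 0\<close>.\<close>
    show ?case using add[OF sm[of "{}"] sm[of "{}"]] by simp
  next
    case (insert k I)
    have s: "nab p v (\<lambda>q. f k q *\<^sub>R Y k q) = dir_deriv A p v (f k) *\<^sub>R Y k p + f k p *\<^sub>R nab p v (Y k)"
    proof -
      have "smooth_fun_near A p (f k)" using insert.prems(1)[of k] U unfolding smooth_fun_near_def by blast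
      moreover have "smooth_field_near A p (Y k)" using insert.prems(2)[of k] U by (blast intro: smooth_field_nearI)
      ultimately show ?thesis by (intro connection_leibniz[OF nab])
    qed
    have "nab p v (\<lambda>q. f k q *\<^sub>R Y k q + (\<Sum>j\<in>I. f j q *\<^sub>R Y j q)) =
        nab p v (\<lambda>q. f k q *\<^sub>R Y k q) + nab p v (\<lambda>q. \<Sum>j\<in>I. f j q *\<^sub>R Y j q)"
      using sm[of "{k}"] sm[of I] insert.prems by (intro add) auto
    with s insert show ?case by simp
  qed
qed

text \<open>The field is linear in \<open>u\<close> over the domain of \<open>c\<close>, where the
  transitions are differentiable; locality of the connection carries this over to
  \<open>nab\<close>.\<close>

lemma connection_const_field:
  assumes A: "smooth_atlas A" "c \<in> A" "p \<in> fst c" and nab: "linear_connection A nab"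
  shows "linear (\<lambda>u. nab p v (const_field A c u))"
proof -
  have "nab p v (const_field A c u) = (\<Sum>b\<in>Basis. (u \<bullet> b) *\<^sub>R nab p v (const_field A c b))" for u
  proof -
    have o: "open (fst c)" by (rule open_chart_domain[OF A(1,2)])
    have sm: "smooth_field A (fst c) (const_field A c b)" for b by (rule const_field_smooth[OF A(1,2)])
    have smf: "smooth_fun A (fst c) (\<lambda>q. u \<bullet> b)" for b
      by (simp add: smooth_fun_iff chart_smooth_const)
    have "nab p v (const_field A c u) = nab p v (\<lambda>q. \<Sum>b\<in>Basis. (u \<bullet> b) *\<^sub>R const_field A c b q)"
    proof (rule connection_cong[OF A(1) nab _ _ o A(3)])
      show "smooth_field_near A p (const_field A c u)" by (rule smooth_field_nearI[OF sm o A(3)])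
      show "smooth_field_near A p (\<lambda>q. \<Sum>b\<in>Basis. (u \<bullet> b) *\<^sub>R const_field A c b q)"
        by (rule smooth_field_nearI[OF smooth_along_sum[OF A(1,1) _ o chart_smooth_const sm] o A(3)]) simp
      fix q assume "q \<in> fst c"
      from linear_expand[OF linear_const_field[OF A(1,2) this]]
      show "const_field A c u q = (\<Sum>b\<in>Basis. (u \<bullet> b) *\<^sub>R const_field A c b q)" .
    qed
    also have "\<dots> = (\<Sum>b\<in>Basis. (u \<bullet> b) *\<^sub>R nab p v (const_field A c b))"
      by (subst connection_sum[OF A(1) nab o A(3) finite_Basis smf sm]) (simp add: dir_deriv_const)
    finally show ?thesis .
  qed
  note eq = this
  show ?thesis
    by (rule linearI; subst eq; subst (2) eq; (subst (3) eq)?)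
      (simp_all add: inner_add_left scaleR_add_left sum.distrib scaleR_sum_right)
qed

lemma connection_chart:
  assumes A: "smooth_atlas A" "c \<in> A" "p \<in> fst c" and nab: "linear_connection A nab"
    and W: "smooth_field A U W" "open U" "p \<in> U"
  shows "nab p v W = (\<Sum>b\<in>Basis. dir_deriv A p v (\<lambda>q. tan_coord A c q (W q) \<bullet> b) *\<^sub>R const_field A c b p +
    (tan_coord A c p (W p) \<bullet> b) *\<^sub>R nab p v (const_field A c b))"
proof -
  let ?f = "\<lambda>b q. tan_coord A c q (W q) \<bullet> b"
  have o: "open (U \<inter> fst c)" using open_chart_domain[OF A(1,2)] W(2) by blast
  have p: "p \<in> U \<inter> fst c" using A(3) W(3) by blast
  have smf: "smooth_fun A (U \<inter> fst c) (?f b)" for b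
    using W(1) A(2) unfolding smooth_fun_iff smooth_along_iff
    by (intro ballI chart_smooth_inner) simp
  have smc: "smooth_field A (U \<inter> fst c) (const_field A c b)" for b
    using const_field_smooth[OF A(1,2), of b] unfolding smooth_along_iff
    by (meson chart_smooth_subset inf_le2 Int_mono order_refl)
  have "nab p v W = nab p v (\<lambda>q. \<Sum>b\<in>Basis. ?f b q *\<^sub>R const_field A c b q)"
  proof (rule connection_cong[OF A(1) nab _ _ o p])
    show "smooth_field_near A p W" by (rule smooth_field_nearI[OF W])
    show "smooth_field_near A p (\<lambda>q. \<Sum>b\<in>Basis. ?f b q *\<^sub>R const_field A c b q)"
      using smf by (intro smooth_field_nearI[OF smooth_along_sum[OF A(1,1) _ o _ smc] o p])
        (auto simp: smooth_fun_iff)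
    fix q assume "q \<in> U \<inter> fst c"
    then have q: "q \<in> fst c" by blast
    from linear_expand[OF linear_const_field[OF A(1,2) q]]
    have "const_field A c (tan_coord A c q (W q)) q = (\<Sum>b\<in>Basis. ?f b q *\<^sub>R const_field A c b q)" .
    then show "W q = (\<Sum>b\<in>Basis. ?f b q *\<^sub>R const_field A c b q)"
      by (simp only: const_field_tan_coord[OF A(1,2) q])
  qed
  then show ?thesis by (simp only: connection_sum[OF A(1) nab o p finite_Basis smf smc])
qed

text \<open>\<open>cov_deriv_along\<close> imitates this formula: the derivative of the coordinates
  in the preferred chart, plus the connection on the field with frozen coordinates. It is the link
  from that definition back to the ambient connection.\<close>

lemma connection_chart_at:
  assumes A: "smooth_atlas A" and nab: "linear_connection A nab"
    and W: "smooth_field A U W" "open U" "p \<in> U"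
  shows "nab p v W = dir_deriv A p v (\<lambda>q. tan_coord A (chart_at A p) q (W q)) +
    nab p v (const_field A (chart_at A p) (W p))"
proof -
  let ?c = "chart_at A p"
  note c = chart_at_mem[OF A, of p]
  define G where "G q = tan_coord A ?c q (W q)" for q
  have G: "chart_has_deriv ?c p G (chart_deriv ?c p G)"
    using chart_smooth_has_deriv[OF smooth_fieldD[OF W(1) c(1)] c(2) W(3)] by (simp add: G_def[abs_def])
  have Gb: "dir_deriv A p v (\<lambda>q. G q \<bullet> b) = dir_deriv A p v G \<bullet> b" for b
    using chart_deriv_eq[OF chart_has_deriv_inner[OF G]] by (simp add: dir_deriv_eq)
  have Gp: "G p = W p" by (simp add: G_def tan_coord_chart_at[OF A])
  have "nab p v W = (\<Sum>b\<in>Basis. dir_deriv A p v (\<lambda>q. G q \<bullet> b) *\<^sub>R const_field A ?c b p +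
    (G p \<bullet> b) *\<^sub>R nab p v (const_field A ?c b))"
    unfolding G_def by (rule connection_chart[OF A c nab W])
  also have "\<dots> = dir_deriv A p v G + (\<Sum>b\<in>Basis. (W p \<bullet> b) *\<^sub>R nab p v (const_field A ?c b))"
    by (simp add: Gb Gp const_field_chart_at[OF A] sum.distrib euclidean_representation)
  also have "(\<Sum>b\<in>Basis. (W p \<bullet> b) *\<^sub>R nab p v (const_field A ?c b)) = nab p v (const_field A ?c (W p))"
    by (rule linear_expand[OF connection_const_field[OF A c nab], symmetric])
  finally show ?thesis by (simp only: G_def[abs_def])
qed

lemma cov_deriv_along_frame:
  assumes B: "smooth_atlas B" and A: "smooth_atlas A" and i: "smooth_map B A i"
    and inj: "inj (tan_map B A i p)" and nab: "linear_connection A nab"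
    and W: "open O'" "i p \<in> O'" "\<And>j. j \<in> I \<Longrightarrow> smooth_field A O' (W j)"
    and f: "\<And>j. j \<in> I \<Longrightarrow> chart_has_deriv (chart_at B p) p (f j) (D j)"
    and U: "open U" "p \<in> U" "\<And>q. q \<in> U \<Longrightarrow> Y q = (\<Sum>j\<in>I. f j q *\<^sub>R W j (i q))"
  shows "cov_deriv_along B A i nab p (tan_map B A i p w) Y =
    (\<Sum>j\<in>I. dir_deriv B p w (f j) *\<^sub>R W j (i p) + f j p *\<^sub>R nab (i p) (tan_map B A i p w) (W j))"
proof -
  let ?a = "chart_at A (i p)" and ?b = "chart_at B p" and ?v = "tan_map B A i p w"
  note a = chart_at_mem[OF A, of "i p"] and b = chart_at_mem[OF B, of p]
  note cb = smooth_atlasD[OF B b(1)]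
  define G where "G j q = tan_coord A ?a q (W j q)" for j q
  have G: "chart_has_deriv ?a (i p) (G j) (chart_deriv ?a (i p) (G j))" if "j \<in> I" for j
    using chart_smooth_has_deriv[OF smooth_fieldD[OF W(3)[OF that] a(1)] a(2) W(2)]
    by (simp add: G_def[abs_def])
  have Gp: "G j (i p) = W j (i p)" for j by (simp add: G_def tan_coord_chart_at[OF A])
  define E where "E j = chart_deriv ?b p (\<lambda>q. G j (i q))" for j
  have E: "chart_has_deriv ?b p (\<lambda>q. G j (i q)) (E j)" if "j \<in> I" for j
    using chart_has_deriv_pullback[OF B b A a i G[OF that]] unfolding E_def
    by (simp add: chart_deriv_eq)
  have "chart_has_deriv ?b p (\<lambda>q. \<Sum>j\<in>I. f j q *\<^sub>R G j (i q))
      (\<lambda>w. \<Sum>j\<in>I. f j p *\<^sub>R E j w + D j w *\<^sub>R G j (i p))"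
    using f E by (intro chart_has_deriv_sum chart_has_deriv_scaleR cb b(2))
  then have "chart_has_deriv ?b p (\<lambda>q. tan_coord A ?a (i q) (Y q))
      (\<lambda>w. \<Sum>j\<in>I. f j p *\<^sub>R E j w + D j w *\<^sub>R G j (i p))"
  proof (rule chart_has_deriv_transform[OF _ cb b(2)])
    show "open (U \<inter> i -` fst ?a)"
      using U(1) smooth_map_open[OF i open_chart_domain[OF A a(1)]] by blast
    show "p \<in> U \<inter> i -` fst ?a" using U(2) a(2) by blast
    fix q assume "q \<in> U \<inter> i -` fst ?a"
    then have q: "q \<in> U" "i q \<in> fst ?a" by blast+
    show "(\<Sum>j\<in>I. f j q *\<^sub>R G j (i q)) = tan_coord A ?a (i q) (Y q)"
      unfolding U(3)[OF q(1)] G_def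
      by (simp add: linear_sum[OF linear_tan_coord[OF A a(1) q(2)]]
          linear_scale[OF linear_tan_coord[OF A a(1) q(2)]])
  qed
  from chart_deriv_eq[OF this]
  have 1: "dir_deriv B p w (\<lambda>q. tan_coord A ?a (i q) (Y q)) =
      (\<Sum>j\<in>I. f j p *\<^sub>R E j w + D j w *\<^sub>R W j (i p))"
    by (simp add: dir_deriv_eq Gp)
  have Ew: "E j w = dir_deriv A (i p) ?v (G j)" if "j \<in> I" for j
    using dir_deriv_pullback[OF B A a i G[OF that], of w] by (simp add: E_def dir_deriv_eq)
  have Dw: "D j w = dir_deriv B p w (f j)" if "j \<in> I" for j
    using chart_deriv_eq[OF f[OF that]] by (simp add: dir_deriv_eq)
  note L = connection_const_field[OF A a nab, of ?v]
  have 2: "nab (i p) ?v (const_field A ?a (Y p)) =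
      (\<Sum>j\<in>I. f j p *\<^sub>R nab (i p) ?v (const_field A ?a (W j (i p))))"
    unfolding U(3)[OF U(2)] by (simp add: linear_sum[OF L] linear_scale[OF L])
  have 3: "nab (i p) ?v (W j) = E j w + nab (i p) ?v (const_field A ?a (W j (i p)))" if "j \<in> I" for j
    unfolding Ew[OF that] G_def[abs_def] by (rule connection_chart_at[OF A nab W(3)[OF that] W(1,2)])
  \<comment> \<open>Injectivity of the differential identifies the direction hidden in the definite
    description of \<open>cov_deriv_along\<close>.\<close>
  have "(THE w'. tan_map B A i p w' = ?v) = w"
    using inj by (intro the_equality) (auto dest: injD)
  then have "cov_deriv_along B A i nab p ?v Y = (\<Sum>j\<in>I. f j p *\<^sub>R E j w + D j w *\<^sub>R W j (i p)) +
      (\<Sum>j\<in>I. f j p *\<^sub>R nab (i p) ?v (const_field A ?a (W j (i p))))"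
    by (simp add: cov_deriv_along_def Let_def 1 2)
  also have "\<dots> = (\<Sum>j\<in>I. dir_deriv B p w (f j) *\<^sub>R W j (i p) + f j p *\<^sub>R nab (i p) ?v (W j))"
    unfolding sum.distrib[symmetric] by (intro sum.cong refl) (simp add: Dw 3 algebra_simps)
  finally show ?thesis .
qed

lemma section_expand:
  assumes A: "smooth_atlas A" "c \<in> A" "p \<in> fst c"
  shows "v = (\<Sum>b\<in>Basis. (tan_coord A c p v \<bullet> b) *\<^sub>R const_field A c b p)"
  using linear_expand[OF linear_const_field[OF A], of "tan_coord A c p v"]
  by (simp only: const_field_tan_coord[OF A])

lemma section_coord_has_deriv:
  assumes Y: "smooth_along B A i UNIV Y" and "d \<in> B" "c \<in> A" "p \<in> fst d" "i p \<in> fst c"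
  shows "chart_has_deriv d p (\<lambda>q. tan_coord A c (i q) (Y q) \<bullet> b)
    (chart_deriv d p (\<lambda>q. tan_coord A c (i q) (Y q) \<bullet> b))"
proof (rule chart_smooth_has_deriv)
  show "chart_smooth d (i -` fst c) (\<lambda>q. tan_coord A c (i q) (Y q) \<bullet> b)"
    using Y assms(2,3) unfolding smooth_along_iff by (intro chart_smooth_inner) simp
qed (use assms in auto)

text \<open>Any chart \<open>c\<close> around \<open>i p\<close> is allowed. Smoothness in
  \<open>p\<close> needs such a fixed chart, whereas the definition refers to the preferred
  one.\<close>

lemma cov_deriv_along_chart:
  assumes B: "smooth_atlas B" and A: "smooth_atlas A" "c \<in> A" "i p \<in> fst c" and i: "smooth_map B A i"
    and inj: "inj (tan_map B A i p)" and nab: "linear_connection A nab"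
    and Y: "smooth_along B A i UNIV Y"
  shows "cov_deriv_along B A i nab p (tan_map B A i p w) Y =
    (\<Sum>b\<in>Basis. dir_deriv B p w (\<lambda>q. tan_coord A c (i q) (Y q) \<bullet> b) *\<^sub>R const_field A c b (i p) +
      (tan_coord A c (i p) (Y p) \<bullet> b) *\<^sub>R nab (i p) (tan_map B A i p w) (const_field A c b))"
proof (rule cov_deriv_along_frame[OF B A(1) i inj nab open_chart_domain[OF A(1,2)] A(3)])
  show "smooth_field A (fst c) (const_field A c b)" for b by (rule const_field_smooth[OF A(1,2)])
  show "open (i -` fst c)" by (rule smooth_map_open[OF i open_chart_domain[OF A(1,2)]])
  show "p \<in> i -` fst c" using A(3) by simp
  show "chart_has_deriv (chart_at B p) p (\<lambda>q. tan_coord A c (i q) (Y q) \<bullet> b)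
    (chart_deriv (chart_at B p) p (\<lambda>q. tan_coord A c (i q) (Y q) \<bullet> b))" for b
    by (rule section_coord_has_deriv[OF Y chart_at_mem(1)[OF B] A(2) chart_at_mem(2)[OF B] A(3)])
  show "Y q = (\<Sum>b\<in>Basis. (tan_coord A c (i q) (Y q) \<bullet> b) *\<^sub>R const_field A c b (i q))"
    if "q \<in> i -` fst c" for q
    using that by (intro section_expand[OF A(1,2)]) simp
qed

text \<open>Parallelism of \<open>J\<close> concerns ambient fields. When \<open>Y\<close> is
  expanded in a coordinate frame and \<open>J Y\<close> in the images of that frame, the
  coefficients coincide; so the connection meets frame fields only, and \<open>J\<close> factors out
  by linearity.\<close>

lemma cov_deriv_along_complex_structure:
  assumes B: "smooth_atlas B" and K: "indefinite_kaehler A J g k nab" and i: "smooth_map B A i"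
    and inj: "inj (tan_map B A i p)" and Y: "smooth_along B A i UNIV Y"
  shows "cov_deriv_along B A i nab p (tan_map B A i p w) (\<lambda>q. J (i q) (Y q)) =
    J (i p) (cov_deriv_along B A i nab p (tan_map B A i p w) Y)"
proof -
  have A: "smooth_atlas A" and nab: "linear_connection A nab"
    and J: "linear (J p)" "open U \<Longrightarrow> smooth_field A U X \<Longrightarrow> smooth_field A U (\<lambda>p. J p (X p))"
    and par: "smooth_field_near A p Z \<Longrightarrow> nab p v (\<lambda>q. J q (Z q)) = J p (nab p v Z)" for p U X v Z
    using K unfolding indefinite_kaehler_def levi_civita_def almost_complex_structure_def by blast+
  let ?a = "chart_at A (i p)" and ?v = "tan_map B A i p w"
  note a = chart_at_mem[OF A, of "i p"]
  let ?f = "\<lambda>b q. tan_coord A ?a (i q) (Y q) \<bullet> b"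
  note o = open_chart_domain[OF A a(1)]
  have "cov_deriv_along B A i nab p ?v (\<lambda>q. J (i q) (Y q)) =
    (\<Sum>b\<in>Basis. dir_deriv B p w (?f b) *\<^sub>R J (i p) (const_field A ?a b (i p)) +
      ?f b p *\<^sub>R nab (i p) ?v (\<lambda>q. J q (const_field A ?a b q)))"
  proof (rule cov_deriv_along_frame[OF B A i inj nab o a(2)])
    show "smooth_field A (fst ?a) (\<lambda>q. J q (const_field A ?a b q))" for b
      by (rule J(2)[OF o const_field_smooth[OF A a(1)]])
    show "open (i -` fst ?a)" by (rule smooth_map_open[OF i o])
    show "p \<in> i -` fst ?a" using a(2) by simp
    show "chart_has_deriv (chart_at B p) p (?f b) (chart_deriv (chart_at B p) p (?f b))" for b
      by (rule section_coord_has_deriv[OF Y chart_at_mem(1)[OF B] a(1) chart_at_mem(2)[OF B] a(2)])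
    fix q assume "q \<in> i -` fst ?a"
    then have "i q \<in> fst ?a" by simp
    from section_expand[OF A a(1) this]
    have "J (i q) (Y q) = J (i q) (\<Sum>b\<in>Basis. ?f b q *\<^sub>R const_field A ?a b (i q))" by simp
    then show "J (i q) (Y q) = (\<Sum>b\<in>Basis. ?f b q *\<^sub>R J (i q) (const_field A ?a b (i q)))"
      by (simp add: linear_sum[OF J(1)] linear_scale[OF J(1)])
  qed
  also have "\<dots> = (\<Sum>b\<in>Basis. dir_deriv B p w (?f b) *\<^sub>R J (i p) (const_field A ?a b (i p)) +
      ?f b p *\<^sub>R J (i p) (nab (i p) ?v (const_field A ?a b)))"
    using par[OF smooth_field_nearI[OF const_field_smooth[OF A a(1)] o a(2)]] by simp
  also have "\<dots> = J (i p) (cov_deriv_along B A i nab p ?v Y)"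
    unfolding cov_deriv_along_chart[OF B A a i inj nab Y]
    by (simp add: linear_sum[OF J(1)] linear_add[OF J(1)] linear_scale[OF J(1)])
  finally show ?thesis .
qed

text \<open>In fixed charts the local expression consists of derivatives of the coefficients of
  \<open>Y\<close> along \<open>w\<close>, of coordinates of the ambient direction, and of the
  fields \<open>?N\<close>, whose coordinates are the Christoffel symbols of \<open>c\<close>. The
  direction enters both as \<open>w\<close> on the submanifold and as its ambient image, hence the
  two smoothness hypotheses.\<close>

lemma cov_deriv_along_smooth:
  assumes B: "smooth_atlas B" "d \<in> B" and A: "smooth_atlas A" "c \<in> A" and i: "smooth_map B A i"
    and inj: "\<And>p. inj (tan_map B A i p)" and nab: "linear_connection A nab"
    and w: "chart_smooth d (i -` fst c) (\<lambda>p. tan_coord B d p (w p))"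
    and X: "smooth_along B A i UNIV (\<lambda>p. tan_map B A i p (w p))"
    and Y: "smooth_along B A i UNIV Y"
  shows "chart_smooth d (i -` fst c)
    (\<lambda>p. tan_coord A c (i p) (cov_deriv_along B A i nab p (tan_map B A i p (w p)) Y))"
proof -
  let ?f = "\<lambda>b p. tan_coord A c (i p) (Y p) \<bullet> b" and ?X = "\<lambda>p. tan_map B A i p (w p)"
  let ?N = "\<lambda>b b' q. nab q (const_field A c b' q) (const_field A c b)"
  note o = open_chart_domain[OF A]
  note d = smooth_atlasD[OF B]
  have oi: "open (i -` fst c)" by (rule smooth_map_open[OF i o])
  have f: "chart_smooth d (i -` fst c) (?f b)" for b
    using Y A B unfolding smooth_along_iff by (intro chart_smooth_inner) simp
  have Xb: "chart_smooth d (i -` fst c) (\<lambda>p. tan_coord A c (i p) (?X p) \<bullet> b)" for b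
    using X A B unfolding smooth_along_iff by (intro chart_smooth_inner) simp
  have N: "chart_smooth d (i -` fst c) (\<lambda>p. tan_coord A c (i p) (?N b b' (i p)))" for b b'
  proof -
    have "smooth_field A (fst c) (?N b b')"
      using nab o const_field_smooth[OF A] unfolding linear_connection_def by blast
    from chart_smooth_pullback[OF B A i o smooth_fieldD[OF this A(2)]] show ?thesis by simp
  qed
  have "chart_smooth d (i -` fst c) (\<lambda>p. \<Sum>b\<in>Basis. chart_deriv d p (?f b) (tan_coord B d p (w p)) *\<^sub>R b +
      ?f b p *\<^sub>R (\<Sum>b'\<in>Basis. (tan_coord A c (i p) (?X p) \<bullet> b') *\<^sub>R tan_coord A c (i p) (?N b b' (i p))))"
    by (intro chart_smooth_sum chart_smooth_add chart_smooth_scaleR chart_smooth_const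
        chart_smooth_deriv[OF d oi] f w Xb N)
  then show ?thesis
  proof (rule chart_smooth_transform[OF _ d oi])
    fix p assume p: "p \<in> fst d" "p \<in> i -` fst c"
    then have ip: "i p \<in> fst c" by simp
    note T = linear_tan_coord[OF A ip]
    have D: "dir_deriv B p (w p) (?f b) = chart_deriv d p (?f b) (tan_coord B d p (w p))" for b
      by (rule dir_deriv_chart[OF B p(1) section_coord_has_deriv[OF Y B(2) A(2) p(1) ip]])
    have "nab (i p) (?X p) (const_field A c b) =
        (\<Sum>b'\<in>Basis. (tan_coord A c (i p) (?X p) \<bullet> b') *\<^sub>R ?N b b' (i p))" for b
    proof -
      have "linear (\<lambda>v. nab (i p) v (const_field A c b))"
        by (rule connection_linear[OF nab smooth_field_nearI[OF const_field_smooth[OF A] o ip]])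
      note lin = linear_sum[OF this] linear_scale[OF this]
      have "nab (i p) (?X p) (const_field A c b) =
        nab (i p) (\<Sum>b'\<in>Basis. (tan_coord A c (i p) (?X p) \<bullet> b') *\<^sub>R const_field A c b' (i p)) (const_field A c b)"
        using section_expand[OF A ip, of "?X p"] by simp
      then show ?thesis by (simp only: lin)
    qed
    then show "(\<Sum>b\<in>Basis. chart_deriv d p (?f b) (tan_coord B d p (w p)) *\<^sub>R b + ?f b p *\<^sub>R
        (\<Sum>b'\<in>Basis. (tan_coord A c (i p) (?X p) \<bullet> b') *\<^sub>R tan_coord A c (i p) (?N b b' (i p)))) =
      tan_coord A c (i p) (cov_deriv_along B A i nab p (?X p) Y)"
      unfolding cov_deriv_along_chart[OF B(1) A ip i inj nab Y] D
      by (simp add: linear_sum[OF T] linear_add[OF T] linear_scale[OF T] tan_coord_const_field[OF A ip])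
  qed
qed

section \<open>Lightlike submanifolds\<close>

lemma nondegenerate_complement:
  fixes W :: "'e::euclidean_space set"
  assumes b: "bilinear b" and W: "subspace W" "nondegenerate_on W b"
  obtains w where "w \<in> W" "\<And>x. x \<in> W \<Longrightarrow> b (u - w) x = 0"
proof -
  obtain O' where O': "O' \<subseteq> W" "pairwise orthogonal O'" "\<And>x. x \<in> O' \<Longrightarrow> norm x = 1"
    "independent O'" "span O' = W"
    by (metis orthonormal_basis_subspace[OF W(1)])
  have fin: "finite O'" using O'(4) by (rule independent_imp_finite)
  have lin1: "linear (\<lambda>y. b y x)" and lin2: "linear (b x)" for x
    using b unfolding bilinear_def by auto
  \<comment> \<open>\<open>\<Phi> y\<close> encodes the functional \<open>b y\<close> on
    \<open>W\<close> as a vector of \<open>W\<close>. Nondegeneracy makes it injective on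
    \<open>W\<close>, hence onto \<open>W\<close> by dimension, and a preimage in \<open>W\<close>
    of \<open>\<Phi> u\<close> is the wanted projection of \<open>u\<close>.\<close>
  define \<Phi> where "\<Phi> y = (\<Sum>e\<in>O'. b y e *\<^sub>R e)" for y
  have lin: "linear \<Phi>"
    unfolding \<Phi>_def
    by (rule linearI) (simp_all add: linear_add[OF lin1] linear_scale[OF lin1] scaleR_add_left
        sum.distrib scaleR_sum_right)
  have zero: "b y x = 0" if "\<Phi> y = 0" "x \<in> W" for x y
  proof -
    have 0: "b y e = 0" if "e \<in> O'" for e
      using independentD[OF O'(4) fin order_refl _ that, of "b y"] \<open>\<Phi> y = 0\<close> by (simp add: \<Phi>_def)
    have "x \<in> span O'" using \<open>x \<in> W\<close> O'(5) by simp
    then show ?thesis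
    proof (induction rule: span_induct)
      show "subspace {x. b y x = 0}" using linear_subspace_kernel[OF lin2, of y] by simp
    qed (rule 0)
  qed
  have "inj_on \<Phi> W"
  proof (rule inj_onI)
    fix x y assume xy: "x \<in> W" "y \<in> W" "\<Phi> x = \<Phi> y"
    then have "\<Phi> (x - y) = 0" by (simp add: linear_diff[OF lin])
    moreover have "x - y \<in> W" using xy W(1) by (simp add: subspace_diff)
    ultimately have "x - y = 0" using W(2) zero[of "x - y"] unfolding nondegenerate_on_def by blast
    then show "x = y" by simp
  qed
  then have "inj_on \<Phi> (span W)" by (simp only: iffD2[OF span_eq_iff W(1)])
  then have "dim (\<Phi> ` W) = dim W" by (rule dim_image_eq[OF lin])
  moreover have range: "\<Phi> y \<in> W" for y
    unfolding \<Phi>_def using O'(1) by (intro subspace_sum[OF W(1)] subspace_scale[OF W(1)]) auto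
  ultimately have "\<Phi> ` W = W"
    using W(1) linear_subspace_image[OF lin W(1)] by (intro subspace_dim_equal) auto
  with range[of u] obtain w where w: "w \<in> W" "\<Phi> u = \<Phi> w" by auto
  then have "\<Phi> (u - w) = 0" by (simp add: linear_diff[OF lin])
  with zero w(1) that show ?thesis by blast
qed

lemma bundle_sumI: "u \<in> E p \<Longrightarrow> v \<in> F p \<Longrightarrow> u + v \<in> bundle_sum E F p"
  unfolding bundle_sum_def by blast

lemma bundle_sumE:
  assumes "x \<in> bundle_sum E F p"
  obtains u v where "u \<in> E p" "v \<in> F p" "x = u + v"
  using assms unfolding bundle_sum_def by blast

lemma subspace_bundle_sum: "subspace (E p) \<Longrightarrow> subspace (F p) \<Longrightarrow> subspace (bundle_sum E F p)"
  unfolding bundle_sum_def by (rule subspace_sums)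

lemma bundle_sum_left: "subspace (F p) \<Longrightarrow> u \<in> E p \<Longrightarrow> u \<in> bundle_sum E F p"
  using bundle_sumI[of u E p 0 F] subspace_0[of "F p"] by simp

lemma bundle_sum_right: "subspace (E p) \<Longrightarrow> v \<in> F p \<Longrightarrow> v \<in> bundle_sum E F p"
  using bundle_sumI[of 0 E p v F] subspace_0[of "E p"] by simp

lemma direct_unique:
  fixes E F :: "'e::real_vector set"
  assumes "subspace E" "subspace F" "E \<inter> F = {0}"
    and "u \<in> E" "u' \<in> E" "v \<in> F" "v' \<in> F" "u + v = u' + v'"
  shows "u = u'" "v = v'"
proof -
  have "u - u' = v' - v" using assms(8) by (simp add: algebra_simps)
  moreover have "u - u' \<in> E" "v' - v \<in> F" using assms by (simp_all add: subspace_diff)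
  ultimately have "u - u' \<in> E \<inter> F" by simp
  with assms(3) show "u = u'" by simp
  with assms(8) show "v = v'" by simp
qed

lemma component_eq:
  assumes "subspace (E p)" "subspace (F p)" "E p \<inter> F p = {0}" "a \<in> E p" "b \<in> F p"
  shows "component E F p (a + b) = a"
  unfolding component_def
proof (rule the_equality)
  show "a \<in> E p \<and> (\<exists>b'\<in>F p. a + b = a + b')" using assms by blast
  fix a' assume "a' \<in> E p \<and> (\<exists>b'\<in>F p. a + b = a' + b')"
  then obtain b' where "a' \<in> E p" "b' \<in> F p" "a + b = a' + b'" by blast
  from direct_unique(1)[OF assms(1-4) this(1) assms(5) this(2,3)] show "a' = a" by simp
qed

section \<open>Tangent and transversal bundle of a lightlike submanifold\<close>

lemma lightlike_submanifoldD:
  assumes "lightlike_submanifold B A g i r ST STp ltr"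
  shows "smooth_atlas B" "smooth_map B A i" "inj (tan_map B A i p)"
    and "subbundle B A i ST" "nondegenerate_on (ST p) (g (i p))"
    and "orth_decomp g i (tangent_bundle B A i) ST (rad_bundle B A g i)"
    and "subbundle B A i STp" "nondegenerate_on (STp p) (g (i p))"
    and "orth_decomp g i (orth_bundle g i (tangent_bundle B A i)) STp (rad_bundle B A g i)"
    and "direct_decomp (orth_bundle g i (bundle_sum ST STp)) (rad_bundle B A g i) ltr"
    and "\<exists>U xi N. open U \<and> p \<in> U \<and>
        (\<forall>j<r. smooth_along B A i U (xi j) \<and> smooth_along B A i U (N j)) \<and>
        (\<forall>q\<in>U. rad_bundle B A g i q = span ((\<lambda>j. xi j q) ` {..<r}) \<and>
           ltr q = span ((\<lambda>j. N j q) ` {..<r}) \<and>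
           (\<forall>j<r. \<forall>k<r. g (i q) (xi j q) (N k q) = (if j = k then 1 else 0) \<and>
              g (i q) (N j q) (N k q) = 0))"
  using assms unfolding lightlike_submanifold_def immersed_submanifold_def Let_def by simp_all

lemma subbundle_subspace: "subbundle B A i E \<Longrightarrow> subspace (E p)"
  unfolding subbundle_def by blast

lemma subspace_tangent_bundle:
  assumes "smooth_atlas B" "smooth_atlas A" "smooth_map B A i"
  shows "subspace (tangent_bundle B A i p)"
  unfolding tangent_bundle_def
  using linear_subspace_image[OF linear_tan_map[OF assms] subspace_UNIV] .

text \<open>Pairing with \<open>xi k\<close> isolates the coefficient of \<open>N k\<close>, so the
  duality relations force the \<open>N j\<close> to be distinct and independent.\<close>

lemma lightlike_ltr_dim:
  assumes L: "lightlike_submanifold B A g i r ST STp ltr" and g: "bilinear (g (i p))"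
  shows "subspace (ltr p)" "dim (ltr p) = r"
proof -
  from lightlike_submanifoldD(11)[OF L, of p] obtain xi N where
    N: "ltr p = span ((\<lambda>j. N j p) ` {..<r})"
    and dual: "\<And>j k. j < r \<Longrightarrow> k < r \<Longrightarrow> g (i p) (xi j p) (N k p) = (if j = k then 1 else 0)"
    by (elim exE conjE) blast
  show "subspace (ltr p)" unfolding N by (rule subspace_span)
  have lin: "linear (g (i p) x)" for x using g unfolding bilinear_def by auto
  have inj: "inj_on (\<lambda>j. N j p) {..<r}"
  proof (rule inj_onI)
    fix j k assume "j \<in> {..<r}" "k \<in> {..<r}" "N j p = N k p"
    then show "j = k" using dual[of j j] dual[of j k] by (simp split: if_splits)
  qed
  have "independent ((\<lambda>j. N j p) ` {..<r})"
  proof (rule independent_if_scalars_zero)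
    fix f x assume s: "(\<Sum>x\<in>(\<lambda>j. N j p) ` {..<r}. f x *\<^sub>R x) = 0" and x: "x \<in> (\<lambda>j. N j p) ` {..<r}"
    then obtain k where k: "k < r" "x = N k p" by auto
    have "0 = g (i p) (xi k p) (\<Sum>j<r. f (N j p) *\<^sub>R N j p)"
      using s by (simp add: sum.reindex[OF inj] linear_0[OF lin])
    also have "\<dots> = (\<Sum>j<r. f (N j p) * g (i p) (xi k p) (N j p))"
      by (simp add: linear_sum[OF lin] linear_scale[OF lin])
    also have "\<dots> = (\<Sum>j<r. if j = k then f (N j p) else 0)"
      using k by (intro sum.cong) (auto simp: dual)
    also have "\<dots> = f x" using k by simp
    finally show "f x = 0" by simp
  qed simp
  then show "dim (ltr p) = r"
    unfolding N dim_span using card_image[OF inj] by (simp add: dim_eq_card_independent)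
qed

text \<open>The sum of \<open>ST\<close> and \<open>STp\<close> is nondegenerate, so the ambient
  space is this sum plus its orthogonal complement \<open>Rad + ltr\<close>; regrouping the four
  summands gives the two bundles. A common vector \<open>s + \<rho> = l + t\<close> yields
  \<open>s - t = l - \<rho>\<close>, an element of the nondegenerate sum that is orthogonal to all
  of it, hence zero.\<close>

lemma lightlike_decomposition:
  assumes A: "smooth_atlas A" and L: "lightlike_submanifold B A g i r ST STp ltr"
    and g: "bilinear (g (i p))" and sym: "\<And>v w. g (i p) v w = g (i p) w v"
  defines "TM \<equiv> tangent_bundle B A i" and "tr \<equiv> tr_bundle STp ltr"
  shows "subspace (tr p)" "TM p \<inter> tr p = {0}" "ltr p \<inter> STp p = {0}"
    and "\<exists>a\<in>TM p. \<exists>b\<in>tr p. u = a + b"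
proof -
  note D = lightlike_submanifoldD[OF L]
  let ?g = "g (i p)" and ?Rad = "rad_bundle B A g i p"
  have sST: "subspace (ST p)" and sSTp: "subspace (STp p)"
    using D(4,7) by (auto intro: subbundle_subspace)
  have sTM: "subspace (TM p)" unfolding TM_def by (rule subspace_tangent_bundle[OF D(1) A D(2)])
  note sltr = lightlike_ltr_dim(1)[OF L g]
  show str: "subspace (tr p)" unfolding tr_def by (rule subspace_bundle_sum[where E = ltr and F = STp, OF sltr sSTp])
  have lin1: "linear (\<lambda>y. ?g y x)" and lin2: "linear (?g x)" for x
    using g unfolding bilinear_def by auto
  have TM: "TM p = bundle_sum ST (rad_bundle B A g i) p" and STRad: "ST p \<inter> ?Rad = {0}"
    using D(6) unfolding TM_def orth_decomp_def direct_decomp_def is_direct_def by auto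
  have TMp: "orth_bundle g i TM p = bundle_sum STp (rad_bundle B A g i) p"
    using D(9) unfolding TM_def orth_decomp_def direct_decomp_def by auto
  have W: "orth_bundle g i (bundle_sum ST STp) p = bundle_sum (rad_bundle B A g i) ltr p"
    and RadL: "?Rad \<inter> ltr p = {0}"
    using D(10) unfolding direct_decomp_def is_direct_def by auto
  have Rad: "?Rad = TM p \<inter> orth_bundle g i TM p" unfolding rad_bundle_def TM_def by simp
  have sRad: "subspace ?Rad"
    unfolding Rad using sTM
    by (intro subspace_inter) (auto simp: orth_bundle_def subspace_def linear_add[OF lin1]
        linear_scale[OF lin1] linear_0[OF lin1])
  have STTM: "x \<in> TM p" if "x \<in> ST p" for x unfolding TM using sRad that by (rule bundle_sum_left)
  have STpTMp: "x \<in> orth_bundle g i TM p" if "x \<in> STp p" for x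
    unfolding TMp using sRad that by (rule bundle_sum_left)
  have orth: "?g x y = 0" "?g y x = 0" if "x \<in> STp p" "y \<in> ST p" for x y
    using STpTMp[OF that(1)] STTM[OF that(2)] sym unfolding orth_bundle_def by auto
  \<comment> \<open>A common vector is tangent and normal, hence radical, and the screen meets the
    radical trivially.\<close>
  have ST0: "ST p \<inter> STp p = {0}"
  proof -
    have "x \<in> ST p \<inter> ?Rad" if "x \<in> ST p" "x \<in> STp p" for x
      unfolding Rad using that STTM STpTMp by blast
    then show ?thesis using STRad sST sSTp subspace_0 by blast
  qed
  \<comment> \<open>The summands are orthogonal, so a vector in the kernel splits into a kernel
    vector of each.\<close>
  have nd: "nondegenerate_on (bundle_sum ST STp p) ?g"
    unfolding nondegenerate_on_def
  proof (intro ballI impI)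
    fix v assume "v \<in> bundle_sum ST STp p" and v0: "\<forall>w\<in>bundle_sum ST STp p. ?g v w = 0"
    then obtain s t where v: "s \<in> ST p" "t \<in> STp p" "v = s + t" by (blast elim: bundle_sumE)
    have "?g s w = 0" if "w \<in> ST p" for w
      using v0[rule_format, OF bundle_sum_left[where E = ST and F = STp, OF sSTp that]] orth(1)[OF v(2) that] v(3)
      by (simp add: linear_add[OF lin1])
    then have "s = 0" using D(5)[of p] v(1) unfolding nondegenerate_on_def by blast
    have "?g t w = 0" if "w \<in> STp p" for w
      using v0[rule_format, OF bundle_sum_right[where E = ST and F = STp, OF sST that]] orth(2)[OF that v(1)] v(3)
      by (simp add: linear_add[OF lin1])
    then have "t = 0" using D(8)[of p] v(2) unfolding nondegenerate_on_def by blast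
    with \<open>s = 0\<close> v(3) show "v = 0" by simp
  qed
  have sW: "subspace (bundle_sum ST STp p)" by (rule subspace_bundle_sum[where E = ST and F = STp, OF sST sSTp])
  have sub: "x \<in> orth_bundle g i (bundle_sum ST STp) p" if "x \<in> ?Rad \<or> x \<in> ltr p" for x
    unfolding W using that bundle_sum_left[where F = ltr, OF sltr] bundle_sum_right[where E = "rad_bundle B A g i", OF sRad] by blast
  show "ltr p \<inter> STp p = {0}"
  proof -
    have "x = 0" if x: "x \<in> ltr p" "x \<in> STp p" for x
    proof -
      have "?g x w = 0" if "w \<in> STp p" for w
        using sub[of x] x(1) bundle_sum_right[where E = ST and F = STp, OF sST that] unfolding orth_bundle_def by blast
      then show ?thesis using D(8)[of p] x(2) unfolding nondegenerate_on_def by blast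
    qed
    then show ?thesis using subspace_0[OF sltr] subspace_0[OF sSTp] by blast
  qed
  show "TM p \<inter> tr p = {0}"
  proof -
    have "x = 0" if "x \<in> TM p" "x \<in> tr p" for x
    proof -
      from that(1) obtain s \<rho> where s: "s \<in> ST p" "\<rho> \<in> ?Rad" "x = s + \<rho>"
        unfolding TM by (rule bundle_sumE)
      from that(2) obtain l t where t: "l \<in> ltr p" "t \<in> STp p" "x = l + t"
        unfolding tr_def by (rule bundle_sumE)
      have eq: "s + (- t) = l + (- \<rho>)" using s(3) t(3) by (simp add: algebra_simps)
      have "s + (- t) \<in> bundle_sum ST STp p"
        by (rule bundle_sumI[of s ST p "- t" STp, OF s(1) subspace_neg[OF sSTp t(2)]])
      moreover have "?g (s + (- t)) w = 0" if "w \<in> bundle_sum ST STp p" for w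
        unfolding eq using sub[of l] sub[of "- \<rho>"] t(1) subspace_neg[OF sRad s(2)] that
        by (simp add: orth_bundle_def linear_diff[OF lin1] linear_neg[OF lin1])
      ultimately have "s + (- t) = 0" using nd unfolding nondegenerate_on_def by blast
      then have "s = t" "l = \<rho>" using eq by simp_all
      then have "s = 0" "l = 0" using ST0 RadL s t by auto
      then show "x = 0" using s(3) \<open>l = \<rho>\<close> by simp
    qed
    then show ?thesis using subspace_0[OF sTM] subspace_0[OF str] by blast
  qed
  from nondegenerate_complement[OF g sW nd, of u]
  obtain w where w: "w \<in> bundle_sum ST STp p" "\<And>x. x \<in> bundle_sum ST STp p \<Longrightarrow> ?g (u - w) x = 0"
    by blast
  from w(1) obtain s t where st: "s \<in> ST p" "t \<in> STp p" "w = s + t" by (rule bundle_sumE)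
  have "u - w \<in> bundle_sum (rad_bundle B A g i) ltr p"
    using w(2) unfolding W[symmetric] orth_bundle_def by blast
  then obtain \<rho> l where l: "\<rho> \<in> ?Rad" "l \<in> ltr p" "u - w = \<rho> + l" by (rule bundle_sumE)
  have "s + \<rho> \<in> TM p" "l + t \<in> tr p"
    unfolding TM tr_def using st l by (auto intro: bundle_sumI)
  moreover have "u = (s + \<rho>) + (l + t)" using st(3) l(3) by (simp add: algebra_simps)
  ultimately show "\<exists>a\<in>TM p. \<exists>b\<in>tr p. u = a + b" by blast
qed

section \<open>Smoothness of tangential parts\<close>

lemma span_image_coefficients:
  assumes "finite I" "x \<in> span (f ` I)"
  obtains c where "x = (\<Sum>j\<in>I. c j *\<^sub>R f j)"
proof -
  have "subspace {x. \<exists>c. x = (\<Sum>j\<in>I. c j *\<^sub>R f j)}" (is "subspace ?S")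
    unfolding subspace_def
  proof (intro conjI ballI allI)
    show "0 \<in> ?S" by (auto intro!: exI[of _ "\<lambda>j. 0"])
    fix x y assume "x \<in> ?S" "y \<in> ?S"
    then obtain c c' where "x = (\<Sum>j\<in>I. c j *\<^sub>R f j)" "y = (\<Sum>j\<in>I. c' j *\<^sub>R f j)" by blast
    then show "x + y \<in> ?S"
      by (auto intro!: exI[of _ "\<lambda>j. c j + c' j"] simp: scaleR_add_left sum.distrib)
  next
    fix a x assume "x \<in> ?S"
    then obtain c where "x = (\<Sum>j\<in>I. c j *\<^sub>R f j)" by blast
    then show "a *\<^sub>R x \<in> ?S"
      by (auto intro!: exI[of _ "\<lambda>j. a * c j"] simp: scaleR_sum_right)
  qed
  moreover have "f ` I \<subseteq> ?S"
  proof
    fix y assume "y \<in> f ` I"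
    then obtain k where "k \<in> I" "y = f k" by blast
    then have "y = (\<Sum>j\<in>I. (if j = k then 1 else 0) *\<^sub>R f j)"
      using assms(1) by (simp add: if_distrib[of "\<lambda>c. c *\<^sub>R _"] cong: if_cong)
    then show "y \<in> ?S" by (intro CollectI exI[of _ "\<lambda>j. if j = k then 1 else 0"])
  qed
  ultimately have "span (f ` I) \<subseteq> ?S" by (rule span_minimal[rotated])
  with assms(2) that show ?thesis by blast
qed

text \<open>The pushed-forward coordinate frame of \<open>d\<close> together with frames of
  \<open>ltr\<close> and \<open>STp\<close> is a frame of the whole ambient space, and the
  coordinates of \<open>w\<close> are the first coefficients of \<open>V\<close> in it. Frames of
  the two bundles are available near a point only, hence the reduction to neighbourhoods of
  \<open>p0\<close>.\<close>

lemma tangent_component_smooth: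
  fixes A :: "('a::{t2_space, second_countable_topology}, 'e::euclidean_space) chart set"
    and B :: "('b::{t2_space, second_countable_topology}, 'f::euclidean_space) chart set"
  assumes A: "smooth_atlas A" "c \<in> A" and L: "lightlike_submanifold B A g i r ST STp ltr" and d: "d \<in> B"
    and g: "\<And>p. bilinear (g p)" "\<And>p v w. g p v w = g p w v"
    and V: "chart_smooth d (i -` fst c) (\<lambda>p. tan_coord A c (i p) (V p))"
    and split: "\<And>p. V p = tan_map B A i p (w p) + R p" "\<And>p. R p \<in> tr_bundle STp ltr p"
  shows "chart_smooth d (i -` fst c) (\<lambda>p. tan_coord B d p (w p))"
proof (rule chart_smooth_local)
  note LD = lightlike_submanifoldD[OF L]
  note B = LD(1) and i = LD(2)
  show dc: "is_chart d" by (rule smooth_atlasD[OF B d])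
  show oi: "open (i -` fst c)" by (rule smooth_map_open[OF i open_chart_domain[OF A]])
  fix p0
  from LD(11)[of p0] obtain U1 N where U1: "open U1" "p0 \<in> U1"
    and N: "\<And>j. j < r \<Longrightarrow> smooth_along B A i U1 (N j)"
    and ltr: "\<And>q. q \<in> U1 \<Longrightarrow> ltr q = span ((\<lambda>j. N j q) ` {..<r})"
    by (elim exE conjE) blast
  from LD(7) obtain k where dimS: "\<And>p. dim (STp p) = k"
    and "\<exists>U F. open U \<and> p0 \<in> U \<and> (\<forall>j<k. smooth_along B A i U (F j)) \<and>
        (\<forall>q\<in>U. STp q = span ((\<lambda>j. F j q) ` {..<k}))"
    unfolding subbundle_def by blast
  then obtain U2 F where U2: "open U2" "p0 \<in> U2"
    and F: "\<And>j. j < k \<Longrightarrow> smooth_along B A i U2 (F j)"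
    and STp: "\<And>q. q \<in> U2 \<Longrightarrow> STp q = span ((\<lambda>j. F j q) ` {..<k})"
    by (elim exE conjE) blast
  define U where "U = U1 \<inter> U2"
  define W where "W = i -` fst c \<inter> U"
  have oW: "open W" unfolding W_def U_def using oi U1 U2 by blast
  \<comment> \<open>The indices of a local frame made of the coordinate frame of the submanifold and of frames of
    \<open>ltr\<close> and \<open>STp\<close>, all written in the coordinates of \<open>c\<close>.\<close>
  define I :: "('f + nat + nat) set" where "I = Basis <+> ({..<r} <+> {..<k})"
  define G where "G j p = (case j of Inl b \<Rightarrow> chart_deriv d p (\<lambda>q. snd c (i q)) b
    | Inr (Inl j) \<Rightarrow> tan_coord A c (i p) (N j p) | Inr (Inr j) \<Rightarrow> tan_coord A c (i p) (F j p))" for j p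
  have sumI: "(\<Sum>j\<in>I. h j) = (\<Sum>b\<in>Basis. h (Inl b)) + ((\<Sum>j<r. h (Inr (Inl j))) + (\<Sum>j<k. h (Inr (Inr j))))"
    for h :: "_ \<Rightarrow> 'e"
    unfolding I_def by (simp add: sum.Plus)
  have finI: "finite I" unfolding I_def by simp
  \<comment> \<open>The count is made at \<open>p0\<close>: the tangent space has the dimension of
    the submanifold by injectivity of the differential, the transversal space has dimension
    \<open>r + k\<close>, and together they fill the ambient space directly.\<close>
  have cardI: "card I = DIM('e)"
  proof -
    note dec = lightlike_decomposition[where p = p0 and B = B, OF A(1) L g]
    have sSTp: "subspace (STp p0)" using LD(7) by (rule subbundle_subspace)
    note ltr = lightlike_ltr_dim[where p = p0 and B = B, OF L g(1)]
    have "dim (tr_bundle STp ltr p0) + dim (ltr p0 \<inter> STp p0) = dim (ltr p0) + dim (STp p0)"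
      unfolding bundle_sum_def by (rule dim_sums_Int[OF ltr(1) sSTp])
    then have tr: "dim (tr_bundle STp ltr p0) = r + k" using ltr(2) dimS dec(3) by simp
    have TM: "dim (tangent_bundle B A i p0) = DIM('f)"
      unfolding tangent_bundle_def
      using dim_image_eq[OF linear_tan_map[OF B A(1) i] inj_on_subset[OF LD(3) subset_UNIV], where S = UNIV]
      by simp
    have "bundle_sum (tangent_bundle B A i) (tr_bundle STp ltr) p0 = UNIV"
      using dec(4) unfolding bundle_sum_def[of "tangent_bundle B A i"] by blast
    moreover have "dim (bundle_sum (tangent_bundle B A i) (tr_bundle STp ltr) p0) +
        dim (tangent_bundle B A i p0 \<inter> tr_bundle STp ltr p0) =
        dim (tangent_bundle B A i p0) + dim (tr_bundle STp ltr p0)"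
      unfolding bundle_sum_def[of "tangent_bundle B A i"]
      by (rule dim_sums_Int[OF subspace_tangent_bundle[OF B A(1) i] dec(1)])
    ultimately have "DIM('e) = DIM('f) + (r + k)" using dec(2) tr TM by simp
    then show ?thesis unfolding I_def by (simp add: card_Plus)
  qed
  have GI: "chart_smooth d W (G j)" if j: "j \<in> I" for j
  proof -
    consider b where "j = Inl b" | n where "j = Inr (Inl n)" "n < r" | n where "j = Inr (Inr n)" "n < k"
      using j unfolding I_def by (auto elim!: PlusE)
    then show ?thesis
    proof cases
      case 1
      have "chart_smooth d W (\<lambda>p. chart_deriv d p (\<lambda>q. snd c (i q)) b)"
        using smooth_mapD[OF i d A(2)] unfolding W_def
        by (intro chart_smooth_deriv[OF dc oW[unfolded W_def]] chart_smooth_const)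
          (erule chart_smooth_subset, blast)
      then show ?thesis by (simp add: G_def[abs_def] 1)
    next
      case 2
      have "chart_smooth d (U1 \<inter> i -` fst c) (\<lambda>p. tan_coord A c (i p) (N n p))"
        using N[OF 2(2)] A(2) d unfolding smooth_along_iff by blast
      then have "chart_smooth d W (\<lambda>p. tan_coord A c (i p) (N n p))"
        by (rule chart_smooth_subset) (auto simp: W_def U_def)
      then show ?thesis by (simp add: G_def[abs_def] 2)
    next
      case 3
      have "chart_smooth d (U2 \<inter> i -` fst c) (\<lambda>p. tan_coord A c (i p) (F n p))"
        using F[OF 3(2)] A(2) d unfolding smooth_along_iff by blast
      then have "chart_smooth d W (\<lambda>p. tan_coord A c (i p) (F n p))"
        by (rule chart_smooth_subset) (auto simp: W_def U_def)
      then show ?thesis by (simp add: G_def[abs_def] 3)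
    qed
  qed
  \<comment> \<open>The expansion is used twice: for the splitting of \<open>V\<close>, and for an
    arbitrary ambient vector, to see that the frame spans.\<close>
  have coeff: "\<exists>a. (\<forall>b\<in>Basis. a (Inl b) = tan_coord B d p v \<bullet> b) \<and>
      tan_coord A c (i p) (tan_map B A i p v + y) = (\<Sum>j\<in>I. a j *\<^sub>R G j p)"
    if p: "p \<in> fst d" "p \<in> W" and y: "y \<in> tr_bundle STp ltr p" for p v y
  proof -
    have ip: "i p \<in> fst c" and pU: "p \<in> U1" "p \<in> U2" using p(2) by (auto simp: W_def U_def)
    note T = linear_tan_coord[OF A ip]
    from y obtain l s where ls: "l \<in> ltr p" "s \<in> STp p" "y = l + s" by (rule bundle_sumE)
    obtain x where x: "l = (\<Sum>j<r. x j *\<^sub>R N j p)"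
      using span_image_coefficients[of "{..<r}" l "\<lambda>j. N j p"] ls(1) ltr[OF pU(1)] by auto
    obtain z where z: "s = (\<Sum>j<k. z j *\<^sub>R F j p)"
      using span_image_coefficients[of "{..<k}" s "\<lambda>j. F j p"] ls(2) STp[OF pU(2)] by auto
    let ?v = "tan_coord B d p v"
    have "chart_has_deriv d p (\<lambda>q. snd c (i q)) (chart_deriv d p (\<lambda>q. snd c (i q)))"
      using ip by (intro chart_smooth_has_deriv[OF smooth_mapD[OF i d A(2)] p(1)]) simp
    from linear_expand[OF chart_has_deriv_linear[OF this], of ?v]
    have 1: "tan_coord A c (i p) (tan_map B A i p v) =
        (\<Sum>b\<in>Basis. (?v \<bullet> b) *\<^sub>R chart_deriv d p (\<lambda>q. snd c (i q)) b)"
      by (simp only: tan_coord_tan_map[OF B d p(1) A ip i])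
    show ?thesis
    proof (intro exI[of _ "case_sum (\<lambda>b. ?v \<bullet> b) (case_sum x z)"] conjI)
      show "tan_coord A c (i p) (tan_map B A i p v + y) =
          (\<Sum>j\<in>I. case_sum (\<lambda>b. ?v \<bullet> b) (case_sum x z) j *\<^sub>R G j p)"
        unfolding sumI ls(3) x z linear_add[OF T] 1
        by (simp add: G_def linear_sum[OF T] linear_scale[OF T])
    qed simp
  qed
  have "\<exists>a. (\<forall>b\<in>Basis. a (Inl b) = tan_coord B d p (w p) \<bullet> b) \<and>
      tan_coord A c (i p) (V p) = (\<Sum>j\<in>I. a j *\<^sub>R G j p)" if "p \<in> fst d" "p \<in> W" for p
    unfolding split(1) by (rule coeff[OF that split(2)])
  \<comment> \<open>These coefficients are chosen point by point, without regularity; being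
    determined by the frame, they turn out to be smooth.\<close>
  then obtain a where a: "\<And>p b. p \<in> fst d \<Longrightarrow> p \<in> W \<Longrightarrow> b \<in> Basis \<Longrightarrow>
      a p (Inl b) = tan_coord B d p (w p) \<bullet> b"
    "\<And>p. p \<in> fst d \<Longrightarrow> p \<in> W \<Longrightarrow> tan_coord A c (i p) (V p) = (\<Sum>j\<in>I. a p j *\<^sub>R G j p)"
    by metis
  have span: "span ((\<lambda>j. G j p) ` I) = UNIV" if p: "p \<in> fst d" "p \<in> W" for p
  proof -
    have ip: "i p \<in> fst c" using p(2) by (simp add: W_def)
    have "u \<in> span ((\<lambda>j. G j p) ` I)" for u
    proof -
      from lightlike_decomposition(4)[where p = p and B = B, OF A(1) L g, of "const_field A c u (i p)"]
      obtain v y where vy: "const_field A c u (i p) = tan_map B A i p v + y" "y \<in> tr_bundle STp ltr p"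
        unfolding tangent_bundle_def by auto
      obtain a where "tan_coord A c (i p) (tan_map B A i p v + y) = (\<Sum>j\<in>I. a j *\<^sub>R G j p)"
        using coeff[OF p vy(2)] by blast
      then have "u = (\<Sum>j\<in>I. a j *\<^sub>R G j p)"
        unfolding vy(1)[symmetric] tan_coord_const_field[OF A ip] .
      then show ?thesis by (simp only:) (intro span_sum span_scale span_base imageI)
    qed
    then show ?thesis by blast
  qed
  have Vs: "chart_smooth d W (\<lambda>p. tan_coord A c (i p) (V p))"
    by (rule chart_smooth_subset[OF V]) (simp add: W_def)
  have "chart_smooth d W (\<lambda>p. a p j)" if "j \<in> I" for j
    by (rule chart_smooth_frame_coefficients[OF dc oW finI cardI that GI span Vs, of "\<lambda>j p. a p j"])
      (simp_all add: a(2))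
  then have "chart_smooth d W (\<lambda>p. \<Sum>b\<in>Basis. a p (Inl b) *\<^sub>R b)"
    by (intro chart_smooth_sum chart_smooth_scaleR chart_smooth_const) (auto simp: I_def)
  then have "chart_smooth d W (\<lambda>p. tan_coord B d p (w p))"
    by (rule chart_smooth_transform[OF _ dc oW]) (simp add: a(1) euclidean_representation)
  then show "\<exists>U. open U \<and> p0 \<in> U \<and> chart_smooth d (i -` fst c \<inter> U) (\<lambda>p. tan_coord B d p (w p))"
    using U1 U2 unfolding W_def U_def by blast
qed

section \<open>STCR lightlike submanifolds\<close>

lemma tangent_sectionE:
  assumes "X \<in> sections B A i (tangent_bundle B A i)"
  obtains w where "\<And>p. X p = tan_map B A i p (w p)"
proof -
  have "\<exists>w. X p = tan_map B A i p w" for p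
    using assms unfolding sections_def tangent_bundle_def by blast
  then show ?thesis using that by metis
qed

text \<open>Tangential parts are extracted twice: from \<open>X\<close> itself, with zero
  transversal part, which recovers a smooth direction \<open>w\<close> on the submanifold, and then
  from the covariant derivative. The differential of the immersion carries the result back to a
  section along it.\<close>

lemma induced_conn_smooth:
  assumes A: "smooth_atlas A" and L: "lightlike_submanifold B A g i r ST STp ltr"
    and g: "\<And>p. bilinear (g p)" "\<And>p v w. g p v w = g p w v" and nab: "linear_connection A nab"
    and X: "X \<in> sections B A i (tangent_bundle B A i)" and Y: "smooth_along B A i UNIV Y"
  shows "smooth_along B A i UNIV (induced_conn B A i nab (tr_bundle STp ltr) X Y)"
  unfolding smooth_along_iff
proof (intro ballI)
  fix d c assume d: "d \<in> B" and c: "c \<in> A"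
  note LD = lightlike_submanifoldD[OF L]
  note B = LD(1) and i = LD(2)
  have sX: "smooth_along B A i UNIV X" using X unfolding sections_def by blast
  from X obtain w where w: "\<And>p. X p = tan_map B A i p (w p)" by (rule tangent_sectionE) blast
  note dec = lightlike_decomposition[where B = B, OF A L g]
  note sTM = subspace_tangent_bundle[OF B A i]
  define V where "V p = cov_deriv_along B A i nab p (X p) Y" for p
  have "\<exists>v y. V p = tan_map B A i p v + y \<and> y \<in> tr_bundle STp ltr p" for p
    using dec(4)[of p "V p"] unfolding tangent_bundle_def by blast
  then obtain v R where R: "\<And>p. V p = tan_map B A i p (v p) + R p" "\<And>p. R p \<in> tr_bundle STp ltr p"
    by metis
  have v: "induced_conn B A i nab (tr_bundle STp ltr) X Y p = tan_map B A i p (v p)" for p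
    unfolding induced_conn_def V_def[symmetric] R(1)
    by (intro component_eq sTM dec(1,2) R(2)) (simp add: tangent_bundle_def)
  have cX: "chart_smooth d (i -` fst c) (\<lambda>p. tan_coord A c (i p) (X p))"
    using sX c d unfolding smooth_along_iff by simp
  have X0: "X p = tan_map B A i p (w p) + 0" "0 \<in> tr_bundle STp ltr p" for p
    using w subspace_0[OF dec(1)] by simp_all
  have "chart_smooth d (i -` fst c) (\<lambda>p. tan_coord B d p (w p))"
    by (rule tangent_component_smooth[OF A c L d g cX X0])
  from cov_deriv_along_smooth[OF B d A c i LD(3) nab this _ Y]
  have "chart_smooth d (i -` fst c) (\<lambda>p. tan_coord A c (i p) (V p))"
    using sX unfolding V_def w[symmetric] .
  then have vs: "chart_smooth d (i -` fst c) (\<lambda>p. tan_coord B d p (v p))"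
    by (rule tangent_component_smooth[OF A c L d g _ R])
  have o: "open (i -` fst c)" by (rule smooth_map_open[OF i open_chart_domain[OF A c]])
  have "chart_smooth d (i -` fst c) (\<lambda>p. chart_deriv d p (\<lambda>q. snd c (i q)) (tan_coord B d p (v p)))"
    by (rule chart_smooth_deriv[OF smooth_atlasD[OF B d] o smooth_mapD[OF i d c] vs])
  then have "chart_smooth d (i -` fst c)
      (\<lambda>p. tan_coord A c (i p) (induced_conn B A i nab (tr_bundle STp ltr) X Y p))"
    by (rule chart_smooth_transform[OF _ smooth_atlasD[OF B d] o])
      (simp add: v tan_coord_tan_map[OF B d _ A c _ i])
  then show "chart_smooth d (UNIV \<inter> i -` fst c)
      (\<lambda>p. tan_coord A c (i p) (induced_conn B A i nab (tr_bundle STp ltr) X Y p))"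
    by simp
qed

section \<open>Pointwise algebra of the STCR splitting\<close>

lemma stcr_lightlike_submanifoldD:
  assumes "stcr_lightlike_submanifold B A J g i r ST STp ltr D0 D1 D2 Dp L1 L2 SS"
  shows "lightlike_submanifold B A g i r ST STp ltr"
    and "subspace (D0 p)" "subspace (D1 p)" "subspace (D2 p)" "subspace (Dp p)"
      "subspace (L1 p)" "subspace (L2 p)" "subspace (SS p)"
    and "D1 p \<inter> D2 p = {0}" "rad_bundle B A g i p = bundle_sum D1 D2 p"
    and "bundle_image J i D1 p \<subseteq> ST p" "bundle_image J i D2 p \<subseteq> STp p"
    and "bundle_image J i D1 p \<inter> Dp p = {0}"
    and "bundle_sum (bundle_image J i D1) Dp p \<inter> D0 p = {0}"
      "ST p = bundle_sum (bundle_sum (bundle_image J i D1) Dp) D0 p"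
    and "bundle_image J i D0 p = D0 p"
    and "bundle_image J i Dp p = bundle_sum L1 SS p" "L1 p \<subseteq> ltr p" "SS p \<subseteq> STp p"
    and "ltr p = bundle_sum L1 L2 p" "bundle_image J i L2 p \<subseteq> STp p"
    and "STp p = bundle_sum (bundle_sum (bundle_image J i D2) (bundle_image J i L2)) SS p"
proof -
  from assms have sub: "\<forall>E\<in>{D0, D1, D2, Dp, L1, L2, SS}. subbundle B A i E"
    and eqs: "rad_bundle B A g i = bundle_sum D1 D2" "ST = bundle_sum (bundle_sum (bundle_image J i D1) Dp) D0"
      "bundle_image J i D0 = D0" "bundle_image J i Dp = bundle_sum L1 SS" "ltr = bundle_sum L1 L2"
      "STp = bundle_sum (bundle_sum (bundle_image J i D2) (bundle_image J i L2)) SS"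
    unfolding stcr_lightlike_submanifold_def Let_def orth_decomp_def direct_decomp_def
    by - (elim conjE, assumption)+
  from sub show "subspace (D0 p)" "subspace (D1 p)" "subspace (D2 p)" "subspace (Dp p)"
      "subspace (L1 p)" "subspace (L2 p)" "subspace (SS p)"
    by (auto intro: subbundle_subspace[where B = B and A = A and i = i])
  show "rad_bundle B A g i p = bundle_sum D1 D2 p"
    "ST p = bundle_sum (bundle_sum (bundle_image J i D1) Dp) D0 p" "bundle_image J i D0 p = D0 p"
    "bundle_image J i Dp p = bundle_sum L1 SS p" "ltr p = bundle_sum L1 L2 p"
    "STp p = bundle_sum (bundle_sum (bundle_image J i D2) (bundle_image J i L2)) SS p"
    by (rule eqs[THEN fun_cong])+
  from assms show "lightlike_submanifold B A g i r ST STp ltr" "D1 p \<inter> D2 p = {0}"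
    "bundle_image J i D1 p \<subseteq> ST p" "bundle_image J i D2 p \<subseteq> STp p"
    "bundle_image J i D1 p \<inter> Dp p = {0}" "bundle_sum (bundle_image J i D1) Dp p \<inter> D0 p = {0}"
    "L1 p \<subseteq> ltr p" "SS p \<subseteq> STp p" "bundle_image J i L2 p \<subseteq> STp p"
    unfolding stcr_lightlike_submanifold_def Let_def orth_decomp_def direct_decomp_def is_direct_def
    by - (elim conjE, (assumption | erule spec))+
qed

text \<open>\<open>D + E\<close> is compared with \<open>ST + Rad\<close>: \<open>D1\<close> and
  \<open>D2\<close> make up the radical part, and \<open>J D1\<close>, \<open>Dp\<close>,
  \<open>D0\<close> the screen part, so directness is inherited from the given decompositions.
  \<open>D\<close> is invariant because \<open>J\<close> preserves \<open>D0\<close> and exchanges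
  \<open>D1\<close> with \<open>J D1\<close> up to sign.\<close>

lemma stcr_decomposition:
  assumes S: "stcr_lightlike_submanifold B A J g i r ST STp ltr D0 D1 D2 Dp L1 L2 SS"
    and A: "smooth_atlas A" and g: "bilinear (g (i p))" "\<And>v w. g (i p) v w = g (i p) w v"
    and J: "linear (J (i p))" "\<And>v. J (i p) (J (i p) v) = - v"
  defines "TM \<equiv> tangent_bundle B A i" and "tr \<equiv> tr_bundle STp ltr"
    and "D \<equiv> stcr_D J i D0 D1" and "E \<equiv> bundle_sum D2 Dp"
  shows "subspace (D p)" "subspace (E p)" "D p \<subseteq> TM p" "E p \<subseteq> TM p" "D p \<inter> E p = {0}"
    and "\<And>x. x \<in> TM p \<Longrightarrow> \<exists>u\<in>D p. \<exists>w\<in>E p. x = u + w"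
    and "\<And>x. x \<in> D p \<Longrightarrow> J (i p) x \<in> D p"
    and "\<And>x. x \<in> E p \<Longrightarrow> J (i p) x \<in> tr p"
    and "\<And>x. x \<in> tr p \<Longrightarrow> \<exists>u\<in>E p. \<exists>w\<in>tr p. J (i p) x = u + w"
proof -
  note SD = stcr_lightlike_submanifoldD(1)[OF S] stcr_lightlike_submanifoldD(2-22)[OF S, of p]
  note L = SD(1)
  note LD = lightlike_submanifoldD[OF L]
  let ?j = "J (i p)" and ?JD1 = "bundle_image J i D1" and ?Rad = "rad_bundle B A g i"
  have sST: "subspace (ST p)" and sSTp: "subspace (STp p)"
    using LD(4,7) by (auto intro: subbundle_subspace)
  have sltr: "subspace (ltr p)" by (rule lightlike_ltr_dim(1)[where B = B and p = p, OF L g(1)])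
  have sRad: "subspace (?Rad p)"
    unfolding SD(10) using SD(3,4) by (rule subspace_bundle_sum)
  have sJ: "subspace (bundle_image J i F p)" if "subspace (F p)" for F
    unfolding bundle_image_def by (rule linear_subspace_image[OF J(1) that])
  then have sJD1: "subspace (?JD1 p)" using SD(3) by blast
  have JI: "?j x \<in> bundle_image J i F p" if "x \<in> F p" for F x
    using that unfolding bundle_image_def by blast
  have TM: "TM p = bundle_sum ST ?Rad p" and STRad: "ST p \<inter> ?Rad p = {0}"
    using LD(6) unfolding TM_def orth_decomp_def direct_decomp_def is_direct_def by auto
  have str: "subspace (tr p)" unfolding tr_def using sltr sSTp by (rule subspace_bundle_sum)
  have sTM: "subspace (TM p)" unfolding TM using sST sRad by (rule subspace_bundle_sum)
  have ltr_tr: "x \<in> tr p" if "x \<in> ltr p" for x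
    unfolding tr_def using sSTp that by (rule bundle_sum_left)
  have STp_tr: "x \<in> tr p" if "x \<in> STp p" for x
    unfolding tr_def using sltr that by (rule bundle_sum_right)
  have sD01: "subspace (bundle_sum D0 D1 p)" using SD(2,3) by (rule subspace_bundle_sum)
  have D: "D p = bundle_sum (bundle_sum D0 D1) ?JD1 p" unfolding D_def stcr_D_def ..
  show sD: "subspace (D p)" unfolding D using sD01 sJD1 by (rule subspace_bundle_sum)
  show sE: "subspace (E p)" unfolding E_def using SD(4,5) by (rule subspace_bundle_sum)
  have DI: "x + y + z \<in> D p" if "x \<in> D0 p" "y \<in> D1 p" "z \<in> ?JD1 p" for x y z
    unfolding D using that by (intro bundle_sumI)
  have DE: "\<exists>x y z. x \<in> D0 p \<and> y \<in> D1 p \<and> z \<in> ?JD1 p \<and> u = x + y + z" if "u \<in> D p" for u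
    using that unfolding D by (blast elim: bundle_sumE)
  have EI: "x + y \<in> E p" if "x \<in> D2 p" "y \<in> Dp p" for x y
    unfolding E_def using that by (intro bundle_sumI)
  have EE: "\<exists>x y. x \<in> D2 p \<and> y \<in> Dp p \<and> u = x + y" if "u \<in> E p" for u
    using that unfolding E_def by (blast elim: bundle_sumE)
  have STI: "z + y + x \<in> ST p" if "x \<in> D0 p" "y \<in> Dp p" "z \<in> ?JD1 p" for x y z
    unfolding SD(15) using that by (intro bundle_sumI)
  have RadI: "x + y \<in> ?Rad p" if "x \<in> D1 p" "y \<in> D2 p" for x y
    unfolding SD(10) using that by (intro bundle_sumI)
  have zero: "0 \<in> D0 p" "0 \<in> D1 p" "0 \<in> D2 p" "0 \<in> Dp p" "0 \<in> ?JD1 p"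
    using SD(2-5) sJD1 by (simp_all add: subspace_0)
  show "D p \<subseteq> TM p"
  proof
    fix u assume "u \<in> D p"
    from DE[OF this] obtain x y z where u: "x \<in> D0 p" "y \<in> D1 p" "z \<in> ?JD1 p" "u = x + y + z" by blast
    have "(z + 0 + x) + (y + 0) \<in> TM p"
      unfolding TM using STI[OF u(1) zero(4) u(3)] RadI[OF u(2) zero(3)] by (rule bundle_sumI)
    then show "u \<in> TM p" using u(4) by (simp add: algebra_simps)
  qed
  show "E p \<subseteq> TM p"
  proof
    fix u assume "u \<in> E p"
    from EE[OF this] obtain x y where u: "x \<in> D2 p" "y \<in> Dp p" "u = x + y" by blast
    have "(0 + y + 0) + (0 + x) \<in> TM p"
      unfolding TM using STI[OF zero(1) u(2) zero(5)] RadI[OF zero(2) u(1)] by (rule bundle_sumI)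
    then show "u \<in> TM p" using u(3) by (simp add: algebra_simps)
  qed
  show "D p \<inter> E p = {0}"
  proof -
    have "u = 0" if "u \<in> D p" "u \<in> E p" for u
    proof -
      from DE[OF that(1)] obtain x y z where
        u: "x \<in> D0 p" "y \<in> D1 p" "z \<in> ?JD1 p" "u = x + y + z" by blast
      from EE[OF that(2)] obtain s t where v: "s \<in> D2 p" "t \<in> Dp p" "u = s + t" by blast
      \<comment> \<open>Both representations are regrouped as screen part plus radical part; the
        zeros fill the summands absent from \<open>D\<close> or from \<open>E\<close>.\<close>
      have "(z + 0 + x) + (y + 0) = (0 + t + 0) + (0 + s)" using u(4) v(3) by (simp add: algebra_simps)
      from direct_unique[OF sST sRad STRad STI[OF u(1) zero(4) u(3)] STI[OF zero(1) v(2) zero(5)]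
          RadI[OF u(2) zero(3)] RadI[OF zero(2) v(1)] this]
      have eq: "z + x = t" "y = s" by simp_all
      have "y \<in> D1 p \<inter> D2 p" using u(2) v(1) eq(2) by simp
      then have "s = 0" using SD(9) eq(2) by simp
      have "z + (- t) \<in> bundle_sum ?JD1 Dp p"
        using u(3) subspace_neg[OF SD(5) v(2)] by (rule bundle_sumI)
      moreover have "z + (- t) = - x" using eq(1) by (simp add: algebra_simps)
      moreover have "- x \<in> D0 p" using SD(2) u(1) by (rule subspace_neg)
      ultimately have "- x \<in> bundle_sum ?JD1 Dp p \<inter> D0 p" by simp
      then have "x = 0" using SD(14) by simp
      then have "z \<in> ?JD1 p \<inter> Dp p" using u(3) v(2) eq(1) by simp
      then have "t = 0" using SD(13) eq(1) \<open>x = 0\<close> by simp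
      with \<open>s = 0\<close> v(3) show "u = 0" by simp
    qed
    then show ?thesis using subspace_0[OF sD] subspace_0[OF sE] by blast
  qed
  show "\<exists>u\<in>D p. \<exists>w\<in>E p. x = u + w" if "x \<in> TM p" for x
  proof -
    from that obtain s \<rho> where s: "s \<in> ST p" "\<rho> \<in> ?Rad p" "x = s + \<rho>" unfolding TM by (rule bundle_sumE)
    from s(1) obtain z y c where a: "z \<in> ?JD1 p" "y \<in> Dp p" "c \<in> D0 p" "s = z + y + c"
      unfolding SD(15) by (blast elim: bundle_sumE)
    from s(2) obtain d e where b: "d \<in> D1 p" "e \<in> D2 p" "\<rho> = d + e"
      unfolding SD(10) by (blast elim: bundle_sumE)
    have "x = (c + d + z) + (e + y)" using s(3) a(4) b(3) by (simp add: algebra_simps)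
    with DI[OF a(3) b(1) a(1)] EI[OF b(2) a(2)] show ?thesis by blast
  qed
  show "?j u \<in> D p" if "u \<in> D p" for u
  proof -
    from DE[OF that] obtain x y z where u: "x \<in> D0 p" "y \<in> D1 p" "z \<in> ?JD1 p" "u = x + y + z" by blast
    from u(3) obtain y' where y': "y' \<in> D1 p" "z = ?j y'" unfolding bundle_image_def by blast
    have "?j x \<in> D0 p" using JI[of x D0] u(1) SD(16) by simp
    moreover have "- y' \<in> D1 p" using SD(3) y'(1) by (rule subspace_neg)
    ultimately have "?j x + (- y') + ?j y \<in> D p" using JI[of y D1] u(2) by (intro DI)
    then show ?thesis unfolding u(4) y'(2) by (simp add: linear_add[OF J(1)] J(2) algebra_simps)
  qed
  have L1_tr: "x \<in> tr p" if "x \<in> L1 p" for x using that SD(18) ltr_tr by blast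
  have SS_tr: "x \<in> tr p" if "x \<in> SS p" for x using that SD(19) STp_tr by blast
  have JDp: "?j x \<in> tr p" if "x \<in> Dp p" for x
  proof -
    have "?j x \<in> bundle_sum L1 SS p" using JI[of x Dp] that SD(17) by simp
    then obtain l s where "l \<in> L1 p" "s \<in> SS p" "?j x = l + s" by (rule bundle_sumE)
    then show ?thesis using L1_tr SS_tr str by (simp add: subspace_add)
  qed
  have JD2: "?j x \<in> tr p" if "x \<in> D2 p" for x using JI[of x D2] that SD(12) STp_tr by blast
  show "?j u \<in> tr p" if "u \<in> E p" for u
  proof -
    from EE[OF that] obtain x y where u: "x \<in> D2 p" "y \<in> Dp p" "u = x + y" by blast
    then show ?thesis using JD2[OF u(1)] JDp[OF u(2)] str by (simp add: linear_add[OF J(1)] subspace_add)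
  qed
  \<comment> \<open>Elements of this sum are of the form \<open>J y\<close> with \<open>y\<close> in
    \<open>Dp\<close>, and a second \<open>J\<close> returns \<open>- y\<close>.\<close>
  have J_back: "?j x \<in> Dp p" if x: "x \<in> bundle_sum L1 SS p" for x
  proof -
    obtain y where y: "y \<in> Dp p" "x = ?j y" using x unfolding SD(17)[symmetric] bundle_image_def by blast
    then show ?thesis using subspace_neg[OF SD(5) y(1)] by (simp add: J(2))
  qed
  show "\<exists>u\<in>E p. \<exists>w\<in>tr p. ?j x = u + w" if x: "x \<in> tr p" for x
  proof -
    from x obtain l t where lt: "l \<in> ltr p" "t \<in> STp p" "x = l + t" unfolding tr_def by (rule bundle_sumE)
    from lt(1) obtain a b where ab: "a \<in> L1 p" "b \<in> L2 p" "l = a + b"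
      unfolding SD(20) by (rule bundle_sumE)
    from lt(2) obtain c d s where cds: "c \<in> bundle_image J i D2 p" "d \<in> bundle_image J i L2 p" "s \<in> SS p"
      "t = c + d + s" unfolding SD(22) by (blast elim: bundle_sumE)
    from cds(1) obtain c' where cc: "c' \<in> D2 p" "c = ?j c'" unfolding bundle_image_def by blast
    from cds(2) obtain d' where dd: "d' \<in> L2 p" "d = ?j d'" unfolding bundle_image_def by blast
    have jas: "?j (a + s) \<in> Dp p" using ab(1) cds(3) by (intro J_back bundle_sumI)
    have b: "?j b \<in> tr p" using JI[of b L2] ab(2) SD(21) STp_tr by blast
    \<comment> \<open>\<open>J d = - d'\<close> falls back into \<open>L2\<close> and so stays
      transversal, just as \<open>J b\<close> does in \<open>STp\<close>; these parts contribute
      nothing to \<open>B\<close>.\<close>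
    have "d' \<in> ltr p" unfolding SD(20) using SD(6) dd(1) by (rule bundle_sum_right)
    then have d'tr: "- d' \<in> tr p" using ltr_tr str by (simp add: subspace_neg)
    have "- c' + ?j (a + s) \<in> E p" using subspace_neg[OF SD(4) cc(1)] jas by (rule EI)
    moreover have "?j b + (- d') \<in> tr p" using str b d'tr by (rule subspace_add)
    moreover have "?j x = (- c' + ?j (a + s)) + (?j b + (- d'))"
      unfolding lt(3) ab(3) cds(4) cc(2) dd(2) by (simp add: linear_add[OF J(1)] J(2) algebra_simps)
    ultimately show ?thesis by blast
  qed
qed

theorem theorem3p6:
  fixes A :: "('a::{t2_space, second_countable_topology}, 'e::euclidean_space) chart set"
    and J :: "'a \<Rightarrow> 'e \<Rightarrow> 'e"
    and g :: "'a \<Rightarrow> 'e \<Rightarrow> 'e \<Rightarrow> real"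
    and nab :: "'a \<Rightarrow> 'e \<Rightarrow> ('a \<Rightarrow> 'e) \<Rightarrow> 'e"
    and B :: "('b::{t2_space, second_countable_topology}, 'f::euclidean_space) chart set"
    and i :: "'b \<Rightarrow> 'a"
    and q r :: nat
    and ST STp ltr D0 D1 D2 Dp L1 L2 SS :: "'b \<Rightarrow> 'e set"
  defines "D \<equiv> stcr_D J i D0 D1"
    and "tr \<equiv> tr_bundle STp ltr"
  assumes "indefinite_kaehler A J g q nab"
    and "stcr_lightlike_submanifold B A J g i r ST STp ltr D0 D1 D2 Dp L1 L2 SS"
  shows "totally_geodesic_foliation B A i nab tr D \<longleftrightarrow>
    (\<forall>X\<in>sections B A i D. \<forall>Y\<in>sections B A i D. \<forall>p.
       B_op B A i J tr (second_fund_form B A i nab tr X (\<lambda>q. J (i q) (Y q))) p = 0)"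
proof -
  note K = assms(3) and S = assms(4)
  note L = stcr_lightlike_submanifoldD(1)[OF S]
  note LD = lightlike_submanifoldD[OF L]
  note B = LD(1) and i = LD(2)
  from K have A: "smooth_atlas A" and nab: "linear_connection A nab" and acs: "almost_complex_structure A J"
    and g: "bilinear (g p)" "g p v w = g p w v" for p v w
    unfolding indefinite_kaehler_def levi_civita_def semi_riemannian_metric_def by simp_all
  from acs have J: "linear (J p)" "J p (J p v) = - v" for p v
    unfolding almost_complex_structure_def by simp_all
  define E where "E = bundle_sum D2 Dp"
  let ?TM = "tangent_bundle B A i"
  note dec = lightlike_decomposition[where B = B, OF A L g, folded tr_def]
  note split = stcr_decomposition[OF S A g J, folded tr_def D_def E_def]
  note sTM = subspace_tangent_bundle[OF B A i]
  have TMtr: "tr p \<inter> ?TM p = {0}" for p using dec(2)[of p] by blast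
  let ?V = "\<lambda>X Y p. cov_deriv_along B A i nab p (X p) Y"
  let ?C = "induced_conn B A i nab tr" and ?h = "second_fund_form B A i nab tr"
  \<comment> \<open>Stated for arbitrary functions \<open>X\<close> and \<open>Y\<close>, since the
    splitting is pointwise; so it covers \<open>JY\<close> at once.\<close>
  have gauss: "?C X Y p \<in> ?TM p" "?h X Y p \<in> tr p" "?V X Y p = ?C X Y p + ?h X Y p" for X Y p
  proof -
    obtain a b where ab: "a \<in> ?TM p" "b \<in> tr p" "?V X Y p = a + b" using dec(4)[of p "?V X Y p"] by blast
    have "?C X Y p = a" unfolding induced_conn_def ab(3) by (intro component_eq sTM dec(1,2) ab(1,2))
    moreover have "?h X Y p = b" unfolding second_fund_form_def ab(3) add.commute[of a b]
      by (intro component_eq dec(1) sTM TMtr ab(2,1))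
    ultimately show "?C X Y p \<in> ?TM p" "?h X Y p \<in> tr p" "?V X Y p = ?C X Y p + ?h X Y p"
      using ab by simp_all
  qed
  have DTM: "X \<in> sections B A i ?TM" if "X \<in> sections B A i D" for X
    using that split(3) unfolding sections_def by blast
  have par: "?V X (\<lambda>q. J (i q) (Y q)) p = J (i p) (?V X Y p)"
    if X: "X \<in> sections B A i D" and Y: "Y \<in> sections B A i D" for X Y p
  proof -
    obtain w where "\<And>p. X p = tan_map B A i p (w p)" using tangent_sectionE[OF DTM[OF X]] by blast
    moreover have "smooth_along B A i UNIV Y" using Y unfolding sections_def by blast
    ultimately show ?thesis using cov_deriv_along_complex_structure[OF B K i LD(3)] by simp
  qed
  \<comment> \<open>The \<open>E\<close>-component of the induced derivative of \<open>Y\<close> is \<open>- Bh(X, JY)\<close>.\<close>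
  have key: "B_op B A i J tr (?h X (\<lambda>q. J (i q) (Y q))) p \<in> E p \<and>
      ?C X Y p + J (i p) u + B_op B A i J tr (?h X (\<lambda>q. J (i q) (Y q))) p = 0"
    if X: "X \<in> sections B A i D" and Y: "Y \<in> sections B A i D"
      and u: "u \<in> D p" "w \<in> E p" "?C X (\<lambda>q. J (i q) (Y q)) p = u + w" for X Y p u w
  proof -
    let ?JY = "\<lambda>q. J (i q) (Y q)"
    obtain x y where xy: "x \<in> E p" "y \<in> tr p" "J (i p) (?h X ?JY p) = x + y"
      using split(9)[OF gauss(2)] by blast
    have xTM: "x \<in> ?TM p" using xy(1) split(4) by blast
    have Bh: "B_op B A i J tr (?h X ?JY) p = x"
      unfolding B_op_def xy(3) by (intro component_eq sTM dec(1,2) xTM xy(2))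
    have "J (i p) (u + w + ?h X ?JY p) = - (?C X Y p + ?h X Y p)"
    proof -
      have "u + w + ?h X ?JY p = J (i p) (?C X Y p + ?h X Y p)"
        using par[OF X Y, of p] gauss(3)[where X = X and Y = ?JY and p = p]
          gauss(3)[where X = X and Y = Y and p = p] u(3) by simp
      then show ?thesis by (simp only: J(2))
    qed
    then have J_sum: "J (i p) u + J (i p) w + (x + y) = - (?C X Y p + ?h X Y p)"
      by (simp only: linear_add[OF J(1)] xy(3))
    \<comment> \<open>All terms are gathered on one side and sorted into tangential and transversal
      ones, so that uniqueness of the splitting of zero yields the tangential equation.\<close>
    have "(?C X Y p + J (i p) u + x) + (J (i p) w + y + ?h X Y p) =
        (J (i p) u + J (i p) w + (x + y)) + (?C X Y p + ?h X Y p)"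
      by (simp only: ac_simps)
    also have "\<dots> = 0 + 0" unfolding J_sum by simp
    finally have eq: "(?C X Y p + J (i p) u + x) + (J (i p) w + y + ?h X Y p) = 0 + 0" .
    have "?C X Y p + J (i p) u + x \<in> ?TM p"
      using split(7)[OF u(1)] split(3) by (intro subspace_add sTM gauss(1) xTM) blast
    moreover have "J (i p) w + y + ?h X Y p \<in> tr p"
      using gauss(2) split(8)[OF u(2)] xy(2) by (intro subspace_add dec(1))
    ultimately have "?C X Y p + J (i p) u + x = 0"
      using direct_unique(1)[OF sTM dec(1,2) _ subspace_0[OF sTM] _ subspace_0[OF dec(1)] eq] by blast
    with Bh xy(1) show ?thesis by simp
  qed
  show ?thesis
  proof
    assume tg: "totally_geodesic_foliation B A i nab tr D"
    show "\<forall>X\<in>sections B A i D. \<forall>Y\<in>sections B A i D. \<forall>p.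
       B_op B A i J tr (?h X (\<lambda>q. J (i q) (Y q))) p = 0"
    proof (intro ballI allI)
      fix X Y p assume X: "X \<in> sections B A i D" and Y: "Y \<in> sections B A i D"
      let ?x = "B_op B A i J tr (?h X (\<lambda>q. J (i q) (Y q))) p"
      from split(6)[OF gauss(1)] obtain u w where
        u: "u \<in> D p" "w \<in> E p" "?C X (\<lambda>q. J (i q) (Y q)) p = u + w" by blast
      have "?C X Y p \<in> D p"
        using tg X Y unfolding totally_geodesic_foliation_def sections_def by blast
      then have "- (?C X Y p + J (i p) u) \<in> D p"
        using split(7)[OF u(1)] by (intro subspace_neg subspace_add split(1))
      \<comment> \<open>\<open>?x\<close> lies in \<open>E\<close>, and the equation expresses it by
        elements of \<open>D\<close>; the two meet only in zero.\<close>
      moreover have "?x \<in> E p" and eq: "?C X Y p + J (i p) u + ?x = 0"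
        using key[OF X Y u] by simp_all
      moreover have "?x = - (?C X Y p + J (i p) u)" using eq by (metis add_eq_0_iff)
      ultimately have "?x \<in> D p \<inter> E p" by simp
      then show "?x = 0" using split(5) by simp
    qed
  next
    assume Bh: "\<forall>X\<in>sections B A i D. \<forall>Y\<in>sections B A i D. \<forall>p.
       B_op B A i J tr (?h X (\<lambda>q. J (i q) (Y q))) p = 0"
    show "totally_geodesic_foliation B A i nab tr D"
      unfolding totally_geodesic_foliation_def
    proof (intro ballI)
      fix X Y assume X: "X \<in> sections B A i D" and Y: "Y \<in> sections B A i D"
      have "?C X Y p \<in> D p" for p
      proof -
        from split(6)[OF gauss(1)] obtain u w where
          u: "u \<in> D p" "w \<in> E p" "?C X (\<lambda>q. J (i q) (Y q)) p = u + w" by blast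
        \<comment> \<open>Without the \<open>B\<close> term the derivative is \<open>- J u\<close>,
          which stays in the invariant bundle \<open>D\<close>.\<close>
        have "?C X Y p + J (i p) u = 0" using key[OF X Y u] Bh X Y by simp
        then have "?C X Y p = - J (i p) u" by (simp add: add_eq_0_iff2)
        then show ?thesis using subspace_neg[OF split(1) split(7)[OF u(1)]] by simp
      qed
      moreover have "smooth_along B A i UNIV (?C X Y)"
        unfolding tr_def using Y by (intro induced_conn_smooth[OF A L g nab DTM[OF X]]) (simp add: sections_def)
      ultimately show "?C X Y \<in> sections B A i D" unfolding sections_def by blast
    qed
  qed
qed

end
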